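(* Let $k$ be an uncountable, algebraically closed field of characteristic $0$, and let $A$ be a countably generated $k$-algebra that is a noetherian domain. If the quotient division ring $D := Q(A)$ of $A$ does not contain a free $k$-algebra on two generators, then $D$ is left algebraic over every maximal subfield of $D$.
   Context: $Q(A)$ denotes the Ore quotient division ring of the Ore domain $A$; it is a division ring whose center contains $k$. If $D$ is a division ring and $E$ is a division subring (not necessarily central), $D$ is left algebraic over $E$ if for every $x \in D$ there are $m\ge 0$ and $c_0,\dots,c_m\in E$, not all zero, with $\sum_{i=0}^m c_i x^i = 0$. A maximal subfield of $D$ is a (commutative) subfield of $D$ which is maximal with respect to inclusion among subfields. "$D$ contains a free $k$-algebra on two generators" means there are $x,y\in D$ such that the $k$-subalgebra $k\langle x,y\rangle\subseteq D$ is free (noncommutative) on $x,y$. *)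

theory Defs
  imports
    "HOL-Library.Countable_Set"
    "HOL-Library.Poly_Mapping"
    "HOL-Computational_Algebra.Computational_Algebra"
begin

definition ring_homomorphism :: "('a::ring_1 \<Rightarrow> 'b::ring_1) \<Rightarrow> bool" where
  "ring_homomorphism f \<longleftrightarrow>
     f 1 = 1 \<and> (\<forall>x y. f (x + y) = f x + f y) \<and> (\<forall>x y. f (x * y) = f x * f y)"

text \<open>A (unital, associative) \<open>k\<close>-algebra is given by its structure map, a ring homomorphism
  \<open>\<eta>\<close> from \<open>k\<close> into the centre of the ring; the scalar action is \<open>c \<cdot> x = \<eta> c * x\<close>.\<close>

definition algebra_map :: "('k::field \<Rightarrow> 'a::ring_1) \<Rightarrow> bool" where
  "algebra_map \<eta> \<longleftrightarrow> ring_homomorphism \<eta> \<and> (\<forall>c x. \<eta> c * x = x * \<eta> c)"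

inductive_set subalgebra_gen :: "('k::field \<Rightarrow> 'a::ring_1) \<Rightarrow> 'a set \<Rightarrow> 'a set"
  for \<eta> :: "'k::field \<Rightarrow> 'a::ring_1" and S :: "'a set" where
  generator: "x \<in> S \<Longrightarrow> x \<in> subalgebra_gen \<eta> S"
| scalar: "\<eta> c \<in> subalgebra_gen \<eta> S"
| add: "x \<in> subalgebra_gen \<eta> S \<Longrightarrow> y \<in> subalgebra_gen \<eta> S \<Longrightarrow> x + y \<in> subalgebra_gen \<eta> S"
| mult: "x \<in> subalgebra_gen \<eta> S \<Longrightarrow> y \<in> subalgebra_gen \<eta> S \<Longrightarrow> x * y \<in> subalgebra_gen \<eta> S"

definition countably_generated_algebra :: "('k::field \<Rightarrow> 'a::ring_1) \<Rightarrow> bool" where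
  "countably_generated_algebra \<eta> \<longleftrightarrow> (\<exists>S. countable S \<and> subalgebra_gen \<eta> S = UNIV)"

definition left_ideal :: "'a::ring_1 set \<Rightarrow> bool" where
  "left_ideal I \<longleftrightarrow> 0 \<in> I \<and> (\<forall>x\<in>I. \<forall>y\<in>I. x + y \<in> I) \<and> (\<forall>r. \<forall>x\<in>I. r * x \<in> I)"

definition right_ideal :: "'a::ring_1 set \<Rightarrow> bool" where
  "right_ideal I \<longleftrightarrow> 0 \<in> I \<and> (\<forall>x\<in>I. \<forall>y\<in>I. x + y \<in> I) \<and> (\<forall>r. \<forall>x\<in>I. x * r \<in> I)"

definition left_noetherian :: "'a::ring_1 itself \<Rightarrow> bool" where
  "left_noetherian _ \<longleftrightarrow>
     (\<forall>I :: nat \<Rightarrow> 'a set. (\<forall>n. left_ideal (I n)) \<and> (\<forall>n. I n \<subseteq> I (Suc n)) \<longrightarrow>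
        (\<exists>N. \<forall>n\<ge>N. I n = I N))"

definition right_noetherian :: "'a::ring_1 itself \<Rightarrow> bool" where
  "right_noetherian _ \<longleftrightarrow>
     (\<forall>I :: nat \<Rightarrow> 'a set. (\<forall>n. right_ideal (I n)) \<and> (\<forall>n. I n \<subseteq> I (Suc n)) \<longrightarrow>
        (\<exists>N. \<forall>n\<ge>N. I n = I N))"

definition noetherian :: "'a::ring_1 itself \<Rightarrow> bool" where
  "noetherian T \<longleftrightarrow> left_noetherian T \<and> right_noetherian T"

text \<open>The Ore quotient division ring of a two-sided Ore domain \<open>A\<close> is determined up to unique
  isomorphism over \<open>A\<close> as a division ring \<open>D\<close> with an embedding \<open>\<iota>\<close> of \<open>A\<close> such that each
  element of \<open>D\<close> is a left fraction and a right fraction of elements of \<open>A\<close>.\<close>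

definition ore_quotient_division_ring ::
    "('a::ring_1_no_zero_divisors \<Rightarrow> 'd::division_ring) \<Rightarrow> bool" where
  "ore_quotient_division_ring \<iota> \<longleftrightarrow>
     ring_homomorphism \<iota> \<and> inj \<iota> \<and>
     (\<forall>z. \<exists>s a. s \<noteq> 0 \<and> z = inverse (\<iota> s) * \<iota> a) \<and>
     (\<forall>z. \<exists>a s. s \<noteq> 0 \<and> z = \<iota> a * inverse (\<iota> s))"

text \<open>The induced \<open>k\<close>-algebra structure on the quotient division ring.\<close>

lemma algebra_map_ore_quotient:
  fixes \<eta> :: "'k::field \<Rightarrow> 'a::ring_1_no_zero_divisors" and \<iota> :: "'a \<Rightarrow> 'd::division_ring"
  assumes \<eta>: "algebra_map \<eta>" and \<iota>: "ore_quotient_division_ring \<iota>"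
  shows "algebra_map (\<iota> \<circ> \<eta>)"
proof -
  have hom: "ring_homomorphism \<iota>" and inj: "inj \<iota>"
    using \<iota> by (auto simp: ore_quotient_division_ring_def)
  have "\<iota> 0 + \<iota> 0 = \<iota> 0"
    using hom unfolding ring_homomorphism_def by (metis add_0_right)
  hence zero: "\<iota> 0 = 0" by simp
  have comm: "\<iota> (\<eta> c) * \<iota> a = \<iota> a * \<iota> (\<eta> c)" for c a
    using \<eta> hom unfolding algebra_map_def ring_homomorphism_def by metis
  have central: "\<iota> (\<eta> c) * z = z * \<iota> (\<eta> c)" for c z
  proof -
    obtain s a where s: "s \<noteq> 0" and z: "z = inverse (\<iota> s) * \<iota> a"
      using \<iota> unfolding ore_quotient_division_ring_def by blast
    have nz: "\<iota> s \<noteq> 0" using s zero injD[OF inj, of s 0] by auto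
    have sz: "\<iota> s * z = \<iota> a"
      unfolding z mult.assoc[symmetric] using nz by simp
    have "\<iota> s * (\<iota> (\<eta> c) * z) = \<iota> (\<eta> c) * (\<iota> s * z)"
      by (simp only: mult.assoc[symmetric] comm[of c s])
    also have "\<dots> = \<iota> a * \<iota> (\<eta> c)"
      by (simp only: sz comm[of c a])
    also have "\<dots> = \<iota> s * (z * \<iota> (\<eta> c))"
      by (simp only: sz mult.assoc[symmetric])
    finally show ?thesis using nz by simp
  qed
  have "ring_homomorphism \<eta>"
    using \<eta> unfolding algebra_map_def by blast
  with hom have "ring_homomorphism (\<iota> \<circ> \<eta>)"
    by (simp add: ring_homomorphism_def)
  with central show ?thesis
    unfolding algebra_map_def comp_apply by blast
qed

text \<open>The free monoid on a set of letters, written additively because \<^typ>\<open>'m \<Rightarrow>\<^sub>0 'k\<close> carries the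
  multiplication of the monoid algebra for an additive monoid \<^typ>\<open>'m\<close>. The free \<open>k\<close>-algebra
  on two generators is the monoid algebra of the free monoid on the two letters \<^const>\<open>True\<close>
  and \<^const>\<open>False\<close>.\<close>

datatype 'a word = Word (letters: "'a list")

instantiation word :: (type) monoid_add
begin

definition zero_word :: "'a word" where "0 = Word []"

definition plus_word :: "'a word \<Rightarrow> 'a word \<Rightarrow> 'a word" where
  "u + v = Word (letters u @ letters v)"

instance
  by standard (simp_all add: zero_word_def plus_word_def)

end

type_synonym 'k free_algebra2 = "bool word \<Rightarrow>\<^sub>0 'k"

definition free_scalar :: "'k::field \<Rightarrow> 'k free_algebra2" where
  "free_scalar c = Poly_Mapping.single 0 c"

definition free_gen :: "bool \<Rightarrow> 'k::field free_algebra2" where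
  "free_gen b = Poly_Mapping.single (Word [b]) 1"

definition freely_generates :: "('k::field \<Rightarrow> 'd::ring_1) \<Rightarrow> 'd \<Rightarrow> 'd \<Rightarrow> bool" where
  "freely_generates \<eta> x y \<longleftrightarrow>
     (\<exists>\<phi> :: 'k free_algebra2 \<Rightarrow> 'd.
        ring_homomorphism \<phi> \<and> (\<forall>c. \<phi> (free_scalar c) = \<eta> c) \<and>
        \<phi> (free_gen True) = x \<and> \<phi> (free_gen False) = y \<and>
        bij_betw \<phi> UNIV (subalgebra_gen \<eta> {x, y}))"

definition contains_free_algebra2 :: "('k::field \<Rightarrow> 'd::ring_1) \<Rightarrow> bool" where
  "contains_free_algebra2 \<eta> \<longleftrightarrow> (\<exists>x y. freely_generates \<eta> x y)"

definition is_subfield :: "'d::division_ring set \<Rightarrow> bool" where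
  "is_subfield E \<longleftrightarrow>
     0 \<in> E \<and> 1 \<in> E \<and>
     (\<forall>x\<in>E. \<forall>y\<in>E. x + y \<in> E \<and> x * y \<in> E \<and> x * y = y * x) \<and>
     (\<forall>x\<in>E. - x \<in> E \<and> (x \<noteq> 0 \<longrightarrow> inverse x \<in> E))"

definition maximal_subfield :: "'d::division_ring set \<Rightarrow> bool" where
  "maximal_subfield E \<longleftrightarrow> is_subfield E \<and> (\<forall>F. is_subfield F \<and> E \<subseteq> F \<longrightarrow> F = E)"

definition left_algebraic_over :: "'d::division_ring set \<Rightarrow> bool" where
  "left_algebraic_over E \<longleftrightarrow>
     (\<forall>x. \<exists>(m::nat) c. (\<forall>i\<le>m. c i \<in> E) \<and> (\<exists>i\<le>m. c i \<noteq> 0) \<and> (\<Sum>i\<le>m. c i * x ^ i) = 0)"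

end

theory Submission
  imports Defs
begin

text \<open>
  Write \<open>[e, u] = e u - u e\<close> and \<open>C(e)\<close> for the centralizer of \<open>e\<close>. The theorem is proved by
  contraposition at every stage but the last: a failure of algebraicity is turned into a free pair.
  
  Free pairs come from iterated integrals. In the rational function ring \<open>D(s)\<close>, with \<open>s\<close> central,
  put \<open>p = s - e\<close>. Multiplying a relation between words in \<open>p\<^sup>-\<^sup>1 f\<close> and \<open>p\<^sup>-\<^sup>1 g\<close> by \<open>p\<close> from the
  left shortens each word and applies the derivation \<open>- [e, \<cdot>]\<close> to its coefficient, exactly as
  differentiation does with a relation between polylogarithms. Hence, as for polylogarithms, the words
  are independent as soon as no nontrivial combination \<open>a f + b g\<close> with \<open>a, b \<in> C(e)\<close> is a
  commutator \<open>[e, u]\<close> (\<open>words_left_independent\<close>, \<open>free_over_center_ratfun\<close>). A free pair in \<open>D(s)\<close>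
  specializes to one in \<open>D\<close>, because only finitely many central values of \<open>s\<close> create a relation of
  given length and the center is uncountable (\<open>free_over_center_descends\<close>).
  
  Suitable \<open>f\<close> and \<open>g\<close> are resolvents \<open>(s - y)\<^sup>-\<^sup>1\<close>. If \<open>(s - y)\<^sup>-\<^sup>1\<close> were a commutator \<open>[e, u]\<close> with
  \<open>u\<close> rational, then the poles of \<open>u\<close> would span a finite dimensional space containing all
  \<open>(s - y)\<^sup>-\<^sup>1 e\<^sup>i\<close>, and this forces \<open>e\<close> to be left algebraic over \<open>C(y)\<close>, unless \<open>y\<close> is left algebraic
  over \<open>C(e)\<close> (\<open>commutator_obstruction\<close>). If only \<open>y\<close> is known to be left transcendental over \<open>C(e)\<close>,
  the pair \<open>e + s y\<close>, \<open>y + s e\<close> is transcendental both ways, as its values at \<open>s = 0\<close> and at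
  \<open>s = \<infinity>\<close> show. So without free pairs every \<open>y\<close> is left algebraic over every \<open>C(e)\<close>
  (\<open>powers_dependent_if_not_free\<close>), in \<open>D\<close> and in \<open>D(s)\<close> alike.
  
  Characteristic \<open>0\<close> enters through the Weyl algebra: if \<open>[e, y] = 1\<close> then \<open>y\<close> is left transcendental
  over \<open>C(e)\<close>. Therefore \<open>[e, [e, u]] = 0\<close> implies \<open>[e, u] = 0\<close>, and this makes a generic combination
  \<open>e\<^sub>0 + s\<^sup>-\<^sup>1 e\<^sub>1 + \<dots>\<close> of commuting elements commute only with series whose coefficients commute with
  every \<open>e\<^sub>i\<close> (\<open>generic_combination_centralizer\<close>). So \<open>D\<close> is left algebraic over the common
  centralizer of finitely many commuting elements (\<open>left_algebraic_over_finite_centralizer\<close>).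
  
  A maximal subfield is its own centralizer, and the noetherian hypothesis makes it the centralizer of a
  finite subset: otherwise a strictly descending chain of centralizers would specialize, along a
  character of a countably generated subalgebra of the subfield, to a strictly ascending chain of left
  ideals of \<open>A\<close> (\<open>subfield_finite_centralizer\<close>). Such characters exist because \<open>k\<close> is uncountable and
  algebraically closed (\<open>countable_algebra_character\<close>).
\<close>

unbundle fps_syntax

section \<open>Polynomials and rational functions over a division ring\<close>

text \<open>
  The ring \<open>D[s]\<close> in one central variable, realized inside the Laurent series in \<open>X = s\<^sup>-\<^sup>1\<close>, where
  rational functions and their expansions at \<open>s = \<infinity>\<close> are available as well. Thus \<open>s\<close> is
  \<^const>\<open>fls_X_inv\<close>, the coefficient of \<open>s\<^sup>n\<close> has index \<open>- n\<close>, and membership in \<open>polys\<close> says that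
  a series has no polar part in \<open>s\<close>.
\<close>
definition polys :: "'d::division_ring fls set" where
  "polys = {q. \<forall>n>0. q $$ n = 0}"

definition pdeg :: "'d::division_ring fls \<Rightarrow> nat" where
  "pdeg q = nat (- fls_subdegree q)"

lemma polysI: "(\<And>n. n > 0 \<Longrightarrow> q $$ n = 0) \<Longrightarrow> q \<in> polys"
  by (auto simp: polys_def)

lemma polysD: "q \<in> polys \<Longrightarrow> n > 0 \<Longrightarrow> q $$ n = 0"
  by (auto simp: polys_def)

lemma polys_0 [simp]: "0 \<in> polys"
  and polys_1 [simp]: "1 \<in> polys"
  and polys_const [simp]: "fls_const c \<in> polys"
  by (auto intro!: polysI)

lemma polys_X_inv [simp]: "fls_X_inv ^ n \<in> polys" "fls_X_inv \<in> polys"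
  by (auto intro!: polysI)

lemma polys_add: "p \<in> polys \<Longrightarrow> q \<in> polys \<Longrightarrow> p + q \<in> polys"
  and polys_diff: "p \<in> polys \<Longrightarrow> q \<in> polys \<Longrightarrow> p - q \<in> polys"
  and polys_uminus: "p \<in> polys \<Longrightarrow> - p \<in> polys"
  by (auto simp: polys_def)

lemma polys_sum: "(\<And>i. i \<in> I \<Longrightarrow> f i \<in> polys) \<Longrightarrow> sum f I \<in> polys"
  by (induction I rule: infinite_finite_induct) (auto intro: polys_add)

lemma polys_nth_above_pdeg:
  assumes "pdeg q < n" shows "q $$ (- int n) = 0"
  using assms by (intro fls_eq0_below_subdegree) (auto simp: pdeg_def)

lemma polys_subdegree:
  assumes "q \<in> polys" shows "fls_subdegree q = - int (pdeg q)"
proof (cases "q = 0")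
  case False
  have "fls_subdegree q \<le> 0"
    using polysD[OF assms, of "fls_subdegree q"] nth_fls_subdegree_nonzero[OF False] by linarith
  thus ?thesis by (simp add: pdeg_def)
qed (simp add: pdeg_def)

lemma polys_lead_nonzero: "q \<in> polys \<Longrightarrow> q \<noteq> 0 \<Longrightarrow> q $$ (- int (pdeg q)) \<noteq> 0"
  by (metis nth_fls_subdegree_nonzero polys_subdegree)

lemma pdeg_less:
  assumes "q \<in> polys" "q \<noteq> 0" "\<And>n. n \<ge> N \<Longrightarrow> q $$ (- int n) = 0"
  shows "pdeg q < N"
  using polys_lead_nonzero[OF assms(1,2)] assms(3)[of "pdeg q"] by (meson not_less)

lemma polys_expand:
  assumes "q \<in> polys" "pdeg q \<le> N"
  shows "q = (\<Sum>j\<le>N. fls_const (q $$ (- int j)) * fls_X_inv ^ j)"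
proof (intro fls_eqI)
  fix n
  have "(\<Sum>j\<le>N. fls_const (q $$ (- int j)) * fls_X_inv ^ j) $$ n
      = (\<Sum>j\<le>N. if n = - int j then q $$ n else 0)"
    by (simp add: fls_nth_sum fls_X_inv_power_times_conv_shift) (rule sum.cong, auto)
  also have "\<dots> = q $$ n"
  proof (cases "\<exists>j\<le>N. n = - int j")
    case True
    then obtain j where j: "j \<le> N" "n = - int j" by blast
    have "(\<Sum>i\<le>N. if n = - int i then q $$ n else 0) = (\<Sum>i\<le>N. if i = j then q $$ n else 0)"
      using j by (intro sum.cong) auto
    thus ?thesis using j by simp
  next
    case False
    have "q $$ n = 0"
    proof (cases "n > 0")
      case True thus ?thesis using assms(1) polysD by blast
    next
      case f: False
      then obtain k where k: "n = - int k" by (metis int_cases2 nonneg_int_cases not_less zero_le_imp_eq_int neg_0_less_iff_less minus_equation_iff)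
      have "\<not> k \<le> N" using False k by auto
      hence "k > N" by simp
      thus ?thesis using k assms(2) polys_nth_above_pdeg[of q k] by simp
    qed
    moreover have "(\<Sum>j\<le>N. if n = - int j then q $$ n else 0) = 0"
      using False by (intro sum.neutral) auto
    ultimately show ?thesis by simp
  qed
  finally show "q $$ n = (\<Sum>j\<le>N. fls_const (q $$ (- int j)) * fls_X_inv ^ j) $$ n" ..
qed

text \<open>
  The only product formula that is needed: multiplication by a polynomial in \<open>s\<close> acts on the
  coefficients of an arbitrary series as a finite difference operator.
\<close>
lemma polys_times_nth:
  assumes "q \<in> polys" "pdeg q \<le> N"
  shows "(q * z) $$ m = (\<Sum>j\<le>N. q $$ (- int j) * z $$ (m + int j))"
proof -
  have "(q * z) $$ m = (\<Sum>j\<le>N. (fls_const (q $$ (- int j)) * (fls_X_inv ^ j * z)) $$ m)"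
    by (subst polys_expand[OF assms]) (simp add: sum_distrib_right fls_nth_sum mult.assoc)
  thus ?thesis by (simp add: fls_X_inv_power_times_conv_shift)
qed

lemma polys_mult: assumes "p \<in> polys" "q \<in> polys" shows "p * q \<in> polys"
proof (rule polysI)
  fix n :: int assume "n > 0"
  thus "(p * q) $$ n = 0"
    unfolding polys_times_nth[OF assms(1) order_refl]
    by (intro sum.neutral) (auto simp: polysD[OF assms(2)])
qed

lemma pdeg_mult:
  assumes "p \<in> polys" "q \<in> polys" "p \<noteq> 0" "q \<noteq> 0"
  shows "pdeg (p * q) = pdeg p + pdeg q"
proof -
  have "fls_subdegree (p * q) = - int (pdeg p + pdeg q)"
    using assms polys_subdegree[of p] polys_subdegree[of q] by simp
  thus ?thesis unfolding pdeg_def[of "p * q"] by simp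
qed

lemma X_inv_commutes: "fls_X_inv * z = z * (fls_X_inv :: 'd::division_ring fls)"
  by (simp add: fls_X_inv_times_conv_shift)

lemma X_commutes: "fls_X * z = z * (fls_X :: 'd::division_ring fls)"
  by (simp add: fls_X_times_conv_shift)

lemma polys_reduce:
  assumes u: "u \<in> polys" "u \<noteq> 0" and v: "v \<in> polys" "v \<noteq> 0" and le: "pdeg v \<le> pdeg u"
  shows "\<exists>t\<in>polys. t \<noteq> 0 \<and> (u - t * v = 0 \<or> pdeg (u - t * v) < pdeg u)"
proof -
  define k where "k = pdeg u - pdeg v"
  define c where "c = u $$ (- int (pdeg u)) * inverse (v $$ (- int (pdeg v)))"
  define t where "t = fls_const c * fls_X_inv ^ k"
  have c0: "c \<noteq> 0"
    using polys_lead_nonzero[OF u] polys_lead_nonzero[OF v] by (simp add: c_def)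
  have t: "t \<in> polys" by (simp add: t_def polys_mult)
  have tv: "t * v \<in> polys" using t v by (simp add: polys_mult)
  have nth: "(t * v) $$ n = c * v $$ (n + int k)" for n
    unfolding t_def mult.assoc fls_X_inv_power_times_conv_shift(1) by simp
  have "u - t * v \<noteq> 0 \<Longrightarrow> pdeg (u - t * v) < pdeg u"
  proof -
    assume ne: "u - t * v \<noteq> 0"
    have "pdeg (u - t * v) < Suc (pdeg u)"
    proof (rule pdeg_less[OF polys_diff[OF u(1) tv] ne])
      fix n assume n: "Suc (pdeg u) \<le> n"
      have "v $$ (- int (n - k)) = 0" by (rule polys_nth_above_pdeg) (use n le in \<open>simp add: k_def\<close>)
      moreover have e: "- int n + int k = - int (n - k)" using n le by (simp add: k_def)
      have "(u - t * v) $$ (- int n) = u $$ (- int n) - c * v $$ (- int (n - k))"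
        unfolding fls_minus_nth nth e ..
      ultimately show "(u - t * v) $$ (- int n) = 0"
        using n polys_nth_above_pdeg[of u n] by simp
    qed
    moreover have "pdeg (u - t * v) \<noteq> pdeg u"
    proof
      assume eq: "pdeg (u - t * v) = pdeg u"
      have "(u - t * v) $$ (- int (pdeg u)) \<noteq> 0"
        using polys_lead_nonzero[OF polys_diff[OF u(1) tv] ne] eq by simp
      moreover have e: "- int (pdeg u) + int k = - int (pdeg v)" using le by (simp add: k_def)
      have "(u - t * v) $$ (- int (pdeg u)) = u $$ (- int (pdeg u)) - c * v $$ (- int (pdeg v))"
        unfolding fls_minus_nth nth e ..
      ultimately show False using polys_lead_nonzero[OF v] by (simp add: c_def mult.assoc)
    qed
    ultimately show ?thesis by simp
  qed
  moreover have "t \<noteq> 0"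
    using c0 by (simp add: t_def)
  ultimately show ?thesis using t by blast
qed

lemma polys_division:
  assumes v: "v \<in> polys" "v \<noteq> 0" and "u \<in> polys"
  shows "\<exists>q\<in>polys. u - q * v = 0 \<or> pdeg (u - q * v) < pdeg v"
  using assms(3)
proof (induction "pdeg u" arbitrary: u rule: less_induct)
  case less
  show ?case
  proof (cases "u = 0 \<or> pdeg u < pdeg v")
    case True
    thus ?thesis by (intro bexI[of _ 0]) auto
  next
    case False
    then obtain t where t: "t \<in> polys" "u - t * v = 0 \<or> pdeg (u - t * v) < pdeg u"
      using polys_reduce[of u v] less.prems v by auto
    show ?thesis
    proof (cases "u - t * v = 0")
      case True thus ?thesis using t by blast
    next
      case False
      then obtain q where q: "q \<in> polys" "u - t * v - q * v = 0 \<or> pdeg (u - t * v - q * v) < pdeg v"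
        using less.hyps[of "u - t * v"] t less.prems v by (auto simp: polys_diff polys_mult)
      have "u - t * v - q * v = u - (t + q) * v" by (simp add: algebra_simps)
      with q(2) have "u - (t + q) * v = 0 \<or> pdeg (u - (t + q) * v) < pdeg v" by metis
      thus ?thesis using polys_add[OF t(1) q(1)] by blast
    qed
  qed
qed

text \<open>
  The left Ore condition, by the Euclidean algorithm: subtract a multiple of the polynomial of
  smaller degree from the other and recurse.
\<close>
lemma polys_left_ore:
  fixes u v :: "'d::division_ring fls"
  assumes "u \<in> polys" "u \<noteq> 0" "v \<in> polys" "v \<noteq> 0"
  shows "\<exists>a\<in>polys. \<exists>b\<in>polys. a \<noteq> 0 \<and> b \<noteq> 0 \<and> a * u = b * v"
  using assms
proof (induction "pdeg u + pdeg v" arbitrary: u v rule: less_induct)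
  case less
  have main: "\<exists>a\<in>polys. \<exists>b\<in>polys. a \<noteq> 0 \<and> b \<noteq> 0 \<and> a * x = b * w"
    if x: "x \<in> polys" "x \<noteq> 0" and w: "w \<in> polys" "w \<noteq> 0" and le: "pdeg w \<le> pdeg x"
      and sum: "pdeg x + pdeg w = pdeg u + pdeg v" for x w :: "'d fls"
  proof -
    obtain t where t: "t \<in> polys" "t \<noteq> 0" "x - t * w = 0 \<or> pdeg (x - t * w) < pdeg x"
      using polys_reduce[OF x w le] by blast
    show ?thesis
    proof (cases "x - t * w = 0")
      case True
      thus ?thesis using t by (intro bexI[of _ 1] bexI[of _ t]) auto
    next
      case False
      then obtain a b where ab: "a \<in> polys" "b \<in> polys" "a \<noteq> 0" "a * (x - t * w) = b * w"
      proof -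
        have "pdeg (x - t * w) + pdeg w < pdeg u + pdeg v" using t(3) sum False by linarith
        from less.hyps[OF this polys_diff[OF x(1) polys_mult[OF t(1) w(1)]] False w] that
        show ?thesis by blast
      qed
      have eq: "a * x = (b + a * t) * w" using ab by (simp add: algebra_simps)
      moreover have "b + a * t \<noteq> 0" using eq ab x by auto
      ultimately show ?thesis
        using ab t by (intro bexI[of _ a] bexI[of _ "b + a * t"]) (auto simp: polys_add polys_mult)
    qed
  qed
  show ?case
  proof (cases "pdeg v \<le> pdeg u")
    case True thus ?thesis using main[of u v] less.prems by blast
  next
    case False
    hence "pdeg u \<le> pdeg v" "pdeg v + pdeg u = pdeg u + pdeg v" by simp_all
    then obtain a b where ab: "a \<in> polys" "b \<in> polys" "a \<noteq> 0" "b \<noteq> 0" "a * v = b * u"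
      using main[of v u] less.prems by blast
    from ab(5) have "b * u = a * v" ..
    with ab show ?thesis by blast
  qed
qed

text \<open>
  Left fractions of polynomials. By the Ore condition they form a division subring, the quotient
  division ring \<open>D(s)\<close>.
\<close>
definition rational_fls :: "'d::division_ring fls set" where
  "rational_fls = {z. \<exists>g\<in>polys. g \<noteq> 0 \<and> g * z \<in> polys}"

lemma rational_flsI: "g \<in> polys \<Longrightarrow> g \<noteq> 0 \<Longrightarrow> g * z \<in> polys \<Longrightarrow> z \<in> rational_fls"
  by (auto simp: rational_fls_def)

lemma rational_common_denominator:
  assumes "finite S" "S \<subseteq> rational_fls"
  shows "\<exists>g\<in>polys. g \<noteq> 0 \<and> (\<forall>z\<in>S. g * z \<in> polys)"
  using assms
proof (induction S rule: finite_induct)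
  case empty
  show ?case by (intro bexI[of _ 1]) auto
next
  case (insert z S)
  then obtain g where g: "g \<in> polys" "g \<noteq> 0" "\<forall>z\<in>S. g * z \<in> polys" by blast
  obtain h where h: "h \<in> polys" "h \<noteq> 0" "h * z \<in> polys"
    using insert.prems by (auto simp: rational_fls_def)
  obtain a b where ab: "a \<in> polys" "b \<in> polys" "a \<noteq> 0" "b \<noteq> 0" "a * g = b * h"
    using polys_left_ore[OF g(1,2) h(1,2)] by blast
  have "a * g * z \<in> polys" using ab h by (simp add: mult.assoc polys_mult)
  moreover have "a * g * w \<in> polys" if "w \<in> S" for w
    unfolding mult.assoc using polys_mult[OF ab(1)] g(3) that by blast
  ultimately show ?case
    using ab(1,3) g(1,2) by (intro bexI[of _ "a * g"]) (auto simp: polys_mult)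
qed

lemma rational_polys: "p \<in> polys \<Longrightarrow> p \<in> rational_fls"
  by (rule rational_flsI[of 1]) auto

lemma rational_add: assumes "z \<in> rational_fls" "w \<in> rational_fls" shows "z + w \<in> rational_fls"
proof -
  obtain g where "g \<in> polys" "g \<noteq> 0" "g * z \<in> polys" "g * w \<in> polys"
    using rational_common_denominator[of "{z, w}"] assms by auto
  thus ?thesis by (intro rational_flsI[of g]) (auto simp: distrib_left polys_add)
qed

lemma rational_mult: assumes z: "z \<in> rational_fls" and w: "w \<in> rational_fls" shows "z * w \<in> rational_fls"
proof -
  obtain g where g: "g \<in> polys" "g \<noteq> 0" "g * z \<in> polys" using z by (auto simp: rational_fls_def)
  obtain h where h: "h \<in> polys" "h \<noteq> 0" "h * w \<in> polys" using w by (auto simp: rational_fls_def)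
  show ?thesis
  proof (cases "g * z = 0")
    case True
    hence "z = 0" using g by simp
    thus ?thesis by (simp add: rational_polys)
  next
    case False
    then obtain a b where ab: "a \<in> polys" "b \<in> polys" "a \<noteq> 0" "b \<noteq> 0" "a * (g * z) = b * h"
      using polys_left_ore[OF g(3) _ h(1,2)] by blast
    have "(a * g) * (z * w) = b * (h * w)" using ab by (metis mult.assoc)
    thus ?thesis using ab g h by (intro rational_flsI[of "a * g"]) (auto simp: polys_mult)
  qed
qed

lemma rational_uminus: "z \<in> rational_fls \<Longrightarrow> - z \<in> rational_fls"
  using rational_mult[of "-1" z] by (simp add: rational_polys polys_uminus)

lemma rational_inverse: assumes "z \<in> rational_fls" shows "inverse z \<in> rational_fls"
proof (cases "z = 0")
  case False
  obtain g where g: "g \<in> polys" "g \<noteq> 0" "g * z \<in> polys" using assms by (auto simp: rational_fls_def)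
  have "g * z * inverse z = g" using False by (simp add: mult.assoc)
  thus ?thesis using g False by (intro rational_flsI[of "g * z"]) auto
qed (simp add: rational_polys)

typedef (overloaded) 'd ratfun = "rational_fls :: 'd::division_ring fls set"
  morphisms fls_of_ratfun ratfun_of_fls
  by (rule exI[of _ 0]) (simp add: rational_polys)

setup_lifting type_definition_ratfun

instantiation ratfun :: (division_ring) division_ring
begin
lift_definition zero_ratfun :: "'a ratfun" is 0 by (simp add: rational_polys)
lift_definition one_ratfun :: "'a ratfun" is 1 by (simp add: rational_polys)
lift_definition plus_ratfun :: "'a ratfun \<Rightarrow> 'a ratfun \<Rightarrow> 'a ratfun" is "(+)" by (rule rational_add)
lift_definition uminus_ratfun :: "'a ratfun \<Rightarrow> 'a ratfun" is uminus by (rule rational_uminus)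
lift_definition minus_ratfun :: "'a ratfun \<Rightarrow> 'a ratfun \<Rightarrow> 'a ratfun" is "(-)"
  using rational_add rational_uminus by fastforce
lift_definition times_ratfun :: "'a ratfun \<Rightarrow> 'a ratfun \<Rightarrow> 'a ratfun" is "(*)" by (rule rational_mult)
lift_definition inverse_ratfun :: "'a ratfun \<Rightarrow> 'a ratfun" is inverse by (rule rational_inverse)
definition divide_ratfun :: "'a ratfun \<Rightarrow> 'a ratfun \<Rightarrow> 'a ratfun" where
  "divide_ratfun x y = x * inverse y"
instance
  by (standard; (rule divide_ratfun_def | (transfer,
      simp add: add.assoc add.commute mult.assoc distrib_left distrib_right)))
end

section \<open>Left algebraicity over a centralizer\<close>

text \<open>
  Left algebraicity of \<open>y\<close> over the centralizer of \<open>e\<close>, in a form that mentions no centralizer: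
  the coefficients \<open>d\<close> are arbitrary, but one relation has to hold for all powers of \<open>e\<close> at once.
  This form is linear in \<open>d\<close>, so it survives taking coefficients of series and clearing denominators.
\<close>
definition dependent_powers :: "'d::division_ring \<Rightarrow> 'd \<Rightarrow> bool" where
  "dependent_powers e y \<longleftrightarrow>
     (\<exists>(m::nat) d. (\<exists>i\<le>m. d i \<noteq> 0) \<and> (\<forall>n. (\<Sum>i\<le>m. d i * e ^ n * y ^ i) = 0))"

text \<open>
  In a shortest relation with leading coefficient \<open>1\<close>, the commutators of the coefficients with
  \<open>e\<close> give a shorter relation, so they vanish.
\<close>
lemma dependent_powers_commuting_coefficients:
  assumes "dependent_powers e y"
  shows "\<exists>(m::nat) c. (\<forall>i\<le>m. c i * e = e * c i) \<and> (\<exists>i\<le>m. c i \<noteq> 0) \<and> (\<Sum>i\<le>m. c i * y ^ i) = 0"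
proof -
  define P where "P = (\<lambda>m d. (\<exists>i\<le>m. d i \<noteq> 0) \<and> (\<forall>n. (\<Sum>i\<le>m. d i * e ^ n * y ^ i) = 0))"
  have ex: "\<exists>m. \<exists>d. P m d" using assms unfolding dependent_powers_def P_def .
  obtain m where "\<exists>d. P m d" and "\<forall>k<m. \<not> (\<exists>d. P k d)"
    using exists_least_iff[THEN iffD1, OF ex] by blast
  then obtain d where d: "P m d" and least: "\<And>k d'. k < m \<Longrightarrow> \<not> P k d'" by blast
  have dm: "d m \<noteq> 0"
  proof
    assume z: "d m = 0"
    with d obtain i where i: "i \<le> m" "d i \<noteq> 0" "i \<noteq> m" by (auto simp: P_def)
    then obtain k where k: "m = Suc k" by (cases m) auto
    have "P k d" using d i z by (auto simp: P_def k le_Suc_eq)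
    thus False using least[of k] k by simp
  qed
  define c where "c i = inverse (d m) * d i" for i
  have c: "(\<Sum>i\<le>m. c i * e ^ n * y ^ i) = 0" for n
  proof -
    have "(\<Sum>i\<le>m. c i * e ^ n * y ^ i) = inverse (d m) * (\<Sum>i\<le>m. d i * e ^ n * y ^ i)"
      by (simp add: c_def sum_distrib_left mult.assoc)
    thus ?thesis using d by (simp add: P_def)
  qed
  have cm: "c m = 1" using dm by (simp add: c_def)
  define b where "b i = c i * e - e * c i" for i
  have b: "(\<Sum>i\<le>m. b i * e ^ n * y ^ i) = 0" for n
  proof -
    have "(\<Sum>i\<le>m. b i * e ^ n * y ^ i)
        = (\<Sum>i\<le>m. c i * e ^ Suc n * y ^ i) - e * (\<Sum>i\<le>m. c i * e ^ n * y ^ i)"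
      by (simp add: b_def sum_distrib_left sum_subtractf algebra_simps)
    thus ?thesis by (simp only: c mult_zero_right diff_self)
  qed
  have bz: "b i = 0" if "i \<le> m" for i
  proof (cases m)
    case 0 thus ?thesis using that cm by (simp add: b_def)
  next
    case (Suc k)
    have "b m = 0" using cm by (simp add: b_def)
    hence "(\<Sum>i\<le>k. b i * e ^ n * y ^ i) = 0" for n using b[of n] Suc by simp
    hence "\<forall>i\<le>k. b i = 0" using least[of k b] Suc by (auto simp: P_def)
    thus ?thesis using that Suc \<open>b m = 0\<close> by (auto simp: le_Suc_eq)
  qed
  show ?thesis
  proof (intro exI conjI allI impI)
    show "c i * e = e * c i" if "i \<le> m" for i using bz[OF that] by (simp add: b_def)
    show "m \<le> m" "c m \<noteq> 0" using cm by auto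
    show "(\<Sum>i\<le>m. c i * y ^ i) = 0" using c[of 0] by simp
  qed
qed

lemma dependent_powersI:
  assumes "\<And>i. i \<le> m \<Longrightarrow> c i * e = e * c i" "i \<le> m" "c i \<noteq> 0" "(\<Sum>i\<le>(m::nat). c i * y ^ i) = 0"
  shows "dependent_powers e y"
proof -
  have com: "c i * e ^ n = e ^ n * c i" if "i \<le> m" for i n
    using power_commuting_commutes[of e "c i" n, OF assms(1)[OF that, symmetric]] by simp
  have "(\<Sum>i\<le>m. c i * e ^ n * y ^ i) = e ^ n * (\<Sum>i\<le>m. c i * y ^ i)" for n
    by (simp add: com sum_distrib_left mult.assoc)
  thus ?thesis unfolding dependent_powers_def
    using assms(2-4) by (intro exI[of _ m] exI[of _ c]) auto
qed

lemma monic_minimal_denominator: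
  assumes "z \<in> rational_fls"
  obtains g where "g \<in> polys" "g \<noteq> 0" "g * z \<in> polys" "g $$ (- int (pdeg g)) = 1"
    "\<And>h. h \<in> polys \<Longrightarrow> h * z \<in> polys \<Longrightarrow> h \<noteq> 0 \<Longrightarrow> pdeg g \<le> pdeg h"
proof -
  define P where "P g \<longleftrightarrow> g \<in> polys \<and> g \<noteq> 0 \<and> g * z \<in> polys" for g
  have "\<exists>g. P g" using assms by (auto simp: P_def rational_fls_def)
  then obtain g where g: "P g" and least: "\<And>h. P h \<Longrightarrow> pdeg g \<le> pdeg h"
    using exists_least_iff[of "\<lambda>n. \<exists>g. P g \<and> pdeg g = n"] by (metis not_less)
  define c where "c = inverse (g $$ (- int (pdeg g)))"
  have c: "c \<noteq> 0" using g polys_lead_nonzero[of g] by (simp add: c_def P_def)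
  define f where "f = fls_const c * g"
  have f: "f \<in> polys" "f \<noteq> 0" "f * z \<in> polys"
    using g c polys_mult[of "fls_const c"] by (simp_all add: f_def P_def mult.assoc)
  have "pdeg f = pdeg g"
    using pdeg_mult[of "fls_const c" g] g c by (simp add: f_def P_def pdeg_def)
  moreover have "f $$ (- int (pdeg g)) = 1"
    using g polys_lead_nonzero[of g] by (simp add: f_def c_def P_def)
  ultimately show ?thesis using f least by (intro that[of f]) (auto simp: P_def)
qed

lemma commutator_const_monic_pdeg:
  assumes g: "g \<in> polys" "g $$ (- int (pdeg g)) = 1"
    and ne: "fls_const t * g - g * fls_const t \<noteq> 0"
  shows "pdeg (fls_const t * g - g * fls_const t) < pdeg g"
proof (rule pdeg_less[OF _ ne])
  show "fls_const t * g - g * fls_const t \<in> polys" using g by (simp add: polys_mult polys_diff)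
  fix n assume "pdeg g \<le> n"
  thus "(fls_const t * g - g * fls_const t) $$ (- int n) = 0"
    using g polys_nth_above_pdeg[of g n] by (cases "n = pdeg g") auto
qed

lemma commutator_mult:
  fixes e g v :: "'r::ring"
  shows "e * (g * v) - g * v * e = (e * g - g * e) * v + g * (e * v - v * e)"
  by (simp add: algebra_simps)

text \<open>
  A denominator of minimal degree can be made monic, and then a commutator of it with a constant
  has smaller degree. If the constant commutes with \<open>z\<close>, this commutator is again a denominator,
  hence zero.
\<close>
lemma rational_clear_commuting:
  assumes "z \<in> rational_fls"
  obtains c where "c \<in> polys" "c \<noteq> 0" "c * z \<in> polys"
    "\<And>t. fls_const t * z = z * fls_const t \<Longrightarrow> fls_const t * c = c * fls_const t"
proof -
  obtain g where g: "g \<in> polys" "g \<noteq> 0" "g * z \<in> polys" "g $$ (- int (pdeg g)) = 1"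
    "\<And>h. h \<in> polys \<Longrightarrow> h * z \<in> polys \<Longrightarrow> h \<noteq> 0 \<Longrightarrow> pdeg g \<le> pdeg h"
    using monic_minimal_denominator[OF assms] by blast
  have "fls_const t * g = g * fls_const t" if t: "fls_const t * z = z * fls_const t" for t
  proof (rule ccontr)
    let ?r = "fls_const t * g - g * fls_const t"
    assume "fls_const t * g \<noteq> g * fls_const t"
    hence ne: "?r \<noteq> 0" by simp
    have "?r * z = fls_const t * (g * z) - g * z * fls_const t"
      using commutator_mult[of "fls_const t" g z] t by simp
    hence "?r * z \<in> polys" using g(3) by (simp add: polys_diff polys_mult)
    hence "pdeg g \<le> pdeg ?r" using g ne by (simp add: polys_diff polys_mult)
    thus False using commutator_const_monic_pdeg[OF g(1,4) ne] by simp
  qed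
  thus ?thesis using that g by blast
qed

definition resolvent :: "'d::division_ring \<Rightarrow> 'd fls" where
  "resolvent y = inverse (fls_X_inv - fls_const y)"

lemma X_inv_minus_const_nonzero: "fls_X_inv - fls_const y \<noteq> (0 :: 'd::division_ring fls)"
proof
  assume "fls_X_inv - fls_const y = 0"
  hence "(fls_X_inv - fls_const y) $$ (-1) = 0" by simp
  thus False by simp
qed

lemma resolvent_nth: "resolvent y $$ n = (if n > 0 then y ^ nat (n - 1) else 0)"
proof -
  define R where "R = fls_shift (-1) (fps_to_fls (Abs_fps (\<lambda>n. y ^ n)))"
  have nth: "R $$ n = (if n > 0 then y ^ nat (n - 1) else 0)" for n
    by (auto simp: R_def)
  have "(fls_X_inv - fls_const y) * R = 1"
  proof (intro fls_eqI)
    fix n :: int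
    have "nat n = Suc (nat (n - 1))" if "n > 0" using that by simp
    thus "((fls_X_inv - fls_const y) * R) $$ n = 1 $$ n"
      by (auto simp: left_diff_distrib fls_X_inv_times_conv_shift nth)
  qed
  hence "R = resolvent y" unfolding resolvent_def
    by (simp add: inverse_unique)
  thus ?thesis using nth by simp
qed

text \<open>
  The value at \<open>y\<close> of the polynomial \<open>r x\<close>, with powers of \<open>y\<close> written on the right; it is the
  residue of \<open>r x (s - y)\<^sup>-\<^sup>1\<close>.
\<close>
definition right_value :: "'d::division_ring fls \<Rightarrow> 'd \<Rightarrow> 'd \<Rightarrow> 'd" where
  "right_value r x y = (\<Sum>j\<le>pdeg r. r $$ (- int j) * x * y ^ j)"

lemma poly_times_resolvent:
  assumes "r \<in> polys"
  shows "r * fls_const x * resolvent y - fls_const (right_value r x y) * resolvent y \<in> polys"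
proof (rule polysI)
  fix n :: int assume n: "n > 0"
  have *: "nat (n + int j - 1) = j + nat (n - 1)" for j using n by simp
  have "(r * (fls_const x * resolvent y)) $$ n = right_value r x y * y ^ nat (n - 1)"
    unfolding polys_times_nth[OF assms order_refl] right_value_def sum_distrib_right
    using n by (intro sum.cong) (auto simp: resolvent_nth * power_add mult.assoc)
  thus "(r * fls_const x * resolvent y - fls_const (right_value r x y) * resolvent y) $$ n = 0"
    using n by (simp add: mult.assoc resolvent_nth)
qed

lemma const_times_resolvent_in_polys_iff:
  "fls_const x * resolvent y \<in> polys \<longleftrightarrow> x = 0"
proof
  assume "fls_const x * resolvent y \<in> polys"
  from polysD[OF this, of 1] show "x = 0" by (simp add: resolvent_nth)
qed simp

text \<open>
  More unknowns than equations, over a division ring: Gaussian elimination.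
\<close>
lemma left_linear_system_nontrivial:
  fixes A :: "nat \<Rightarrow> nat \<Rightarrow> 'd::division_ring"
  shows "\<exists>d. (\<exists>i\<le>m. d i \<noteq> 0) \<and> (\<forall>j<m. (\<Sum>i\<le>m. d i * A i j) = 0)"
proof (induction m arbitrary: A)
  case 0
  show ?case by (intro exI[of _ "\<lambda>_. 1"]) auto
next
  case (Suc m)
  show ?case
  proof (cases "\<forall>i\<le>Suc m. A i m = 0")
    case True
    obtain d where d: "\<exists>i\<le>m. d i \<noteq> 0" "\<forall>j<m. (\<Sum>i\<le>m. d i * A i j) = 0"
      using Suc.IH by blast
    define d' where "d' i = (if i = Suc m then 0 else d i)" for i
    have eq: "(\<Sum>i\<le>Suc m. d' i * A i j) = (\<Sum>i\<le>m. d i * A i j)" for j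
      by (simp add: d'_def)
    show ?thesis
    proof (intro exI[of _ d'] conjI allI impI)
      from d(1) obtain i where "i \<le> m" "d i \<noteq> 0" by blast
      hence "i \<le> Suc m \<and> d' i \<noteq> 0" by (simp add: d'_def)
      thus "\<exists>i\<le>Suc m. d' i \<noteq> 0" by blast
      fix j assume "j < Suc m"
      thus "(\<Sum>i\<le>Suc m. d' i * A i j) = 0"
      proof (cases "j = m")
        case True
        thus ?thesis using \<open>\<forall>i\<le>Suc m. A i m = 0\<close> by (intro sum.neutral) auto
      next
        case False thus ?thesis using \<open>j < Suc m\<close> d(2) eq by auto
      qed
    qed
  next
    case False
    then obtain k where k: "k \<le> Suc m" "A k m \<noteq> 0" by blast
    define \<sigma> where "\<sigma> i = (if i < k then i else Suc i)" for i
    define q where "q i = A i m * inverse (A k m)" for i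
    define B where "B i j = A (\<sigma> i) j - q (\<sigma> i) * A k j" for i j
    obtain d where d: "\<exists>i\<le>m. d i \<noteq> 0" "\<forall>j<m. (\<Sum>i\<le>m. d i * B i j) = 0"
      using Suc.IH by blast
    define dk where "dk = - (\<Sum>i\<le>m. d i * q (\<sigma> i))"
    define d' where "d' i = (if i = k then dk else if i < k then d i else d (i - 1))" for i
    have inj: "inj_on \<sigma> {..m}" by (auto simp: inj_on_def \<sigma>_def split: if_splits)
    have img: "\<sigma> ` {..m} = {..Suc m} - {k}"
    proof (intro equalityI subsetI)
      fix i assume "i \<in> {..Suc m} - {k}"
      thus "i \<in> \<sigma> ` {..m}" using k
        by (intro image_eqI[of _ _ "if i < k then i else i - 1"]) (auto simp: \<sigma>_def)
    qed (auto simp: \<sigma>_def split: if_splits)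
    have d's: "d' (\<sigma> i) = d i" for i by (auto simp: d'_def \<sigma>_def)
    have sum: "(\<Sum>i\<le>Suc m. d' i * A i j) = (\<Sum>i\<le>m. d i * B i j)" for j
    proof -
      have "(\<Sum>i\<le>Suc m. d' i * A i j) = dk * A k j + (\<Sum>i\<in>{..Suc m} - {k}. d' i * A i j)"
        using k by (subst sum.remove[of _ k]) (auto simp: d'_def)
      also have "(\<Sum>i\<in>{..Suc m} - {k}. d' i * A i j) = (\<Sum>i\<le>m. d i * A (\<sigma> i) j)"
        unfolding img[symmetric] sum.reindex[OF inj] by (simp add: d's)
      also have "dk * A k j + \<dots> = (\<Sum>i\<le>m. d i * B i j)"
        by (simp add: dk_def B_def sum_distrib_right sum_subtractf right_diff_distrib mult.assoc)
      finally show ?thesis .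
    qed
    have Bm: "B i m = 0" for i using k by (simp add: B_def q_def mult.assoc)
    show ?thesis
    proof (intro exI[of _ d'] conjI allI impI)
      from d(1) obtain i where i: "i \<le> m" "d i \<noteq> 0" by blast
      have "\<sigma> i \<le> Suc m" "d' (\<sigma> i) \<noteq> 0" using i d's by (auto simp: \<sigma>_def)
      thus "\<exists>i\<le>Suc m. d' i \<noteq> 0" by blast
      fix j assume "j < Suc m"
      thus "(\<Sum>i\<le>Suc m. d' i * A i j) = 0" unfolding sum
        using d(2) Bm by (cases "j = m") auto
    qed
  qed
qed

section \<open>Resolvents that are not commutators\<close>

lemma inverse_commutes:
  fixes a e :: "'d::division_ring"
  assumes "e * a = a * e" shows "e * inverse a = inverse a * e"
proof (cases "a = 0")
  case False
  have "e * inverse a = (inverse a * a) * e * inverse a" using False by simp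
  also have "\<dots> = inverse a * (e * a) * inverse a" by (simp only: assms mult.assoc)
  also have "\<dots> = inverse a * e * (a * inverse a)" by (simp only: mult.assoc)
  finally show ?thesis using False by simp
qed simp

text \<open>
  Suppose \<open>a (s - y)\<^sup>-\<^sup>1 + a' g = [e, u]\<close> with \<open>a\<close> and \<open>a'\<close> commuting with \<open>e\<close>. Normalizing
  \<open>a = 1\<close> and clearing the denominator of \<open>a'\<close> leaves \<open>[e, v] \<equiv> x (s - y)\<^sup>-\<^sup>1\<close> modulo polynomials,
  with \<open>x \<in> D\<close>. Let \<open>g\<close> be the monic minimal denominator of \<open>v\<close>; then
  \<open>[e, g] v + \<zeta> (s - y)\<^sup>-\<^sup>1 \<equiv> 0\<close> for the value \<open>\<zeta>\<close> of \<open>g x\<close> at \<open>y\<close>. If \<open>\<zeta> = 0\<close>, minimality gives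
  \<open>[e, g] = 0\<close>, and a product of polynomials over \<open>C(e)\<close> vanishes at \<open>y\<close>. If \<open>\<zeta> \<noteq> 0\<close>, the resolvent
  lies in the cyclic module \<open>D[s] v\<close> modulo polynomials; this module is finite dimensional over \<open>D\<close> and
  stable under right multiplication by \<open>e\<close>, so the elements \<open>(s - y)\<^sup>-\<^sup>1 e\<^sup>i\<close> are dependent, that is,
  one relation \<open>\<Sum>\<^sub>i d\<^sub>i y\<^sup>n e\<^sup>i = 0\<close> holds for all \<open>n\<close>.
\<close>
lemma commutator_obstruction:
  fixes e y g0 :: "'d::division_ring"
  assumes nd1: "\<not> dependent_powers e y" and nd2: "\<not> dependent_powers y e"
    and rat: "a \<in> rational_fls" "a' \<in> rational_fls" "u \<in> rational_fls"
    and com: "fls_const e * a = a * fls_const e" "fls_const e * a' = a' * fls_const e"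
    and a0: "a \<noteq> 0"
  shows "a * resolvent y + a' * fls_const g0 \<noteq> fls_const e * u - u * fls_const e"
proof
  let ?E = "fls_const e" and ?R = "resolvent y"
  assume eq: "a * ?R + a' * fls_const g0 = ?E * u - u * ?E"
  define b where "b = inverse a * a'"
  define w where "w = inverse a * u"
  have ia: "?E * inverse a = inverse a * ?E" using com(1) by (rule inverse_commutes)
  have Eb: "?E * b = b * ?E" unfolding b_def using ia com(2) by (metis mult.assoc)
  have b: "b \<in> rational_fls" and w: "w \<in> rational_fls"
    using rat by (simp_all add: b_def w_def rational_mult rational_inverse)
  have eq1: "?R + b * fls_const g0 = ?E * w - w * ?E"
  proof -
    have "inverse a * (a * ?R + a' * fls_const g0) = ?R + b * fls_const g0"
      using a0 by (simp add: distrib_left b_def flip: mult.assoc)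
    moreover have "inverse a * (?E * u - u * ?E) = ?E * w - w * ?E"
      by (simp add: w_def right_diff_distrib ia flip: mult.assoc)
    ultimately show ?thesis using eq by metis
  qed
  obtain c where c: "c \<in> polys" "c \<noteq> 0" "c * b \<in> polys" "?E * c = c * ?E"
    using rational_clear_commuting[OF b] Eb by metis
  define v where "v = c * w"
  define x where "x = right_value c 1 y"
  have cR: "c * ?R - fls_const x * ?R \<in> polys"
    using poly_times_resolvent[OF c(1), of 1 y] by (simp add: x_def)
  have ev: "?E * v - v * ?E - fls_const x * ?R \<in> polys"
  proof -
    have "?E * v - v * ?E = c * (?E * w - w * ?E)"
      unfolding v_def commutator_mult using c(4) by simp
    also have "\<dots> = c * ?R + c * b * fls_const g0"
      unfolding eq1[symmetric] by (simp add: distrib_left mult.assoc)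
    finally have "?E * v - v * ?E - fls_const x * ?R = (c * ?R - fls_const x * ?R) + c * b * fls_const g0"
      by simp
    thus ?thesis using polys_add[OF cR polys_mult[OF c(3) polys_const]] by metis
  qed
  have "v \<in> rational_fls" using c w by (simp add: v_def rational_mult rational_polys)
  then obtain g where g: "g \<in> polys" "g \<noteq> 0" "g * v \<in> polys" "g $$ (- int (pdeg g)) = 1"
    and gmin: "\<And>h. h \<in> polys \<Longrightarrow> h * v \<in> polys \<Longrightarrow> h \<noteq> 0 \<Longrightarrow> pdeg g \<le> pdeg h"
    using monic_minimal_denominator by blast
  define r where "r = ?E * g - g * ?E"
  have r: "r \<in> polys" using g by (simp add: r_def polys_diff polys_mult)
  define \<zeta> where "\<zeta> = right_value g x y"
  have gR: "g * fls_const x * ?R - fls_const \<zeta> * ?R \<in> polys"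
    unfolding \<zeta>_def by (rule poly_times_resolvent[OF g(1)])
  have rv: "r * v + fls_const \<zeta> * ?R \<in> polys"
  proof -
    have "r * v + fls_const \<zeta> * ?R = (?E * (g * v) - g * v * ?E)
        - g * (?E * v - v * ?E - fls_const x * ?R) - (g * fls_const x * ?R - fls_const \<zeta> * ?R)"
      by (simp add: r_def algebra_simps)
    moreover have "?E * (g * v) - g * v * ?E \<in> polys"
      by (rule polys_diff[OF polys_mult[OF polys_const g(3)] polys_mult[OF g(3) polys_const]])
    moreover have "g * (?E * v - v * ?E - fls_const x * ?R) \<in> polys"
      by (rule polys_mult[OF g(1) ev])
    ultimately show ?thesis using gR by (simp only: polys_diff)
  qed
  show False
  proof (cases "\<zeta> = 0")
    case True
    hence "r * v \<in> polys" using rv by simp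
    hence "r = 0"
      using gmin[OF r] commutator_const_monic_pdeg[OF g(1,4), of e] unfolding r_def by fastforce
    hence Eg: "?E * g = g * ?E" by (simp add: r_def)
    define h where "h = g * c"
    have h: "h \<in> polys" "h \<noteq> 0" using g c by (simp_all add: h_def polys_mult)
    have Eh: "?E * h = h * ?E" unfolding h_def using Eg c(4) by (metis mult.assoc)
    have "h * ?R = g * (c * ?R - fls_const x * ?R) + (g * fls_const x * ?R - fls_const \<zeta> * ?R)"
      using True by (simp add: h_def algebra_simps)
    hence "h * ?R \<in> polys" using polys_add[OF polys_mult[OF g(1) cR] gR] by simp
    moreover have "h * ?R - fls_const (right_value h 1 y) * ?R \<in> polys"
      using poly_times_resolvent[OF h(1), of 1 y] by simp
    ultimately have "fls_const (right_value h 1 y) * ?R \<in> polys"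
      using polys_diff by fastforce
    hence "right_value h 1 y = 0" by (simp only: const_times_resolvent_in_polys_iff)
    hence "(\<Sum>j\<le>pdeg h. h $$ (- int j) * y ^ j) = 0" by (simp add: right_value_def)
    moreover have "h $$ n * e = e * h $$ n" for n
      using arg_cong[OF Eh, of "\<lambda>z. z $$ n"] by simp
    ultimately show False
      using nd1 dependent_powersI[of "pdeg h" "\<lambda>j. h $$ (- int j)" e "pdeg h" y]
        polys_lead_nonzero[OF h] by blast
  next
    case False
    define q where "q = - (fls_const (inverse \<zeta>) * r)"
    have q: "q \<in> polys" using r by (simp add: q_def polys_uminus polys_mult)
    have Rq: "?R - q * v \<in> polys"
    proof -
      have "fls_const (inverse \<zeta>) * (r * v + fls_const \<zeta> * ?R) = ?R - q * v"
        using False by (simp add: q_def distrib_left flip: mult.assoc)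
      thus ?thesis using polys_mult[OF polys_const rv] by metis
    qed
    \<comment> \<open>Modulo polynomials, right multiplication of \<open>v\<close> by \<open>e\<close> is left multiplication by \<open>t\<close>.\<close>
    define t where "t = ?E - fls_const x * q"
    have t: "t \<in> polys" using q by (simp add: t_def polys_diff polys_mult)
    have tpow: "t ^ i \<in> polys" for i by (induction i) (auto simp: polys_mult t)
    have vt: "v * ?E - t * v \<in> polys"
    proof -
      have "v * ?E - t * v = - (?E * v - v * ?E - fls_const x * ?R) - fls_const x * (?R - q * v)"
        by (simp add: t_def algebra_simps)
      thus ?thesis using polys_diff[OF polys_uminus[OF ev] polys_mult[OF polys_const Rq]] by metis
    qed
    have Ri: "?R * ?E ^ i - q * t ^ i * v \<in> polys" for i
    proof (induction i)
      case 0 thus ?case using Rq by simp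
    next
      case (Suc i)
      have "?R * ?E ^ Suc i - q * t ^ Suc i * v
          = (?R * ?E ^ i - q * t ^ i * v) * ?E + q * t ^ i * (v * ?E - t * v)"
        unfolding power_Suc2 by (simp add: algebra_simps)
      thus ?case using polys_add[OF polys_mult[OF Suc polys_const] polys_mult[OF polys_mult[OF q tpow] vt]]
        by metis
    qed
    define m where "m = pdeg g"
    have "\<exists>s. s \<in> polys \<and> (s = 0 \<or> pdeg s < m) \<and> ?R * ?E ^ i - s * v \<in> polys" for i
    proof -
      obtain k where k: "k \<in> polys" "q * t ^ i - k * g = 0 \<or> pdeg (q * t ^ i - k * g) < m"
        using polys_division[OF g(1,2) polys_mult[OF q tpow]] unfolding m_def by blast
      have "?R * ?E ^ i - (q * t ^ i - k * g) * v = (?R * ?E ^ i - q * t ^ i * v) + k * (g * v)"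
        by (simp add: algebra_simps)
      hence "?R * ?E ^ i - (q * t ^ i - k * g) * v \<in> polys"
        using polys_add[OF Ri polys_mult[OF k(1) g(3)]] by metis
      moreover have "q * t ^ i - k * g \<in> polys"
        using q tpow k g by (intro polys_diff polys_mult)
      ultimately show ?thesis using k(2) by blast
    qed
    then obtain s where s: "\<And>i. s i \<in> polys" "\<And>i. s i = 0 \<or> pdeg (s i) < m"
      "\<And>i. ?R * ?E ^ i - s i * v \<in> polys" by metis
    obtain d where d: "\<exists>i\<le>m. d i \<noteq> 0" "\<forall>j<m. (\<Sum>i\<le>m. d i * s i $$ (- int j)) = 0"
      using left_linear_system_nontrivial[of m "\<lambda>i j. s i $$ (- int j)"] by blast
    have ds: "(\<Sum>i\<le>m. fls_const (d i) * s i) = 0"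
    proof (intro fls_eqI)
      fix n :: int
      have "(\<Sum>i\<le>m. d i * s i $$ n) = 0"
      proof (cases "n > 0")
        case True
        thus ?thesis using s(1) by (simp add: polysD)
      next
        case False
        hence "n = - int (nat (- n))" by simp
        then obtain j where j: "n = - int j" by blast
        show ?thesis
        proof (cases "j < m")
          case True thus ?thesis using d(2) j by simp
        next
          case False
          have "s i $$ n = 0" for i
            using s(2)[of i] False polys_nth_above_pdeg[of "s i" j] j by auto
          thus ?thesis by simp
        qed
      qed
      thus "(\<Sum>i\<le>m. fls_const (d i) * s i) $$ n = 0 $$ n" by (simp add: fls_nth_sum)
    qed
    have "(\<Sum>i\<le>m. fls_const (d i) * (?R * ?E ^ i - s i * v)) \<in> polys"
      by (intro polys_sum polys_mult[OF polys_const s(3)])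
    also have "(\<Sum>i\<le>m. fls_const (d i) * (?R * ?E ^ i - s i * v))
        = (\<Sum>i\<le>m. fls_const (d i) * (?R * ?E ^ i)) - (\<Sum>i\<le>m. fls_const (d i) * s i) * v"
      by (simp add: right_diff_distrib sum_subtractf sum_distrib_right mult.assoc)
    finally have poly: "(\<Sum>i\<le>m. fls_const (d i) * (?R * ?E ^ i)) \<in> polys" using ds by simp
    have "(\<Sum>i\<le>m. d i * y ^ n * e ^ i) = 0" for n
      using polysD[OF poly, of "int n + 1"]
      by (simp add: fls_nth_sum resolvent_nth mult.assoc fls_const_power[symmetric])
    hence "dependent_powers y e" using d(1) unfolding dependent_powers_def by blast
    thus False using nd2 by blast
  qed
qed

section \<open>Independence of iterated integrals\<close>

definition center :: "'d::ring_1 set" where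
  "center = {z. \<forall>x. z * x = x * z}"

definition word_value :: "'d::monoid_mult \<Rightarrow> 'd \<Rightarrow> bool list \<Rightarrow> 'd" where
  "word_value x y w = prod_list (map (\<lambda>b. if b then x else y) w)"

text \<open>
  Independence is required over the whole center and not only over \<open>k\<close>: the center of \<open>D(s)\<close>
  contains \<open>s\<close>, and independence over the polynomials in \<open>s\<close> is what survives specialization.
\<close>
definition free_over_center :: "'d::division_ring \<Rightarrow> 'd \<Rightarrow> bool" where
  "free_over_center x y \<longleftrightarrow>
     (\<forall>W c. finite W \<and> (\<forall>w\<in>W. c w \<in> center) \<and> (\<Sum>w\<in>W. c w * word_value x y w) = 0
        \<longrightarrow> (\<forall>w\<in>W. c w = 0))"

lemma word_value_Nil [simp]: "word_value x y [] = 1"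
  and word_value_Cons [simp]: "word_value x y (b # w) = (if b then x else y) * word_value x y w"
  by (simp_all add: word_value_def)

abbreviation words_upto :: "nat \<Rightarrow> bool list set" where
  "words_upto n \<equiv> {w. length w \<le> n}"

lemma finite_words_upto: "finite (words_upto n)"
  using finite_lists_length_le[of "UNIV :: bool set" n] by simp

lemma words_upto_Suc: "words_upto (Suc n) = insert [] ((#) True ` words_upto n \<union> (#) False ` words_upto n)"
proof (intro equalityI subsetI)
  fix w assume "w \<in> words_upto (Suc n)"
  thus "w \<in> insert [] ((#) True ` words_upto n \<union> (#) False ` words_upto n)"
  proof (cases w)
    case (Cons b v) thus ?thesis using \<open>w \<in> words_upto (Suc n)\<close> by (cases b) auto
  qed simp
qed auto

lemma sum_words_upto_Suc:
  fixes F :: "bool list \<Rightarrow> 'a::comm_monoid_add"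
  shows "(\<Sum>w\<in>words_upto (Suc n). F w) = F [] + (\<Sum>w\<in>words_upto n. F (True # w) + F (False # w))"
proof -
  have "(\<Sum>w\<in>words_upto (Suc n). F w)
      = F [] + ((\<Sum>w\<in>(#) True ` words_upto n. F w) + (\<Sum>w\<in>(#) False ` words_upto n. F w))"
    unfolding words_upto_Suc
    by (subst sum.insert) (auto simp: finite_words_upto intro!: arg_cong2[of _ _ _ _ "(+)"] sum.union_disjoint)
  thus ?thesis by (simp add: sum.reindex sum.distrib)
qed

text \<open>
  The words are independent from the left over \<open>D\<close>, even modulo polynomials. Multiplying a relation
  from the left by \<open>P\<close> turns the coefficient \<open>d\<close> of a word into \<open>- [e, d]\<close> and adds to the coefficient
  of each shorter word the contributions \<open>d f\<close> and \<open>d g\<close> of its two extensions. The induction is on the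
  length of the longest words and then on the number of words of that length: once one of their
  coefficients is \<open>1\<close>, its commutator vanishes, and the new relation has fewer longest words. It is
  therefore trivial, so all top coefficients commute with \<open>e\<close>, and comparing coefficients one level
  below contradicts the hypothesis on \<open>f\<close> and \<open>g\<close>.
\<close>
lemma words_left_independent:
  fixes e f g :: "'d::division_ring"
  defines "P \<equiv> fls_X_inv - fls_const e"
  defines "x \<equiv> inverse P * fls_const f" and "y \<equiv> inverse P * fls_const g"
  assumes crit: "\<And>a b u. e * a = a * e \<Longrightarrow> e * b = b * e \<Longrightarrow> a * f + b * g = e * u - u * e \<Longrightarrow> a = 0 \<and> b = 0"
    and "l \<in> polys"
    and "d [] = 0"
    and "l + (\<Sum>w\<in>words_upto n. fls_const (d w) * word_value x y w) = 0"
  shows "\<forall>w\<in>words_upto n. d w = 0"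
  using assms(5-7)
proof (induction n arbitrary: l d)
  case 0
  thus ?case by auto
next
  case (Suc n)
  let ?W = "word_value x y"
  have P: "P \<noteq> 0" unfolding P_def by (rule X_inv_minus_const_nonzero)
  have Pc: "P * fls_const t = fls_const t * P - fls_const (e * t - t * e)" for t
    by (simp add: P_def algebra_simps X_inv_commutes flip: fls_const_mult_const fls_minus_const)
  have Pw: "P * ?W (True # w) = fls_const f * ?W w" "P * ?W (False # w) = fls_const g * ?W w" for w
    using P by (simp_all add: x_def y_def flip: mult.assoc)
  show ?case using Suc.prems
  proof (induction "card {w. length w = Suc n \<and> d w \<noteq> 0}" arbitrary: l d rule: less_induct)
    case (less d l)
    show ?case
    proof (cases "\<exists>w. length w = Suc n \<and> d w \<noteq> 0")
      case False
      have "(\<Sum>w\<in>words_upto (Suc n). fls_const (d w) * ?W w) = (\<Sum>w\<in>words_upto n. fls_const (d w) * ?W w)"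
        using False by (intro sum.mono_neutral_right[OF finite_words_upto]) (auto simp: le_Suc_eq)
      hence "\<forall>w\<in>words_upto n. d w = 0" using Suc.IH[of l d] less.prems by simp
      thus ?thesis using False by (auto simp: le_Suc_eq)
    next
      case True
      then obtain v where v: "length v = Suc n" "d v \<noteq> 0" by blast
      define k where "k w = inverse (d v) * d w" for w
      define l1 where "l1 = fls_const (inverse (d v)) * l"
      have l1: "l1 \<in> polys" using less.prems by (simp add: l1_def polys_mult)
      have k0: "k [] = 0" and kv: "k v = 1" using less.prems v by (simp_all add: k_def)
      have rel: "l1 + (\<Sum>w\<in>words_upto (Suc n). fls_const (k w) * ?W w) = 0"
      proof -
        have "fls_const (inverse (d v)) * (l + (\<Sum>w\<in>words_upto (Suc n). fls_const (d w) * ?W w)) = 0"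
          using less.prems by simp
        thus ?thesis
          by (simp add: k_def l1_def distrib_left sum_distrib_left flip: mult.assoc fls_const_mult_const)
      qed
      define D where "D w = k (True # w) * f + k (False # w) * g" for w
      define k' where "k' w = (if w = [] then 0 else (if length w \<le> n then D w else 0) - (e * k w - k w * e))" for w
      define l' where "l' = P * l1 + fls_const (D [])"
      have l': "l' \<in> polys" using l1 by (simp add: l'_def P_def polys_add polys_mult polys_diff)
      have rel': "l' + (\<Sum>w\<in>words_upto (Suc n). fls_const (k' w) * ?W w) = 0"
      proof -
        have "(\<Sum>w\<in>words_upto (Suc n). fls_const (k w) * (P * ?W w))
            = (\<Sum>w\<in>words_upto n. fls_const (D w) * ?W w)"
          unfolding sum_words_upto_Suc
          by (simp add: k0 Pw D_def distrib_right flip: mult.assoc fls_const_mult_const fls_plus_const del: word_value_Cons)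
        also have "\<dots> = fls_const (D []) +
            (\<Sum>w\<in>words_upto (Suc n) - {[]}. fls_const (if length w \<le> n then D w else 0) * ?W w)"
        proof -
          have "(\<Sum>w\<in>words_upto n. fls_const (D w) * ?W w)
              = fls_const (D []) * ?W [] + (\<Sum>w\<in>words_upto n - {[]}. fls_const (D w) * ?W w)"
            by (rule sum.remove) (auto simp: finite_words_upto)
          also have "(\<Sum>w\<in>words_upto n - {[]}. fls_const (D w) * ?W w)
              = (\<Sum>w\<in>words_upto (Suc n) - {[]}. fls_const (if length w \<le> n then D w else 0) * ?W w)"
            by (rule sum.mono_neutral_cong_left) (auto simp: finite_words_upto)
          finally show ?thesis by simp
        qed
        finally have 1: "(\<Sum>w\<in>words_upto (Suc n). fls_const (k w) * (P * ?W w)) = fls_const (D []) +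
            (\<Sum>w\<in>words_upto (Suc n) - {[]}. fls_const (if length w \<le> n then D w else 0) * ?W w)" .
        have 2: "(\<Sum>w\<in>words_upto (Suc n). fls_const (e * k w - k w * e) * ?W w)
            = (\<Sum>w\<in>words_upto (Suc n) - {[]}. fls_const (e * k w - k w * e) * ?W w)"
          by (rule sum.mono_neutral_right[OF finite_words_upto]) (auto simp: k0)
        have 3: "(\<Sum>w\<in>words_upto (Suc n). fls_const (k' w) * ?W w)
            = (\<Sum>w\<in>words_upto (Suc n) - {[]}. fls_const (if length w \<le> n then D w else 0) * ?W w)
            - (\<Sum>w\<in>words_upto (Suc n) - {[]}. fls_const (e * k w - k w * e) * ?W w)"
        proof -
          have "(\<Sum>w\<in>words_upto (Suc n). fls_const (k' w) * ?W w)
              = (\<Sum>w\<in>words_upto (Suc n) - {[]}. fls_const (k' w) * ?W w)"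
            by (rule sum.mono_neutral_right[OF finite_words_upto]) (auto simp: k'_def)
          also have "\<dots> = (\<Sum>w\<in>words_upto (Suc n) - {[]}. fls_const (if length w \<le> n then D w else 0) * ?W w
              - fls_const (e * k w - k w * e) * ?W w)"
            by (intro sum.cong refl) (simp add: k'_def left_diff_distrib flip: fls_minus_const)
          finally show ?thesis by (simp only: sum_subtractf)
        qed
        have "0 = P * (l1 + (\<Sum>w\<in>words_upto (Suc n). fls_const (k w) * ?W w))" using rel by simp
        also have "\<dots> = P * l1 + (\<Sum>w\<in>words_upto (Suc n). (P * fls_const (k w)) * ?W w)"
          by (simp add: distrib_left sum_distrib_left mult.assoc)
        also have "\<dots> = P * l1 + ((\<Sum>w\<in>words_upto (Suc n). fls_const (k w) * (P * ?W w))
            - (\<Sum>w\<in>words_upto (Suc n). fls_const (e * k w - k w * e) * ?W w))"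
          unfolding Pc left_diff_distrib sum_subtractf mult.assoc ..
        also have "\<dots> = l' + (\<Sum>w\<in>words_upto (Suc n). fls_const (k' w) * ?W w)"
          unfolding 1 2 3 l'_def by simp
        finally show ?thesis ..
      qed
      have "{w. length w = Suc n \<and> k' w \<noteq> 0} \<subset> {w. length w = Suc n \<and> d w \<noteq> 0}"
      proof
        show "{w. length w = Suc n \<and> k' w \<noteq> 0} \<subseteq> {w. length w = Suc n \<and> d w \<noteq> 0}"
          by (auto simp: k'_def k_def)
        have "k' v = 0" using v kv by (auto simp: k'_def)
        thus "{w. length w = Suc n \<and> k' w \<noteq> 0} \<noteq> {w. length w = Suc n \<and> d w \<noteq> 0}"
          using v by blast
      qed
      moreover have "finite {w. length w = Suc n \<and> d w \<noteq> 0}"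
        by (rule finite_subset[OF _ finite_words_upto[of "Suc n"]]) auto
      ultimately have "card {w. length w = Suc n \<and> k' w \<noteq> 0} < card {w. length w = Suc n \<and> d w \<noteq> 0}"
        by (rule psubset_card_mono[rotated])
      moreover have "k' [] = 0" by (simp add: k'_def)
      ultimately have k'0: "\<forall>w\<in>words_upto (Suc n). k' w = 0"
        using less.hyps l' rel' by blast
      have top: "e * k w = k w * e" if "length w = Suc n" for w
      proof -
        have "k' w = 0" "w \<noteq> []" "\<not> length w \<le> n" using k'0 that by auto
        thus ?thesis by (simp add: k'_def)
      qed
      obtain b v' where vv: "v = b # v'" "length v' = n" using v(1) by (cases v) auto
      have "\<exists>u. D v' = e * u - u * e"
      proof (cases "v' = []")
        case False
        have "k' v' = 0" using k'0 vv by auto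
        hence "D v' = e * k v' - k v' * e" using False vv by (simp add: k'_def)
        thus ?thesis by blast
      next
        case True
        have "l' = 0" using rel' k'0 by simp
        have "l1 = 0"
        proof (rule ccontr)
          assume ne: "l1 \<noteq> 0"
          have Pp: "P \<in> polys" by (simp add: P_def polys_diff)
          have "P $$ (-1) \<noteq> 0" by (simp add: P_def)
          hence "pdeg P > 0" using polys_nth_above_pdeg[of P 1] by (metis neq0_conv of_nat_1 zero_less_one)
          hence "pdeg (P * l1) > 0" using pdeg_mult[OF Pp l1 P ne] by simp
          moreover have "(P * l1) $$ (- int (pdeg (P * l1))) \<noteq> 0"
            using polys_lead_nonzero[OF polys_mult[OF Pp l1]] P ne by simp
          moreover have "P * l1 = - fls_const (D [])" using \<open>l' = 0\<close> by (simp add: l'_def add_eq_0_iff2)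
          ultimately show False by auto
        qed
        hence "D [] = 0" using \<open>l' = 0\<close> by (simp add: l'_def)
        thus ?thesis using True by (intro exI[of _ 0]) simp
      qed
      hence "k (True # v') = 0 \<and> k (False # v') = 0"
        using crit top vv unfolding D_def by (metis length_Cons)
      thus ?thesis using kv vv by (cases b) auto
    qed
  qed
qed

lemma commutes_polys:
  assumes z: "\<And>t. fls_const t * z = z * fls_const t" and q: "q \<in> polys"
  shows "q * z = z * q"
proof -
  have Xz: "fls_X_inv ^ j * z = z * fls_X_inv ^ j" for j
    by (simp add: fls_X_inv_power_times_conv_shift)
  have "fls_const t * fls_X_inv ^ j * z = z * (fls_const t * fls_X_inv ^ j)" for t j
    by (metis Xz z mult.assoc)
  thus ?thesis
    by (subst (1 2) polys_expand[OF q order_refl]) (simp only: sum_distrib_left sum_distrib_right)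
qed

text \<open>
  Denominators that commute with all constants commute with each other, so they may be multiplied.
\<close>
lemma common_central_denominator:
  assumes "finite S" and "\<And>z. z \<in> S \<Longrightarrow> z \<in> rational_fls"
    and "\<And>z t. z \<in> S \<Longrightarrow> fls_const t * z = z * fls_const t"
  shows "\<exists>g\<in>polys. g \<noteq> 0 \<and> (\<forall>t. fls_const t * g = g * fls_const t) \<and> (\<forall>z\<in>S. g * z \<in> polys)"
  using assms
proof (induction S rule: finite_induct)
  case empty
  show ?case by (intro bexI[of _ 1]) auto
next
  case (insert z S)
  have "\<exists>g\<in>polys. g \<noteq> 0 \<and> (\<forall>t. fls_const t * g = g * fls_const t) \<and> (\<forall>z\<in>S. g * z \<in> polys)"
    by (intro insert.IH) (simp_all add: insert.prems)
  then obtain g where g: "g \<in> polys" "g \<noteq> 0" "\<And>t. fls_const t * g = g * fls_const t"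
    "\<And>z. z \<in> S \<Longrightarrow> g * z \<in> polys" by blast
  have "\<exists>h\<in>polys. h \<noteq> 0 \<and> h * z \<in> polys \<and> (\<forall>t. fls_const t * h = h * fls_const t)"
  proof (rule rational_clear_commuting[OF insert.prems(1)[OF insertI1]])
    fix c assume c: "c \<in> polys" "c \<noteq> 0" "c * z \<in> polys"
      "\<And>t. fls_const t * z = z * fls_const t \<Longrightarrow> fls_const t * c = c * fls_const t"
    have "fls_const t * c = c * fls_const t" for t
      by (rule c(4), rule insert.prems(2), rule insertI1)
    thus ?thesis using c(1-3) by blast
  qed
  then obtain h where h: "h \<in> polys" "h \<noteq> 0" "h * z \<in> polys"
    and h4: "\<And>t. fls_const t * h = h * fls_const t" by blast
  have "h * g * w \<in> polys" if "w \<in> insert z S" for w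
  proof (cases "w = z")
    case True
    have "h * g * z = g * (h * z)" using commutes_polys[OF g(3) h(1)] by (simp add: mult.assoc)
    thus ?thesis using True polys_mult[OF g(1) h(3)] by simp
  next
    case False
    thus ?thesis using that polys_mult[OF h(1) g(4)] by (simp add: mult.assoc)
  qed
  moreover have "fls_const t * (h * g) = h * g * fls_const t" for t
    by (metis g(3) h4 mult.assoc)
  ultimately show ?case using g h by (intro bexI[of _ "h * g"]) (auto simp: polys_mult)
qed

text \<open>
  The left \<open>D\<close>-span of the polynomials and the words of bounded length. It is a \<open>D[s]\<close>-module,
  because \<open>s\<close> times a word is \<open>e\<close> times that word plus a shorter one.
\<close>
inductive_set word_span :: "'d::division_ring fls \<Rightarrow> 'd fls \<Rightarrow> nat \<Rightarrow> 'd fls set"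
  for x y n where
  poly: "l \<in> polys \<Longrightarrow> l \<in> word_span x y n"
| word: "length w \<le> n \<Longrightarrow> fls_const t * word_value x y w \<in> word_span x y n"
| add: "z \<in> word_span x y n \<Longrightarrow> z' \<in> word_span x y n \<Longrightarrow> z + z' \<in> word_span x y n"

lemma word_span_normal_form:
  assumes "z \<in> word_span x y n"
  shows "\<exists>l d. l \<in> polys \<and> d [] = 0 \<and> z = l + (\<Sum>w\<in>words_upto n. fls_const (d w) * word_value x y w)"
  using assms
proof induction
  case (poly l)
  thus ?case by (intro exI[of _ l] exI[of _ "\<lambda>_. 0"]) auto
next
  case (word w t)
  show ?case
  proof (cases "w = []")
    case True
    thus ?thesis by (intro exI[of _ "fls_const t"] exI[of _ "\<lambda>_. 0"]) auto
  next
    case False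
    have "(\<Sum>v\<in>words_upto n. fls_const (if v = w then t else 0) * word_value x y v)
        = (\<Sum>v\<in>words_upto n. if v = w then fls_const t * word_value x y v else 0)"
      by (intro sum.cong) auto
    also have "\<dots> = fls_const t * word_value x y w"
      using word finite_words_upto[of n] by (simp add: sum.delta)
    finally show ?thesis using False
      by (intro exI[of _ 0] exI[of _ "\<lambda>v. if v = w then t else 0"]) auto
  qed
next
  case (add z z')
  then obtain l d l' d' where "l \<in> polys" "d [] = 0"
    "z = l + (\<Sum>w\<in>words_upto n. fls_const (d w) * word_value x y w)" "l' \<in> polys" "d' [] = 0"
    "z' = l' + (\<Sum>w\<in>words_upto n. fls_const (d' w) * word_value x y w)" by blast
  thus ?case
    by (intro exI[of _ "l + l'"] exI[of _ "\<lambda>w. d w + d' w"])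
       (simp add: polys_add sum.distrib distrib_right flip: fls_plus_const)
qed

lemma word_span_const: "z \<in> word_span x y n \<Longrightarrow> fls_const t * z \<in> word_span x y n"
proof (induction rule: word_span.induct)
  case (word w t')
  thus ?case using word_span.word[of w n "t * t'" x y] by (simp flip: mult.assoc)
next
  case (poly l)
  thus ?case by (intro word_span.poly polys_mult) simp
qed (simp add: distrib_left word_span.add)

lemma word_span_sum: "(\<And>i. i \<in> I \<Longrightarrow> F i \<in> word_span x y n) \<Longrightarrow> sum F I \<in> word_span x y n"
  by (induction I rule: infinite_finite_induct) (auto intro: word_span.intros)

locale resolvent_words =
  fixes e f g :: "'d::division_ring" and P x y
  assumes P_eq: "P = fls_X_inv - fls_const e"
    and x_eq: "x = inverse P * fls_const f" and y_eq: "y = inverse P * fls_const g"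
begin

lemma P_nonzero: "P \<noteq> 0" unfolding P_eq by (rule X_inv_minus_const_nonzero)

lemma P_word:
  "P * word_value x y (b # w) = fls_const (if b then f else g) * word_value x y w"
  using P_nonzero by (simp add: x_eq y_eq flip: mult.assoc)

lemma X_inv_word:
  "fls_X_inv * (fls_const t * word_value x y (b # w))
   = fls_const (t * e) * word_value x y (b # w) + fls_const (t * (if b then f else g)) * word_value x y w"
proof -
  have "fls_X_inv * (fls_const t * word_value x y (b # w))
      = fls_const t * (fls_X_inv * word_value x y (b # w))"
    by (metis X_inv_commutes mult.assoc)
  also have "fls_X_inv * word_value x y (b # w)
      = fls_const e * word_value x y (b # w) + P * word_value x y (b # w)"
    by (simp add: P_eq algebra_simps)
  finally show ?thesis unfolding P_word
    by (simp add: distrib_left flip: mult.assoc)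
qed

lemma word_span_X_inv: "z \<in> word_span x y n \<Longrightarrow> fls_X_inv * z \<in> word_span x y n"
proof (induction rule: word_span.induct)
  case (word w t)
  show ?case
  proof (cases w)
    case Nil
    thus ?thesis by (auto intro!: word_span.poly polys_mult)
  next
    case (Cons b v)
    show ?thesis unfolding Cons X_inv_word using word Cons
      by (intro word_span.add word_span.word) auto
  qed
next
  case (poly l)
  thus ?case by (intro word_span.poly polys_mult) simp
qed (simp add: distrib_left word_span.add)

lemma word_span_polys: assumes "z \<in> word_span x y n" "q \<in> polys" shows "q * z \<in> word_span x y n"
proof -
  have X: "fls_X_inv ^ j * z \<in> word_span x y n" for j
    by (induction j) (auto simp: assms mult.assoc intro: word_span_X_inv)
  show ?thesis
    by (subst polys_expand[OF assms(2) order_refl], unfold sum_distrib_right mult.assoc)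
       (intro word_span_sum word_span_const X)
qed

text \<open>
  Modulo shorter words, \<open>s\<close> acts as \<open>e\<close>.
\<close>
lemma poly_times_word:
  assumes "length w = Suc n" "q \<in> polys"
  shows "q * word_value x y w - fls_const (\<Sum>j\<le>pdeg q. q $$ (- int j) * e ^ j) * word_value x y w
    \<in> word_span x y n"
proof -
  obtain b v where w: "w = b # v" "length v = n" using assms(1) by (cases w) auto
  have X: "fls_X_inv ^ j * word_value x y w - fls_const (e ^ j) * word_value x y w \<in> word_span x y n" for j
  proof (induction j)
    case 0 thus ?case by (simp add: word_span.poly)
  next
    case (Suc j)
    have "fls_X_inv ^ Suc j * word_value x y w - fls_const (e ^ Suc j) * word_value x y w
       = fls_X_inv * (fls_X_inv ^ j * word_value x y w - fls_const (e ^ j) * word_value x y w)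
       + (fls_X_inv * (fls_const (e ^ j) * word_value x y w) - fls_const (e ^ Suc j) * word_value x y w)"
      by (simp add: algebra_simps)
    moreover have "fls_X_inv * (fls_const (e ^ j) * word_value x y w) - fls_const (e ^ Suc j) * word_value x y w
       = fls_const (e ^ j * (if b then f else g)) * word_value x y v"
      unfolding w X_inv_word power_Suc2 by simp
    moreover have "fls_const (e ^ j * (if b then f else g)) * word_value x y v \<in> word_span x y n"
      using w by (intro word_span.word) simp
    ultimately show ?case using word_span.add[OF word_span_X_inv[OF Suc]] by metis
  qed
  have c: "fls_const (\<Sum>j\<le>pdeg q. q $$ (- int j) * e ^ j) = (\<Sum>j\<le>pdeg q. fls_const (q $$ (- int j)) * fls_const (e ^ j))"
    by (intro fls_eqI) (simp add: fls_nth_sum)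
  have "q * word_value x y w - fls_const (\<Sum>j\<le>pdeg q. q $$ (- int j) * e ^ j) * word_value x y w
     = (\<Sum>j\<le>pdeg q. fls_const (q $$ (- int j)) *
          (fls_X_inv ^ j * word_value x y w - fls_const (e ^ j) * word_value x y w))"
    unfolding c
    by (subst polys_expand[OF assms(2) order_refl])
       (simp only: sum_distrib_right right_diff_distrib sum_subtractf mult.assoc)
  thus ?thesis by (simp only: word_span_sum word_span_const X)
qed

end

text \<open>
  A relation over the center of \<open>D(s)\<close> becomes, after clearing denominators, one with polynomial
  coefficients \<open>B\<^sub>w\<close> over the center of \<open>D\<close>. On the longest words \<open>s\<close> acts as \<open>e\<close>, so independence
  over \<open>D\<close> yields \<open>B\<^sub>w(e) = 0\<close>, and \<open>e\<close> is transcendental over the center.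
\<close>
lemma free_over_center_ratfun:
  fixes e f g :: "'d::division_ring"
  assumes crit: "\<And>a b u. e * a = a * e \<Longrightarrow> e * b = b * e \<Longrightarrow> a * f + b * g = e * u - u * e \<Longrightarrow> a = 0 \<and> b = 0"
    and trans: "\<And>(m::nat) c. (\<And>i. c i \<in> center) \<Longrightarrow> (\<Sum>i\<le>m. c i * e ^ i) = 0 \<Longrightarrow> \<forall>i\<le>m. c i = 0"
  shows "\<exists>x y :: 'd ratfun. free_over_center x y"
proof -
  define P where "P = fls_X_inv - fls_const e"
  define x where "x = inverse P * fls_const f"
  define y where "y = inverse P * fls_const g"
  interpret resolvent_words e f g P x y
    by unfold_locales (rule P_def x_def y_def)+
  have rat: "x \<in> rational_fls" "y \<in> rational_fls"
    unfolding x_def y_def P_def by (intro rational_mult rational_inverse rational_polys polys_diff polys_const polys_X_inv)+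
  define X where "X = ratfun_of_fls x"
  define Y where "Y = ratfun_of_fls y"
  have XY: "fls_of_ratfun X = x" "fls_of_ratfun Y = y"
    using rat by (simp_all add: X_def Y_def ratfun_of_fls_inverse)
  have wv: "fls_of_ratfun (word_value X Y w) = word_value x y w" for w
    by (induction w) (simp_all add: XY one_ratfun.rep_eq times_ratfun.rep_eq)
  have sum_rep: "fls_of_ratfun (sum F I) = (\<Sum>i\<in>I. fls_of_ratfun (F i))" for F :: "bool list \<Rightarrow> 'd ratfun" and I
    by (induction I rule: infinite_finite_induct) (simp_all add: zero_ratfun.rep_eq plus_ratfun.rep_eq)
  have "free_over_center X Y"
    unfolding free_over_center_def
  proof (intro allI impI, elim conjE)
    fix W c assume W: "finite W" and cen: "\<forall>w\<in>W. c w \<in> center"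
      and rel: "(\<Sum>w\<in>W. c w * word_value X Y w) = 0"
    define C where "C w = fls_of_ratfun (c w)" for w
    have C_rat: "C w \<in> rational_fls" for w using fls_of_ratfun[of "c w"] by (simp add: C_def)
    have C_com: "fls_const t * C w = C w * fls_const t" if "w \<in> W" for t w
    proof -
      have "c w * ratfun_of_fls (fls_const t) = ratfun_of_fls (fls_const t) * c w"
        using cen that by (simp add: center_def)
      hence "fls_of_ratfun (c w * ratfun_of_fls (fls_const t)) = fls_of_ratfun (ratfun_of_fls (fls_const t) * c w)"
        by simp
      thus ?thesis by (simp add: times_ratfun.rep_eq ratfun_of_fls_inverse rational_polys C_def)
    qed
    have C_rel: "(\<Sum>w\<in>W. C w * word_value x y w) = 0"
      using arg_cong[OF rel, of fls_of_ratfun]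
      by (simp add: sum_rep wv C_def times_ratfun.rep_eq zero_ratfun.rep_eq)
    have "\<exists>q\<in>polys. q \<noteq> 0 \<and> (\<forall>t. fls_const t * q = q * fls_const t) \<and> (\<forall>z\<in>C ` W. q * z \<in> polys)"
    proof (rule common_central_denominator)
      show "finite (C ` W)" using W by simp
      show "z \<in> rational_fls" if "z \<in> C ` W" for z using that C_rat by auto
      show "fls_const t * z = z * fls_const t" if "z \<in> C ` W" for z t
        using that C_com by (elim imageE) simp
    qed
    then obtain q where q: "q \<in> polys" "q \<noteq> 0" "\<And>t. fls_const t * q = q * fls_const t" "\<And>w. w \<in> W \<Longrightarrow> q * C w \<in> polys"
      by blast
    define B where "B w = q * C w" for w
    define V where "V = {w\<in>W. C w \<noteq> 0}"
    have V: "finite V" "V \<subseteq> W" using W by (auto simp: V_def)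
    have B: "B w \<in> polys" "B w \<noteq> 0" if "w \<in> V" for w
      using that q by (auto simp: B_def V_def)
    have B_cen: "B w $$ n \<in> center" if "w \<in> V" for w n
    proof -
      have "fls_const t * B w = B w * fls_const t" for t
        unfolding B_def using q(3) C_com[of w t] that V by (metis mult.assoc subsetD)
      from arg_cong[OF this, of "\<lambda>z. z $$ n"] show ?thesis by (simp add: center_def)
    qed
    have B_rel: "(\<Sum>w\<in>V. B w * word_value x y w) = 0"
    proof -
      have "(\<Sum>w\<in>W. B w * word_value x y w) = 0"
        using C_rel by (simp add: B_def mult.assoc flip: sum_distrib_left)
      thus ?thesis
        using sum.mono_neutral_right[OF W V(2), of "\<lambda>w. B w * word_value x y w"]
        by (auto simp: V_def B_def)
    qed
    have "V = {}"
    proof (rule ccontr)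
      assume ne: "V \<noteq> {}"
      define n where "n = Max (length ` V)"
      have len: "length w \<le> n" if "w \<in> V" for w using that V(1) by (simp add: n_def)
      have "n \<in> length ` V" unfolding n_def using V(1) ne by (intro Max_in) auto
      then obtain v where v: "v \<in> V" "length v = n" by auto
      show False
      proof (cases n)
        case 0
        hence "V = {[]}" using len v by auto
        thus False using B_rel B by auto
      next
        case (Suc k)
        define ev where "ev w = (\<Sum>j\<le>pdeg (B w). B w $$ (- int j) * e ^ j)" for w
        define T where "T = {w\<in>V. length w = n}"
        have T: "finite T" "T \<subseteq> V" using V by (auto simp: T_def)
        \<comment> \<open>the part of the relation that is spanned by shorter words\<close>
        define s where "s = (\<Sum>w\<in>T. B w * word_value x y w - fls_const (ev w) * word_value x y w)
           + (\<Sum>w\<in>V - T. B w * word_value x y w)"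
        have "s \<in> word_span x y k"
          unfolding s_def
        proof (intro word_span.add word_span_sum)
          fix w assume "w \<in> T"
          thus "B w * word_value x y w - fls_const (ev w) * word_value x y w \<in> word_span x y k"
            unfolding ev_def using B Suc by (intro poly_times_word) (auto simp: T_def)
        next
          fix w assume w: "w \<in> V - T"
          hence "length w \<le> k" using len[of w] Suc by (auto simp: T_def)
          hence "word_value x y w \<in> word_span x y k" using word_span.word[of w k 1 x y] by simp
          thus "B w * word_value x y w \<in> word_span x y k" using w B by (intro word_span_polys) auto
        qed
        then obtain l d where ld: "l \<in> polys" "d [] = 0"
          "s = l + (\<Sum>w\<in>words_upto k. fls_const (d w) * word_value x y w)"
          using word_span_normal_form by blast
        define d' where "d' w = (if length w \<le> k then d w else if w \<in> T then ev w else 0)" for w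
        have sub: "words_upto k \<subseteq> words_upto n" using Suc by auto
        have 1: "(\<Sum>w\<in>words_upto k. fls_const (d' w) * word_value x y w)
            = (\<Sum>w\<in>words_upto k. fls_const (d w) * word_value x y w)"
          by (intro sum.cong) (auto simp: d'_def)
        have 2: "(\<Sum>w\<in>words_upto n - words_upto k. fls_const (d' w) * word_value x y w)
            = (\<Sum>w\<in>T. fls_const (ev w) * word_value x y w)"
          using finite_words_upto[of n] Suc
          by (intro sum.mono_neutral_cong_right) (auto simp: d'_def T_def)
        have "l + (\<Sum>w\<in>words_upto n. fls_const (d' w) * word_value x y w)
            = s + (\<Sum>w\<in>T. fls_const (ev w) * word_value x y w)"
          unfolding sum.subset_diff[OF sub finite_words_upto] 1 2 ld(3) by (simp add: add.assoc add.commute)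
        also have "\<dots> = (\<Sum>w\<in>V. B w * word_value x y w)"
          unfolding s_def sum.subset_diff[OF T(2) V(1)] by (simp add: sum_subtractf)
        also have "\<dots> = 0" by (rule B_rel)
        finally have rel0: "l + (\<Sum>w\<in>words_upto n. fls_const (d' w) * word_value x y w) = 0" .
        have "\<forall>w\<in>words_upto n. d' w = 0"
        proof (rule words_left_independent[where l = l and e = e and f = f and g = g])
          show "a = 0 \<and> b = 0" if "e * a = a * e" "e * b = b * e" "a * f + b * g = e * u - u * e" for a b u
            using that by (rule crit)
          show "l \<in> polys" by fact
          show "d' [] = 0" using ld(2) by (simp add: d'_def)
          show "l + (\<Sum>w\<in>words_upto n. fls_const (d' w) *
            word_value (inverse (fls_X_inv - fls_const e) * fls_const f)
              (inverse (fls_X_inv - fls_const e) * fls_const g) w) = 0"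
            using rel0 unfolding x_def y_def P_def .
        qed
        hence "d' v = 0" using v by auto
        hence "ev v = 0" using v Suc by (auto simp: d'_def T_def)
        hence "\<forall>j\<le>pdeg (B v). B v $$ (- int j) = 0"
          unfolding ev_def by (intro trans B_cen[OF v(1)])
        thus False using polys_lead_nonzero[OF B[OF v(1)]] by blast
      qed
    qed
    hence "C w = 0" if "w \<in> W" for w using that by (auto simp: V_def)
    thus "\<forall>w\<in>W. c w = 0"
      unfolding C_def by (metis fls_of_ratfun_inject zero_ratfun.rep_eq)
  qed
  thus ?thesis by blast
qed

section \<open>Free pairs over rational functions from transcendental elements\<close>

lift_definition rf_const :: "'d::division_ring \<Rightarrow> 'd ratfun" is fls_const
  by (simp add: rational_polys)

lift_definition rf_var :: "'d::division_ring ratfun" is fls_X_inv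
  by (simp add: rational_polys)

lemmas ratfun_rep = zero_ratfun.rep_eq one_ratfun.rep_eq plus_ratfun.rep_eq minus_ratfun.rep_eq
  times_ratfun.rep_eq inverse_ratfun.rep_eq rf_const.rep_eq rf_var.rep_eq

lemma fls_of_ratfun_power: "fls_of_ratfun (x ^ n) = fls_of_ratfun x ^ n"
  by (induction n) (simp_all add: ratfun_rep)

lemma fls_of_ratfun_sum: "fls_of_ratfun (sum F I) = (\<Sum>i\<in>I. fls_of_ratfun (F i))"
  by (induction I rule: infinite_finite_induct) (simp_all add: ratfun_rep)

lemma fls_of_ratfun_eq_0_iff: "fls_of_ratfun x = 0 \<longleftrightarrow> x = 0"
  using fls_of_ratfun_inject[of x 0] by (simp add: ratfun_rep)

lemma dependent_powers_fls_of_ratfun: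
  assumes "dependent_powers a b" shows "dependent_powers (fls_of_ratfun a) (fls_of_ratfun b)"
proof -
  obtain m d i where d: "i \<le> m" "d i \<noteq> 0" "\<And>n. (\<Sum>i\<le>m. d i * a ^ n * b ^ i) = 0"
    using assms by (auto simp: dependent_powers_def)
  have "(\<Sum>i\<le>m. fls_of_ratfun (d i) * fls_of_ratfun a ^ n * fls_of_ratfun b ^ i) = 0" for n
    using arg_cong[OF d(3)[of n], of fls_of_ratfun]
    by (simp add: fls_of_ratfun_sum ratfun_rep fls_of_ratfun_power)
  thus ?thesis using d(1,2) unfolding dependent_powers_def
    by (intro exI[of _ m] exI[of _ "\<lambda>i. fls_of_ratfun (d i)"]) (auto simp: fls_of_ratfun_eq_0_iff)
qed

lemma dependent_powers_fls_const:
  assumes "dependent_powers (fls_const e) (fls_const y)" shows "dependent_powers e y"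
proof -
  obtain m d i where d: "i \<le> m" "d i \<noteq> 0" "\<And>n. (\<Sum>i\<le>m. d i * fls_const e ^ n * fls_const y ^ i) = 0"
    using assms by (auto simp: dependent_powers_def)
  obtain k where k: "d i $$ k \<noteq> 0" using d(2) nth_fls_subdegree_nonzero by blast
  have "(\<Sum>i\<le>m. d i $$ k * e ^ n * y ^ i) = 0" for n
    using arg_cong[OF d(3)[of n], of "\<lambda>z. z $$ k"]
    by (simp add: fls_nth_sum flip: fls_const_power)
  thus ?thesis using d(1) k unfolding dependent_powers_def
    by (intro exI[of _ m] exI[of _ "\<lambda>i. d i $$ k"]) auto
qed

lemma dependent_powers_rf_const:
  "dependent_powers (rf_const e) (rf_const y) \<Longrightarrow> dependent_powers e y"
  using dependent_powers_fls_of_ratfun[of "rf_const e" "rf_const y"]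
  by (simp add: ratfun_rep dependent_powers_fls_const)

text \<open>
  Two further variables supply resolvents \<open>f = (s\<^sub>2 - y)\<^sup>-\<^sup>1\<close> and \<open>g = (s\<^sub>1 - y)\<^sup>-\<^sup>1\<close> in
  \<open>D(s\<^sub>1)(s\<^sub>2)\<close>. In a relation \<open>a f + b g = [e, u]\<close>, the obstruction over \<open>D(s\<^sub>1)\<close> excludes
  \<open>a \<noteq> 0\<close>; if \<open>a = 0\<close>, dividing by \<open>b\<close> and taking the constant coefficient exhibits \<open>g\<close> as a
  commutator in \<open>D(s\<^sub>1)\<close>, which the obstruction over \<open>D\<close> excludes.
\<close>
lemma mutually_independent_powers_imp_free:
  fixes e y :: "'d::division_ring"
  assumes nd1: "\<not> dependent_powers e y" and nd2: "\<not> dependent_powers y e"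
  shows "\<exists>x z :: 'd ratfun ratfun ratfun. free_over_center x z"
proof -
  define e1 where "e1 = rf_const e"
  define y1 where "y1 = rf_const y"
  define g1 where "g1 = inverse (rf_var - rf_const y)"
  define f2 where "f2 = inverse (rf_var - rf_const y1)"
  have nd1': "\<not> dependent_powers e1 y1" and nd2': "\<not> dependent_powers y1 e1"
    using nd1 nd2 dependent_powers_rf_const by (auto simp: e1_def y1_def)
  have g1: "fls_of_ratfun g1 = resolvent y" and f2: "fls_of_ratfun f2 = resolvent y1"
    by (simp_all add: g1_def f2_def ratfun_rep resolvent_def)
  have g1_not: "g1 \<noteq> e1 * u - u * e1" for u
  proof
    assume "g1 = e1 * u - u * e1"
    hence "resolvent y = fls_const e * fls_of_ratfun u - fls_of_ratfun u * fls_const e"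
      using g1 by (simp add: ratfun_rep e1_def)
    thus False
      using commutator_obstruction[OF nd1 nd2, of 1 0 "fls_of_ratfun u" 0] fls_of_ratfun[of u]
      by (simp add: rational_polys)
  qed
  show ?thesis
  proof (rule free_over_center_ratfun[where e = "rf_const e1" and f = f2 and g = "rf_const g1"])
    fix a b u :: "'d ratfun ratfun"
    assume ea: "rf_const e1 * a = a * rf_const e1" and eb: "rf_const e1 * b = b * rf_const e1"
      and eq: "a * f2 + b * rf_const g1 = rf_const e1 * u - u * rf_const e1"
    have a0: "a = 0"
    proof (rule ccontr)
      assume "a \<noteq> 0"
      hence "fls_of_ratfun a \<noteq> 0" by (simp add: fls_of_ratfun_eq_0_iff)
      moreover have "fls_const e1 * fls_of_ratfun a = fls_of_ratfun a * fls_const e1"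
        "fls_const e1 * fls_of_ratfun b = fls_of_ratfun b * fls_const e1"
        using arg_cong[OF ea, of fls_of_ratfun] arg_cong[OF eb, of fls_of_ratfun]
        by (simp_all add: ratfun_rep)
      moreover have "fls_of_ratfun a * resolvent y1 + fls_of_ratfun b * fls_const g1
          = fls_const e1 * fls_of_ratfun u - fls_of_ratfun u * fls_const e1"
        using arg_cong[OF eq, of fls_of_ratfun] by (simp add: ratfun_rep f2)
      ultimately show False
        using commutator_obstruction[OF nd1' nd2' fls_of_ratfun fls_of_ratfun fls_of_ratfun] by blast
    qed
    have b0: "b = 0"
    proof (rule ccontr)
      assume b: "b \<noteq> 0"
      define w where "w = inverse b * u"
      have ib: "rf_const e1 * inverse b = inverse b * rf_const e1" using eb by (rule inverse_commutes)
      have "rf_const g1 = inverse b * (b * rf_const g1)" using b by (simp flip: mult.assoc)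
      also have "\<dots> = inverse b * (rf_const e1 * u - u * rf_const e1)" using eq a0 by simp
      also have "\<dots> = rf_const e1 * w - w * rf_const e1"
        by (simp add: w_def right_diff_distrib ib flip: mult.assoc)
      finally have "rf_const g1 = rf_const e1 * w - w * rf_const e1" .
      from arg_cong[OF this, of "\<lambda>z. fls_of_ratfun z $$ 0"]
      have "g1 = e1 * fls_of_ratfun w $$ 0 - fls_of_ratfun w $$ 0 * e1" by (simp add: ratfun_rep)
      thus False using g1_not by blast
    qed
    from a0 b0 show "a = 0 \<and> b = 0" ..
  next
    fix m :: nat and c :: "nat \<Rightarrow> 'd ratfun ratfun"
    assume c: "\<And>i. c i \<in> center" and rel: "(\<Sum>i\<le>m. c i * rf_const e1 ^ i) = 0"
    show "\<forall>i\<le>m. c i = 0"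
    proof (rule ccontr)
      assume "\<not> (\<forall>i\<le>m. c i = 0)"
      then obtain i where "i \<le> m" "c i \<noteq> 0" by blast
      hence "dependent_powers (rf_const y1) (rf_const e1)"
        using c rel by (intro dependent_powersI[of m c _ i]) (auto simp: center_def)
      thus False using nd2' dependent_powers_rf_const by blast
    qed
  qed
qed

lemma fls_times_nth_lead:
  assumes "\<And>n. n < k \<Longrightarrow> D $$ n = 0" and "\<And>n. n < 0 \<Longrightarrow> z $$ n = 0"
  shows "(D * z) $$ k = D $$ k * (z $$ 0 :: 'd::division_ring)"
proof -
  define z' where "z' = fls_shift 1 (z - fls_const (z $$ 0))"
  have z: "z = fls_const (z $$ 0) + fls_X * z'"
    by (intro fls_eqI) (auto simp: z'_def fls_X_times_conv_shift)
  have "(D * z') $$ (k - 1) = 0"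
  proof (cases "D = 0 \<or> z' = 0")
    case False
    have "fls_subdegree D \<ge> k" using False assms(1) by (intro fls_subdegree_geI) auto
    moreover have "fls_subdegree z' \<ge> 0" using False assms(2)
      by (intro fls_subdegree_geI) (auto simp: z'_def)
    ultimately show ?thesis by (intro fls_times_nth_eq0) auto
  qed auto
  moreover have "D * z = D * fls_const (z $$ 0) + fls_X * (D * z')"
  proof -
    have "D * (fls_X * z') = (D * fls_X) * z'" by (simp only: mult.assoc)
    also have "D * fls_X = fls_X * D" by (rule X_commutes[symmetric])
    finally have "D * (fls_X * z') = fls_X * (D * z')" by (simp only: mult.assoc)
    thus ?thesis using arg_cong[OF z, of "\<lambda>y. D * y"] by (simp add: distrib_left)
  qed
  ultimately show ?thesis by (simp add: fls_X_times_conv_shift)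
qed

lemma fls_power_nth_0:
  assumes "\<And>n. n < 0 \<Longrightarrow> z $$ n = 0"
  shows "(\<forall>n<0. (z ^ i) $$ n = 0) \<and> (z ^ i) $$ 0 = (z $$ 0 :: 'd::division_ring) ^ i"
proof (induction i)
  case (Suc i)
  have "(z * z ^ i) $$ n = 0" if "n < 0" for n
    using fls_times_nth_lead[of n z "z ^ i"] assms Suc that by auto
  moreover have "(z * z ^ i) $$ 0 = z $$ 0 * (z $$ 0) ^ i"
    using fls_times_nth_lead[of 0 z "z ^ i"] assms Suc by auto
  ultimately show ?case by simp
qed simp

lemma X_inv_mult_power: "(fls_X_inv * z) ^ i = fls_X_inv ^ i * (z :: 'd::division_ring fls) ^ i"
proof (induction i)
  case (Suc i)
  have "(fls_X_inv * z) ^ Suc i = fls_X_inv * (z * fls_X_inv ^ i) * z ^ i"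
    by (simp add: Suc mult.assoc)
  also have "z * fls_X_inv ^ i = fls_X_inv ^ i * z"
    by (simp add: fls_X_inv_power_times_conv_shift)
  finally show ?case by (simp add: mult.assoc)
qed simp

text \<open>
  Specialization at \<open>s = \<infinity>\<close>: the lowest coefficients in \<open>X\<close> of a relation.
\<close>
lemma dependent_powers_power_series:
  assumes A: "\<And>n. n < 0 \<Longrightarrow> A $$ n = 0" and B: "\<And>n. n < 0 \<Longrightarrow> B $$ n = 0"
    and D: "i \<le> m" "D i \<noteq> 0" and rel: "\<And>n. (\<Sum>i\<le>(m::nat). D i * B ^ n * A ^ i) = (0::'d::division_ring fls)"
  shows "dependent_powers (B $$ 0) (A $$ 0)"
proof -
  define S where "S = {i. i \<le> m \<and> D i \<noteq> 0}"
  define k where "k = Min ((\<lambda>i. fls_subdegree (D i)) ` S)"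
  have S: "finite S" "i \<in> S" using D by (auto simp: S_def)
  hence "k \<in> (\<lambda>i. fls_subdegree (D i)) ` S" unfolding k_def by (intro Min_in) auto
  then obtain j where j: "j \<in> S" "fls_subdegree (D j) = k" by auto
  have low: "D i $$ n = 0" if "i \<le> m" "n < k" for i n
  proof (cases "D i = 0")
    case False
    hence "k \<le> fls_subdegree (D i)" unfolding k_def using that S by (intro Min_le) (auto simp: S_def)
    thus ?thesis using that by simp
  qed simp
  have "(D i * (B ^ n * A ^ i)) $$ k = D i $$ k * ((B $$ 0) ^ n * (A $$ 0) ^ i)" if "i \<le> m" for i n
  proof -
    have BA: "(B ^ n * A ^ i) $$ l = (B ^ n) $$ l * (A ^ i) $$ 0" if "l \<le> 0" for l
      using fls_power_nth_0[OF A, of i] fls_power_nth_0[OF B, of n] that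
      by (intro fls_times_nth_lead) auto
    have "(D i * (B ^ n * A ^ i)) $$ k = D i $$ k * (B ^ n * A ^ i) $$ 0"
      using low[OF that] BA fls_power_nth_0[OF B, of n] by (intro fls_times_nth_lead) auto
    thus ?thesis using BA[of 0] fls_power_nth_0[OF A, of i] fls_power_nth_0[OF B, of n] by simp
  qed
  hence "(\<Sum>i\<le>m. D i $$ k * ((B $$ 0) ^ n * (A $$ 0) ^ i)) = (\<Sum>i\<le>m. D i * B ^ n * A ^ i) $$ k" for n
    by (simp add: fls_nth_sum mult.assoc)
  hence "(\<Sum>i\<le>m. D i $$ k * (B $$ 0) ^ n * (A $$ 0) ^ i) = 0" for n
    using rel by (simp add: mult.assoc)
  moreover have "D j $$ k \<noteq> 0" "j \<le> m" using j by (auto simp: S_def)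
  ultimately show ?thesis unfolding dependent_powers_def by (intro exI[of _ m] exI[of _ "\<lambda>i. D i $$ k"]) auto
qed

lemma polys_times_nth_0: "p \<in> polys \<Longrightarrow> q \<in> polys \<Longrightarrow> (p * q) $$ 0 = p $$ 0 * q $$ 0"
  by (subst polys_times_nth[OF _ order_refl], assumption, subst sum.atMost_shift) (simp add: polysD)

lemma polys_power: "p \<in> polys \<Longrightarrow> p ^ i \<in> polys"
  by (induction i) (auto simp: polys_mult)

lemma polys_power_nth_0: "p \<in> polys \<Longrightarrow> (p ^ i) $$ 0 = (p $$ 0) ^ i"
  by (induction i) (auto simp: polys_times_nth_0 polys_power)

text \<open>
  Specialization at \<open>s = 0\<close>: after clearing denominators, divide by the largest common power of
  \<open>s\<close> and take constant terms.
\<close>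
lemma dependent_powers_polys:
  assumes A: "A \<in> polys" and B: "B \<in> polys"
    and D: "i \<le> m" "D i \<noteq> 0" "\<And>i. i \<le> m \<Longrightarrow> D i \<in> rational_fls"
    and rel: "\<And>n. (\<Sum>i\<le>(m::nat). D i * B ^ n * A ^ i) = (0::'d::division_ring fls)"
  shows "dependent_powers (B $$ 0) (A $$ 0)"
proof -
  obtain g where g: "g \<in> polys" "g \<noteq> 0" "\<And>i. i \<le> m \<Longrightarrow> g * D i \<in> polys"
    using rational_common_denominator[of "D ` {..m}"] D(3) by (auto simp: image_subset_iff)
  define G where "G i = g * D i" for i
  have G: "G i \<in> polys" if "i \<le> m" for i using g that by (simp add: G_def)
  have "G i \<noteq> 0" using g D by (simp add: G_def)
  have "\<exists>j. \<exists>i\<le>m. G i $$ (- int j) \<noteq> 0"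
    using polys_lead_nonzero[OF G[OF D(1)] \<open>G i \<noteq> 0\<close>] D(1) by blast
  then obtain j where j: "\<exists>i\<le>m. G i $$ (- int j) \<noteq> 0" and least: "\<forall>k<j. \<not> (\<exists>i\<le>m. G i $$ (- int k) \<noteq> 0)"
    using exists_least_iff[of "\<lambda>j. \<exists>i\<le>m. G i $$ (- int j) \<noteq> 0"] by blast
  define H where "H i = fls_X ^ j * G i" for i
  have Hn: "H i $$ n = G i $$ (n - int j)" for i n
    by (simp add: H_def fls_X_power_times_conv_shift)
  have H: "H i \<in> polys" if "i \<le> m" for i
  proof (rule polysI)
    fix n :: int assume n: "n > 0"
    show "H i $$ n = 0"
    proof (cases "n > int j")
      case True thus ?thesis using G[OF that] by (simp add: Hn polysD)
    next
      case False
      define k where "k = nat (int j - n)"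
      have "k < j" "n - int j = - int k" using n False by (auto simp: k_def)
      thus ?thesis using least that by (simp add: Hn)
    qed
  qed
  have "(\<Sum>i\<le>m. H i $$ 0 * (B $$ 0) ^ n * (A $$ 0) ^ i) = 0" for n
  proof -
    have "(\<Sum>i\<le>m. H i * B ^ n * A ^ i) = fls_X ^ j * (g * (\<Sum>i\<le>m. D i * B ^ n * A ^ i))"
      by (simp add: H_def G_def sum_distrib_left mult.assoc)
    hence "0 = (\<Sum>i\<le>m. H i * B ^ n * A ^ i) $$ 0" using rel by simp
    also have "\<dots> = (\<Sum>i\<le>m. H i $$ 0 * (B $$ 0) ^ n * (A $$ 0) ^ i)"
      using H A B by (simp add: fls_nth_sum polys_times_nth_0 polys_mult polys_power polys_power_nth_0)
    finally show ?thesis ..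
  qed
  moreover obtain i' where "i' \<le> m" "H i' $$ 0 \<noteq> 0" using j by (auto simp: Hn)
  ultimately show ?thesis unfolding dependent_powers_def
    by (intro exI[of _ m] exI[of _ "\<lambda>i. H i $$ 0"]) auto
qed

text \<open>
  The elements \<open>e + s y\<close> and \<open>y + s e\<close> are independent both ways: a relation in one order
  specializes at \<open>s = 0\<close>, and one in the other order at \<open>s = \<infinity>\<close>, to a relation for \<open>e\<close> and \<open>y\<close>
  in the same order.
\<close>
lemma independent_powers_imp_free:
  fixes e y :: "'d::division_ring"
  assumes nd: "\<not> dependent_powers e y"
  shows "\<exists>x z :: 'd ratfun ratfun ratfun ratfun. free_over_center x z"
proof (rule mutually_independent_powers_imp_free)
  let ?a = "rf_const e + rf_var * rf_const y" and ?b = "rf_const y + rf_var * rf_const e"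
  define A where "A = fls_const e + fls_X_inv * fls_const y"
  define B where "B = fls_const y + fls_X_inv * fls_const e"
  have rep: "fls_of_ratfun ?a = A" "fls_of_ratfun ?b = B"
    by (simp_all add: ratfun_rep A_def B_def)
  have AB: "A \<in> polys" "B \<in> polys" by (simp_all add: A_def B_def polys_add polys_mult)
  have AB0: "A $$ 0 = e" "B $$ 0 = y"
    by (simp_all add: A_def B_def fls_X_inv_times_conv_shift)
  show "\<not> dependent_powers ?a ?b"
  proof
    assume "dependent_powers ?a ?b"
    then obtain m d i where d: "i \<le> m" "d i \<noteq> 0" "\<And>n. (\<Sum>i\<le>m. d i * ?a ^ n * ?b ^ i) = 0"
      by (auto simp: dependent_powers_def)
    have "(\<Sum>i\<le>m. fls_of_ratfun (d i) * A ^ n * B ^ i) = 0" for n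
      using arg_cong[OF d(3)[of n], of fls_of_ratfun] rep
      by (simp add: fls_of_ratfun_sum times_ratfun.rep_eq fls_of_ratfun_power zero_ratfun.rep_eq)
    hence "dependent_powers (A $$ 0) (B $$ 0)"
      using d(1,2) AB fls_of_ratfun
      by (intro dependent_powers_polys[of B A i m "\<lambda>i. fls_of_ratfun (d i)"]) (auto simp: fls_of_ratfun_eq_0_iff)
    thus False using nd AB0 by simp
  qed
  show "\<not> dependent_powers ?b ?a"
  proof
    assume "dependent_powers ?b ?a"
    hence "dependent_powers B A" using dependent_powers_fls_of_ratfun rep by metis
    then obtain m d i where d: "i \<le> m" "d i \<noteq> 0" "\<And>n. (\<Sum>i\<le>m. d i * B ^ n * A ^ i) = 0"
      by (auto simp: dependent_powers_def)
    \<comment> \<open>Divide by \<open>s\<close> to obtain power series in \<open>X\<close>.\<close>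
    define A1 where "A1 = fls_const y + fls_X * fls_const e"
    define B1 where "B1 = fls_const e + fls_X * fls_const y"
    have XX: "fls_X_inv * (fls_X * z) = (z :: 'd fls)" for z
      by (simp add: fls_X_inv_times_conv_shift fls_X_times_conv_shift)
    have A1: "A = fls_X_inv * A1" and B1: "B = fls_X_inv * B1"
      by (simp_all add: A_def B_def A1_def B1_def distrib_left XX)
    have nn: "A1 $$ n = 0" "B1 $$ n = 0" if "n < 0" for n
      using that by (simp_all add: A1_def B1_def fls_X_times_conv_shift)
    have n0: "A1 $$ 0 = y" "B1 $$ 0 = e" by (simp_all add: A1_def B1_def fls_X_times_conv_shift)
    have "(\<Sum>i\<le>m. (d i * fls_X_inv ^ i) * B1 ^ n * A1 ^ i) = 0" for n
    proof -
      have X: "fls_X_inv ^ j * z = z * fls_X_inv ^ j" for j and z :: "'d fls"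
        by (simp add: fls_X_inv_power_times_conv_shift)
      have "d i * B ^ n * A ^ i = fls_X_inv ^ n * ((d i * fls_X_inv ^ i) * B1 ^ n * A1 ^ i)" for i
      proof -
        have "d i * B ^ n * A ^ i = (d i * fls_X_inv ^ n) * (B1 ^ n * fls_X_inv ^ i) * A1 ^ i"
          unfolding A1 B1 X_inv_mult_power by (simp only: mult.assoc)
        also have "d i * fls_X_inv ^ n = fls_X_inv ^ n * d i" by (rule X[symmetric])
        also have "B1 ^ n * fls_X_inv ^ i = fls_X_inv ^ i * B1 ^ n" by (rule X[symmetric])
        finally show ?thesis by (simp only: mult.assoc)
      qed
      hence "fls_X_inv ^ n * (\<Sum>i\<le>m. (d i * fls_X_inv ^ i) * B1 ^ n * A1 ^ i) = 0"
        using d(3)[of n] by (simp add: sum_distrib_left)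
      thus ?thesis by simp
    qed
    hence "dependent_powers (B1 $$ 0) (A1 $$ 0)"
      using d(1,2) nn by (intro dependent_powers_power_series[of A1 B1 i m "\<lambda>i. d i * fls_X_inv ^ i"]) auto
    thus False using nd n0 by simp
  qed
qed

section \<open>Specializing a central variable\<close>

text \<open>
  With the multiplications by the elements of a set as \<open>F\<close>, this covers both ideals and subspaces over a
  subfield that is only a set.
\<close>
definition stable_subset :: "('a \<Rightarrow> 'a) set \<Rightarrow> 'a::monoid_add set \<Rightarrow> bool" where
  "stable_subset F M \<longleftrightarrow> 0 \<in> M \<and> (\<forall>x\<in>M. \<forall>y\<in>M. x + y \<in> M) \<and> (\<forall>f\<in>F. \<forall>x\<in>M. f x \<in> M)"

lemma maximal_stable_subset_avoiding:
  fixes z :: "'a::monoid_add"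
  assumes z: "z \<noteq> 0" and R: "0 \<in> R" and F: "\<forall>f\<in>F. f 0 = 0"
  obtains M where "M \<subseteq> R" "stable_subset F M" "z \<notin> M"
    "\<And>X. M \<subseteq> X \<Longrightarrow> X \<subseteq> R \<Longrightarrow> stable_subset F X \<Longrightarrow> z \<notin> X \<Longrightarrow> X = M"
proof -
  define \<W> where "\<W> = {M. M \<subseteq> R \<and> stable_subset F M \<and> z \<notin> M}"
  have "\<exists>M\<in>\<W>. \<forall>X\<in>\<W>. M \<subseteq> X \<longrightarrow> X = M"
  proof (rule subset_Zorn_nonempty)
    have "f x \<in> {0}" if "f \<in> F" "x \<in> {0}" for f x using that bspec[OF F that(1)] by simp
    hence "stable_subset F {0}" by (simp add: stable_subset_def)
    hence "{0} \<in> \<W>" using z R by (simp add: \<W>_def)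
    thus "\<W> \<noteq> {}" by blast
    fix C assume C: "C \<noteq> {}" "subset.chain \<W> C"
    hence CW: "C \<subseteq> \<W>" and lin: "\<And>X Y. X \<in> C \<Longrightarrow> Y \<in> C \<Longrightarrow> X \<subseteq> Y \<or> Y \<subseteq> X"
      by (auto simp: subset.chain_def)
    have st: "stable_subset F X" if "X \<in> C" for X using subsetD[OF CW that] by (simp add: \<W>_def)
    have "x + y \<in> \<Union>C" if xy: "x \<in> \<Union>C" "y \<in> \<Union>C" for x y
    proof -
      obtain X Y where XY: "X \<in> C" "Y \<in> C" "x \<in> X" "y \<in> Y" using xy by blast
      then obtain Z where Z: "Z \<in> C" "x \<in> Z" "y \<in> Z" using lin[OF XY(1,2)] by blast
      thus ?thesis using st[OF Z(1)] unfolding stable_subset_def by blast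
    qed
    moreover have "f x \<in> \<Union>C" if "f \<in> F" "x \<in> \<Union>C" for f x
      using that st unfolding stable_subset_def by blast
    moreover have "0 \<in> \<Union>C" using C(1) st unfolding stable_subset_def by blast
    ultimately have "stable_subset F (\<Union>C)" by (simp add: stable_subset_def)
    moreover have "\<Union>C \<subseteq> R" "z \<notin> \<Union>C" using CW by (auto simp: \<W>_def)
    ultimately show "\<Union>C \<in> \<W>" by (simp add: \<W>_def)
  qed
  then obtain M where "M \<in> \<W>" and "\<And>X. X \<in> \<W> \<Longrightarrow> M \<subseteq> X \<Longrightarrow> X = M" by blast
  thus ?thesis using that[of M] by (simp add: \<W>_def)
qed

text \<open>
  A right \<open>E\<close>-subspace maximal among those that omit \<open>z\<close> is a complement of \<open>z E\<close>.
\<close>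
lemma subfield_functional:
  fixes E :: "'d::division_ring set"
  assumes E: "is_subfield E" and z: "z \<noteq> 0"
  obtains h where "\<And>d. h d \<in> E" "\<And>x y. h (x + y) = h x + h y" "\<And>d c. c \<in> E \<Longrightarrow> h (d * c) = h d * c" "h z = 1"
proof -
  have E0: "0 \<in> E" "1 \<in> E" and Ep: "\<And>x y. x \<in> E \<Longrightarrow> y \<in> E \<Longrightarrow> x + y \<in> E"
    and Em: "\<And>x y. x \<in> E \<Longrightarrow> y \<in> E \<Longrightarrow> x * y \<in> E" and En: "\<And>x. x \<in> E \<Longrightarrow> - x \<in> E"
    and Ei: "\<And>x. x \<in> E \<Longrightarrow> inverse x \<in> E"
    using E unfolding is_subfield_def by (metis inverse_zero)+
  define F where "F = (\<lambda>c x. x * c) ` E"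
  have F0: "\<forall>f\<in>F. f 0 = 0" by (simp add: F_def)
  obtain M where "M \<subseteq> UNIV" and M: "stable_subset F M" and Mz: "z \<notin> M"
    and max: "\<And>X. M \<subseteq> X \<Longrightarrow> X \<subseteq> UNIV \<Longrightarrow> stable_subset F X \<Longrightarrow> z \<notin> X \<Longrightarrow> X = M"
    by (rule maximal_stable_subset_avoiding[OF z UNIV_I F0]) (rule that)
  have M0: "0 \<in> M" and Mp: "\<And>x y. x \<in> M \<Longrightarrow> y \<in> M \<Longrightarrow> x + y \<in> M"
    and Mc: "\<And>x c. x \<in> M \<Longrightarrow> c \<in> E \<Longrightarrow> x * c \<in> M"
    using M by (simp_all add: stable_subset_def F_def)
  have Mn: "- x \<in> M" if "x \<in> M" for x
    using Mc[OF that, of "-1"] En[OF E0(2)] by simp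
  have Md: "x - y \<in> M" if "x \<in> M" "y \<in> M" for x y
    using Mp[OF that(1) Mn[OF that(2)]] by simp
  have ex: "\<exists>c\<in>E. d - z * c \<in> M" for d
  proof (cases "d \<in> M")
    case True thus ?thesis using E0 by (intro bexI[of _ 0]) auto
  next
    case False
    define X where "X = {w + d * c |w c. w \<in> M \<and> c \<in> E}"
    have MX: "M \<subseteq> X" unfolding X_def using E0(1) by force
    have "d \<in> X" unfolding X_def using M0 E0(2) by force
    hence "X \<noteq> M" using False by blast
    have "0 \<in> X" using MX M0 by blast
    moreover have "x + y \<in> X" if xy: "x \<in> X" "y \<in> X" for x y
    proof -
      obtain w c w' c' where "x = w + d * c" "y = w' + d * c'" "w \<in> M" "w' \<in> M" "c \<in> E" "c' \<in> E"
        using xy by (auto simp: X_def)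
      moreover from this have "x + y = (w + w') + d * (c + c')" by (simp add: algebra_simps)
      ultimately show ?thesis unfolding X_def using Mp Ep by blast
    qed
    moreover have "x * b \<in> X" if xb: "x \<in> X" "b \<in> E" for x b
    proof -
      obtain w c where "x = w + d * c" "w \<in> M" "c \<in> E" using xb by (auto simp: X_def)
      moreover from this have "x * b = w * b + d * (c * b)" by (simp add: algebra_simps)
      ultimately show ?thesis unfolding X_def using Mc Em xb(2) by blast
    qed
    ultimately have "stable_subset F X" by (simp add: stable_subset_def F_def)
    hence "z \<in> X" using max[OF MX subset_UNIV] \<open>X \<noteq> M\<close> by blast
    then obtain w c where wc: "z = w + d * c" "w \<in> M" "c \<in> E" by (auto simp: X_def)
    have c0: "c \<noteq> 0" using wc Mz by auto
    have "d * c = z - w" using wc by simp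
    hence "d * c * inverse c = z * inverse c - w * inverse c" by (simp add: left_diff_distrib)
    hence "d - z * inverse c = - (w * inverse c)" using c0 by (simp add: mult.assoc)
    thus ?thesis using Mn[OF Mc[OF wc(2) Ei[OF wc(3)]]] Ei[OF wc(3)] by metis
  qed
  have uniq: "c = c'" if "c \<in> E" "c' \<in> E" "d - z * c \<in> M" "d - z * c' \<in> M" for c c' d
  proof (rule ccontr)
    assume "c \<noteq> c'"
    hence ne: "c - c' \<noteq> 0" by simp
    have cE: "c - c' \<in> E" using Ep[OF that(1) En[OF that(2)]] by simp
    have "(d - z * c') - (d - z * c) = z * (c - c')" by (simp add: algebra_simps)
    hence "z * (c - c') \<in> M" using Md[OF that(4,3)] by simp
    hence "z * (c - c') * inverse (c - c') \<in> M" using Mc Ei[OF cE] by blast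
    thus False using ne Mz by (simp add: mult.assoc)
  qed
  obtain h where h: "\<And>d. h d \<in> E" "\<And>d. d - z * h d \<in> M" using ex by metis
  have heq: "h d = c" if "c \<in> E" "d - z * c \<in> M" for d c
    using uniq[OF h(1) that(1) h(2) that(2)] .
  show ?thesis
  proof (rule that[of h])
    show "h d \<in> E" for d by (rule h(1))
    show "h (x + y) = h x + h y" for x y
    proof (rule heq)
      have "x + y - z * (h x + h y) = (x - z * h x) + (y - z * h y)" by (simp add: algebra_simps)
      thus "x + y - z * (h x + h y) \<in> M" using Mp[OF h(2) h(2)] by metis
    qed (intro Ep h(1))
    show "h (d * c) = h d * c" if "c \<in> E" for d c
    proof (rule heq)
      have "d * c - z * (h d * c) = (d - z * h d) * c" by (simp add: algebra_simps)
      thus "d * c - z * (h d * c) \<in> M" using Mc[OF h(2) that] by metis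
    qed (intro Em h(1) that)
    show "h z = 1" by (rule heq) (use E0 M0 in auto)
  qed
qed

lemma center_simps:
  "0 \<in> (center :: 'd::division_ring set)" "1 \<in> (center :: 'd set)"
  "a \<in> center \<Longrightarrow> b \<in> center \<Longrightarrow> a + b \<in> (center :: 'd set)"
  "a \<in> center \<Longrightarrow> b \<in> center \<Longrightarrow> a * b \<in> (center :: 'd set)"
  "a \<in> center \<Longrightarrow> - a \<in> (center :: 'd set)" "a \<in> center \<Longrightarrow> inverse a \<in> (center :: 'd set)"
proof -
  show "0 \<in> (center :: 'd set)" "1 \<in> (center :: 'd set)" by (simp_all add: center_def)
  show "a \<in> center \<Longrightarrow> b \<in> center \<Longrightarrow> a + b \<in> (center :: 'd set)"
    by (simp add: center_def distrib_left distrib_right)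
  show "a \<in> center \<Longrightarrow> - a \<in> (center :: 'd set)" by (simp add: center_def)
  show "a * b \<in> (center :: 'd set)" if "a \<in> center" "b \<in> center"
  proof -
    have "a * b * x = x * (a * b)" for x
    proof -
      have "a * b * x = a * (x * b)" using that(2) by (simp add: center_def mult.assoc)
      also have "\<dots> = x * a * b" using that(1) by (simp add: center_def flip: mult.assoc)
      finally show ?thesis by (simp add: mult.assoc)
    qed
    thus ?thesis by (simp add: center_def)
  qed
  show "inverse a \<in> (center :: 'd set)" if "a \<in> center"
    using inverse_commutes[of _ a] that by (auto simp: center_def)
qed

lemma center_power: "a \<in> center \<Longrightarrow> a ^ n \<in> (center :: 'd::division_ring set)"
  by (induction n) (simp_all add: center_simps)

lemma center_commute: "a \<in> center \<Longrightarrow> x * a = a * x"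
  by (simp add: center_def)

lemma is_subfield_center: "is_subfield (center :: 'd::division_ring set)"
  unfolding is_subfield_def by (intro conjI ballI impI center_simps center_commute)

definition poly_eval :: "'d::division_ring fls \<Rightarrow> 'd \<Rightarrow> 'd" where
  "poly_eval q a = (\<Sum>j\<le>pdeg q. q $$ (- int j) * a ^ j)"

lemma poly_eval_upto:
  assumes "\<And>j. j > N \<Longrightarrow> q $$ (- int j) = 0"
  shows "poly_eval q a = (\<Sum>j\<le>N. q $$ (- int j) * a ^ j)"
proof -
  have "poly_eval q a = (\<Sum>j\<le>max N (pdeg q). q $$ (- int j) * a ^ j)"
    unfolding poly_eval_def by (intro sum.mono_neutral_left) (auto simp: polys_nth_above_pdeg)
  also have "\<dots> = (\<Sum>j\<le>N. q $$ (- int j) * a ^ j)"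
    by (intro sum.mono_neutral_right) (auto simp: assms)
  finally show ?thesis .
qed

lemma poly_eval_add: "poly_eval (p + q) a = poly_eval p a + poly_eval q a"
proof -
  let ?N = "max (pdeg p) (pdeg q)"
  have "poly_eval r a = (\<Sum>j\<le>?N. r $$ (- int j) * a ^ j)" if "r = p \<or> r = q \<or> r = p + q" for r
    using that by (intro poly_eval_upto) (auto simp: polys_nth_above_pdeg)
  thus ?thesis by (simp add: distrib_right sum.distrib)
qed

lemma poly_eval_0 [simp]: "poly_eval 0 a = 0"
  and poly_eval_const [simp]: "poly_eval (fls_const c) a = c"
  by (simp_all add: poly_eval_def pdeg_def)

lemma poly_eval_sum: "poly_eval (sum f I) a = (\<Sum>i\<in>I. poly_eval (f i) a)"
  by (induction I rule: infinite_finite_induct) (simp_all add: poly_eval_add)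

lemma poly_eval_const_mult: "poly_eval (fls_const c * q) a = c * poly_eval q a"
proof -
  have "poly_eval (fls_const c * q) a = (\<Sum>j\<le>pdeg q. (fls_const c * q) $$ (- int j) * a ^ j)"
    by (intro poly_eval_upto) (auto simp: polys_nth_above_pdeg)
  thus ?thesis by (simp add: poly_eval_def sum_distrib_left mult.assoc)
qed

lemma poly_eval_X_inv_mult:
  assumes "q \<in> polys" shows "poly_eval (fls_X_inv * q) a = poly_eval q a * a"
proof -
  have nth: "(fls_X_inv * q) $$ (- int (Suc j)) = q $$ (- int j)" "(fls_X_inv * q) $$ 0 = 0" for j
    using assms by (simp_all add: fls_X_inv_times_conv_shift polysD)
  have "poly_eval (fls_X_inv * q) a = (\<Sum>j\<le>Suc (pdeg q). (fls_X_inv * q) $$ (- int j) * a ^ j)"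
  proof (intro poly_eval_upto)
    fix j assume "Suc (pdeg q) < j"
    then obtain i where "j = Suc i" "pdeg q < i" by (cases j) auto
    thus "(fls_X_inv * q) $$ (- int j) = 0" using nth(1)[of i] polys_nth_above_pdeg[of q i] by simp
  qed
  also have "\<dots> = (\<Sum>j\<le>pdeg q. q $$ (- int j) * a ^ Suc j)"
    by (subst sum.atMost_Suc_shift, unfold nth) (simp add: nth(2))
  finally show ?thesis by (simp add: poly_eval_def sum_distrib_right mult.assoc power_Suc2 del: power_Suc)
qed

lemma poly_eval_mult:
  assumes a: "a \<in> center" and p: "p \<in> polys" and q: "q \<in> polys"
  shows "poly_eval (p * q) a = poly_eval p a * poly_eval q a"
proof -
  have X: "poly_eval (fls_X_inv ^ j * q) a = poly_eval q a * a ^ j" for j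
  proof (induction j)
    case (Suc j)
    have "poly_eval (fls_X_inv * (fls_X_inv ^ j * q)) a = poly_eval (fls_X_inv ^ j * q) a * a"
      by (intro poly_eval_X_inv_mult polys_mult polys_X_inv q)
    moreover have "fls_X_inv ^ Suc j * q = fls_X_inv * (fls_X_inv ^ j * q)" by (simp add: mult.assoc)
    ultimately show ?case unfolding power_Suc2[of a] by (simp only: Suc mult.assoc)
  qed simp
  have "p * q = (\<Sum>j\<le>pdeg p. fls_const (p $$ (- int j)) * (fls_X_inv ^ j * q))"
    by (subst polys_expand[OF p order_refl]) (simp add: sum_distrib_right mult.assoc)
  hence "poly_eval (p * q) a = (\<Sum>j\<le>pdeg p. p $$ (- int j) * (poly_eval q a * a ^ j))"
    by (simp add: poly_eval_sum poly_eval_const_mult X)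
  also have "\<dots> = (\<Sum>j\<le>pdeg p. p $$ (- int j) * (a ^ j * poly_eval q a))"
    by (simp only: center_commute[OF center_power[OF a]])
  finally show ?thesis by (simp add: poly_eval_def sum_distrib_right mult.assoc)
qed

text \<open>
  A central root splits off a central linear factor, which can be evaluated multiplicatively.
\<close>
lemma finite_central_roots:
  assumes "q \<in> polys" "q \<noteq> 0" shows "finite {a \<in> center. poly_eval q a = 0}"
  using assms
proof (induction "pdeg q" arbitrary: q rule: less_induct)
  case less
  show ?case
  proof (cases "\<exists>b\<in>center. poly_eval q b = 0")
    case False
    hence "{a \<in> center. poly_eval q a = 0} = {}" by blast
    thus ?thesis by (simp only: finite.emptyI)
  next
    case True
    then obtain b where b: "b \<in> center" "poly_eval q b = 0" by blast
    define v where "v = fls_X_inv - fls_const b"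
    have v: "v \<in> polys" "v \<noteq> 0"
      using X_inv_minus_const_nonzero by (auto simp: v_def polys_diff)
    have ev: "poly_eval v a = a - b" for a
      using poly_eval_add[of v "fls_const b" a] poly_eval_X_inv_mult[of 1 a] poly_eval_const[of 1 a]
      by (simp add: v_def algebra_simps)
    have "pdeg v < 2"
      by (rule pdeg_less[OF v]) (auto simp: v_def)
    moreover have "v $$ (- int 1) \<noteq> 0" by (simp add: v_def)
    hence "\<not> pdeg v < 1" using polys_nth_above_pdeg[of v 1] by blast
    ultimately have degv: "pdeg v = 1" by simp
    obtain k where k: "k \<in> polys" "q - k * v = 0 \<or> pdeg (q - k * v) < 1"
      using polys_division[OF v less.prems(1)] degv by auto
    define r where "r = q - k * v"
    have r: "r \<in> polys" using less.prems k v by (simp add: r_def polys_diff polys_mult)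
    have "r = fls_const (r $$ 0)"
    proof (cases "r = 0")
      case False
      hence "pdeg r = 0" using k by (simp add: r_def)
      thus ?thesis using polys_expand[OF r, of 0] by simp
    qed simp
    moreover have "poly_eval r b = 0"
    proof -
      have "q = r + k * v" by (simp add: r_def)
      hence "poly_eval q b = poly_eval r b + poly_eval k b * poly_eval v b"
        using poly_eval_mult[OF b(1) k(1) v(1)] poly_eval_add by metis
      thus ?thesis using b ev by simp
    qed
    ultimately have "r = 0" by (metis poly_eval_const fls_const_0)
    hence qk: "q = k * v" by (simp add: r_def)
    hence k0: "k \<noteq> 0" using less.prems by auto
    have "pdeg q = pdeg k + 1" using pdeg_mult[OF k(1) v(1) k0 v(2)] degv qk by simp
    hence fin: "finite {a \<in> center. poly_eval k a = 0}" using less.hyps[of k] k k0 by simp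
    have "{a \<in> center. poly_eval q a = 0} \<subseteq> insert b {a \<in> center. poly_eval k a = 0}"
      using poly_eval_mult[OF _ k(1) v(1)] qk ev by auto
    thus ?thesis using fin finite_subset by blast
  qed
qed

abbreviation almost_all_central :: "'d::division_ring filter" where
  "almost_all_central \<equiv> inf cofinite (principal center)"

lemma eventually_almost_all_central:
  "eventually P almost_all_central \<longleftrightarrow> finite {a \<in> center. \<not> P a}"
  by (simp add: eventually_inf_principal eventually_cofinite)

lemma eventually_central: "eventually (\<lambda>a. a \<in> center) almost_all_central"
  by (simp add: eventually_almost_all_central)

lemma eventually_poly_eval_nonzero:
  "q \<in> polys \<Longrightarrow> q \<noteq> 0 \<Longrightarrow> eventually (\<lambda>a. poly_eval q a \<noteq> 0) almost_all_central"
  using finite_central_roots[of q] by (simp add: eventually_almost_all_central)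

definition denominator :: "'d::division_ring fls \<Rightarrow> 'd fls" where
  "denominator z = (SOME g. g \<in> polys \<and> g \<noteq> 0 \<and> g * z \<in> polys)"

text \<open>
  Evaluation of a rational function by means of one chosen denominator. It is multiplicative only up
  to finitely many central values (zeros of denominators), which is why the statements below
  use a filter.
\<close>
definition fraction_eval :: "'d::division_ring fls \<Rightarrow> 'd \<Rightarrow> 'd" where
  "fraction_eval z a = inverse (poly_eval (denominator z) a) * poly_eval (denominator z * z) a"

lemma denominator:
  assumes "z \<in> rational_fls"
  shows "denominator z \<in> polys" "denominator z \<noteq> 0" "denominator z * z \<in> polys"
proof -
  have "\<exists>g. g \<in> polys \<and> g \<noteq> 0 \<and> g * z \<in> polys" using assms by (auto simp: rational_fls_def)
  from someI_ex[OF this] show "denominator z \<in> polys" "denominator z \<noteq> 0" "denominator z * z \<in> polys"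
    unfolding denominator_def by blast+
qed

lemma fraction_eval_any_denominator:
  assumes z: "z \<in> rational_fls" and h: "h \<in> polys" "h * z \<in> polys"
  shows "eventually (\<lambda>a. poly_eval (h * z) a = poly_eval h a * fraction_eval z a) almost_all_central"
proof (cases "h = 0")
  case False
  let ?g = "denominator z"
  note g = denominator[OF z]
  obtain c b where cb: "c \<in> polys" "b \<in> polys" "c \<noteq> 0" "b \<noteq> 0" "c * h = b * ?g"
    using polys_left_ore[OF h(1) False g(1,2)] by blast
  show ?thesis
    using eventually_central eventually_poly_eval_nonzero[OF cb(1,3)] eventually_poly_eval_nonzero[OF g(1,2)]
  proof eventually_elim
    case (elim a)
    note em = poly_eval_mult[OF elim(1)]
    have "poly_eval c a * poly_eval (h * z) a = poly_eval (c * h * z) a"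
      using em[OF cb(1) h(2)] by (simp add: mult.assoc)
    also have "\<dots> = poly_eval b a * poly_eval (?g * z) a"
      unfolding cb(5) using em[OF cb(2) g(3)] by (simp add: mult.assoc)
    also have "\<dots> = poly_eval b a * poly_eval ?g a * fraction_eval z a"
    proof -
      have "poly_eval (?g * z) a = poly_eval ?g a * fraction_eval z a"
        using elim(3) by (simp add: fraction_eval_def flip: mult.assoc)
      thus ?thesis by (simp add: mult.assoc)
    qed
    also have "poly_eval b a * poly_eval ?g a = poly_eval c a * poly_eval h a"
      using em[OF cb(2) g(1)] em[OF cb(1) h(1)] cb(5) by simp
    finally show ?case using elim(2) by (simp add: mult.assoc)
  qed
qed simp

lemma fraction_eval_mult:
  assumes z: "z \<in> rational_fls" and w: "w \<in> rational_fls"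
  shows "eventually (\<lambda>a. fraction_eval (z * w) a = fraction_eval z a * fraction_eval w a) almost_all_central"
proof (cases "z = 0")
  case True
  thus ?thesis by (simp add: fraction_eval_def)
next
  case False
  let ?g = "denominator z" and ?h = "denominator w"
  note g = denominator[OF z] and h = denominator[OF w]
  have p0: "?g * z \<noteq> 0" using g False by simp
  obtain c b where cb: "c \<in> polys" "b \<in> polys" "c \<noteq> 0" "b \<noteq> 0" "c * (?g * z) = b * ?h"
    using polys_left_ore[OF g(3) p0 h(1,2)] by blast
  have eq: "(c * ?g) * (z * w) = b * (?h * w)" using cb(5) by (metis mult.assoc)
  have cg: "c * ?g \<in> polys" "c * ?g \<noteq> 0" using cb g by (auto simp: polys_mult)
  have cgzw: "(c * ?g) * (z * w) \<in> polys" unfolding eq using cb h by (simp add: polys_mult)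
  show ?thesis
    using eventually_central eventually_poly_eval_nonzero[OF cg]
      fraction_eval_any_denominator[OF rational_mult[OF z w] cg(1) cgzw]
      fraction_eval_any_denominator[OF z g(1,3)] fraction_eval_any_denominator[OF w h(1,3)]
  proof eventually_elim
    case (elim a)
    note em = poly_eval_mult[OF elim(1)]
    have "poly_eval (c * ?g) a * fraction_eval (z * w) a = poly_eval b a * poly_eval (?h * w) a"
      using elim(3) unfolding eq using em[OF cb(2) h(3)] by simp
    also have "\<dots> = poly_eval (b * ?h) a * fraction_eval w a"
      using elim(5) em[OF cb(2) h(1)] by (simp add: mult.assoc)
    also have "\<dots> = poly_eval c a * poly_eval (?g * z) a * fraction_eval w a"
      using cb(5) em[OF cb(1) g(3)] by simp
    also have "\<dots> = poly_eval (c * ?g) a * (fraction_eval z a * fraction_eval w a)"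
      using elim(4) em[OF cb(1) g(1)] by (simp add: mult.assoc)
    finally show ?case using elim(2) by simp
  qed
qed

lemma rational_word_value:
  "x \<in> rational_fls \<Longrightarrow> y \<in> rational_fls \<Longrightarrow> word_value x y w \<in> rational_fls"
  by (induction w) (auto intro: rational_mult rational_polys)

lemma fraction_eval_word:
  assumes x: "x \<in> rational_fls" and y: "y \<in> rational_fls"
  shows "eventually (\<lambda>a. fraction_eval (word_value x y w) a
     = word_value (fraction_eval x a) (fraction_eval y a) w) almost_all_central"
proof (induction w)
  case Nil
  have 1: "poly_eval 1 a = 1" for a :: 'a using poly_eval_const[of 1 a] by simp
  have "eventually (\<lambda>a. poly_eval (1 * 1) a = poly_eval 1 a * fraction_eval 1 (a::'a)) almost_all_central"
    by (rule fraction_eval_any_denominator) (auto intro: rational_polys)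
  hence "eventually (\<lambda>a. fraction_eval 1 a = (1::'a)) almost_all_central"
    by eventually_elim (simp add: 1)
  thus ?case by simp
next
  case (Cons b w)
  have "(if b then x else y) \<in> rational_fls" using x y by simp
  from Cons.IH fraction_eval_mult[OF this rational_word_value[OF x y, of w]]
  show ?case by eventually_elim simp
qed

section \<open>Descent of free pairs\<close>

definition central_polys :: "'d::division_ring fls set" where
  "central_polys = {q \<in> polys. \<forall>t. fls_const t * q = q * fls_const t}"

lemma central_polysD: "q \<in> central_polys \<Longrightarrow> q \<in> polys"
  by (simp add: central_polys_def)

lemma central_polys_commute: "q \<in> central_polys \<Longrightarrow> p \<in> polys \<Longrightarrow> p * q = q * p"
  by (rule commutes_polys) (simp_all add: central_polys_def)

lemma central_polys_closed:
  assumes "p \<in> central_polys" "q \<in> central_polys"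
  shows "p + q \<in> central_polys" "p * q \<in> central_polys" "- p \<in> central_polys"
proof -
  have c: "fls_const t * p = p * fls_const t" "fls_const t * q = q * fls_const t" for t
    using assms by (auto simp: central_polys_def)
  have "fls_const t * (p * q) = p * q * fls_const t" for t by (metis c mult.assoc)
  thus "p + q \<in> central_polys" "p * q \<in> central_polys" "- p \<in> central_polys"
    using assms c by (auto simp: central_polys_def polys_add polys_mult polys_uminus distrib_left distrib_right)
qed

lemma central_polys_sum: "(\<And>i. i \<in> I \<Longrightarrow> f i \<in> central_polys) \<Longrightarrow> sum f I \<in> central_polys"
proof (induction I rule: infinite_finite_induct)
  case (insert i I)
  thus ?case by (simp add: central_polys_closed(1))
qed (simp_all add: central_polys_def)

lemma central_polysI: assumes "q \<in> polys" "\<And>n. q $$ n \<in> center" shows "q \<in> central_polys"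
  unfolding central_polys_def
proof (intro CollectI conjI allI assms(1) fls_eqI)
  fix t n
  show "(fls_const t * q) $$ n = (q * fls_const t) $$ n"
    using center_commute[OF assms(2)[of n], of t] by simp
qed

definition map_coeffs :: "('d::division_ring \<Rightarrow> 'd) \<Rightarrow> 'd fls \<Rightarrow> 'd fls" where
  "map_coeffs h q = (\<Sum>j\<le>pdeg q. fls_const (h (q $$ (- int j))) * fls_X_inv ^ j)"

lemma map_coeffs_polys: "map_coeffs h q \<in> polys"
  unfolding map_coeffs_def by (intro polys_sum polys_mult) auto

lemma map_coeffs_nth:
  assumes "h 0 = 0" shows "map_coeffs h q $$ (- int j) = h (q $$ (- int j))"
proof -
  have "map_coeffs h q $$ (- int j) = (\<Sum>i\<le>pdeg q. if i = j then h (q $$ (- int j)) else 0)"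
    unfolding map_coeffs_def fls_nth_sum
    by (intro sum.cong) (auto simp: fls_X_inv_power_times_conv_shift)
  thus ?thesis using assms polys_nth_above_pdeg[of q j] by (auto simp: not_le)
qed

lemma map_coeffs_central:
  assumes "h 0 = 0" "\<And>d. h d \<in> center" shows "map_coeffs h q \<in> central_polys"
proof (rule central_polysI[OF map_coeffs_polys])
  fix n :: int
  show "map_coeffs h q $$ n \<in> center"
  proof (cases "n > 0")
    case True thus ?thesis using polysD[OF map_coeffs_polys] center_simps(1) by metis
  next
    case False
    hence "n = - int (nat (- n))" by simp
    thus ?thesis using map_coeffs_nth[of h, OF assms(1)] assms(2) by metis
  qed
qed

lemma poly_eval_map_coeffs:
  assumes h: "\<And>x y. h (x + y) = h x + h y" "\<And>d c. c \<in> center \<Longrightarrow> h (d * c) = h d * c"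
    and a: "a \<in> center"
  shows "poly_eval (map_coeffs h q) a = h (poly_eval q a)"
proof -
  have h0: "h 0 = 0" using h(1)[of 0 0] by simp
  have hs: "h (sum f I) = (\<Sum>i\<in>I. h (f i))" for f and I :: "nat set"
    by (induction I rule: infinite_finite_induct) (simp_all add: h0 h(1))
  have "poly_eval (map_coeffs h q) a = (\<Sum>j\<le>pdeg q. map_coeffs h q $$ (- int j) * a ^ j)"
    by (intro poly_eval_upto) (simp add: map_coeffs_nth h0 polys_nth_above_pdeg)
  thus ?thesis
    by (simp add: map_coeffs_nth h0 poly_eval_def[of q] hs h(2) center_power[OF a])
qed

text \<open>
  Gaussian elimination without matrices: a functional \<open>h\<close> with values in the center, applied to the
  coefficients, provides a pivot \<open>H\<^sub>k = h(p\<^sub>k)\<close>, and the polynomials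
  \<open>H\<^sub>k p\<^sub>i - H\<^sub>i p\<^sub>k\<close> are again independent. At values where they remain independent and the pivot
  does not vanish, so do the original polynomials.
\<close>
lemma central_independence_specializes:
  assumes "finite I" and "\<And>i. i \<in> I \<Longrightarrow> p i \<in> (polys :: 'd::division_ring fls set)"
    and "\<And>C. (\<And>i. i \<in> I \<Longrightarrow> C i \<in> central_polys) \<Longrightarrow> (\<Sum>i\<in>I. C i * p i) = 0 \<Longrightarrow> \<forall>i\<in>I. C i = 0"
  shows "eventually (\<lambda>a. \<forall>c. (\<forall>i\<in>I. c i \<in> center) \<and> (\<Sum>i\<in>I. c i * poly_eval (p i) a) = 0
      \<longrightarrow> (\<forall>i\<in>I. c i = 0)) almost_all_central"
  using assms
proof (induction I arbitrary: p rule: finite_induct)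
  case empty
  show ?case by simp
next
  case (insert k I)
  have pk: "p k \<in> polys" using insert.prems by simp
  have cp01: "(0 :: 'd fls) \<in> central_polys" "1 \<in> (central_polys :: 'd fls set)" by (auto simp: central_polys_def)
  have "p k \<noteq> 0"
  proof
    assume "p k = 0"
    hence "(\<Sum>i\<in>insert k I. (if i = k then 1 else 0) * p i) = 0"
      using insert.hyps by (intro sum.neutral) auto
    note rel = this
    define C :: "_ \<Rightarrow> 'd fls" where "C i = (if i = k then 1 else 0)" for i
    have "C i \<in> central_polys" for i unfolding C_def using cp01 by (cases "i = k") simp_all
    moreover have "(\<Sum>i\<in>insert k I. C i * p i) = 0" using rel unfolding C_def .
    ultimately have "\<forall>i\<in>insert k I. C i = 0" by (rule insert.prems(2))
    hence "C k = 0" by blast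
    thus False by (simp add: C_def)
  qed
  obtain h where h: "\<And>d. h d \<in> center" "\<And>x y. h (x + y) = h x + h y"
    "\<And>d c. c \<in> center \<Longrightarrow> h (d * c) = h d * c" "h (p k $$ (- int (pdeg (p k)))) = 1"
    using subfield_functional[OF is_subfield_center polys_lead_nonzero[OF pk \<open>p k \<noteq> 0\<close>]] by metis
  have h0: "h 0 = 0" using h(2)[of 0 0] by simp
  have hs: "h (sum f J) = (\<Sum>i\<in>J. h (f i))" for f J
    by (induction J rule: infinite_finite_induct) (simp_all add: h0 h(2))
  define H where "H i = map_coeffs h (p i)" for i
  have Hc: "H i \<in> central_polys" for i unfolding H_def by (rule map_coeffs_central[of h, OF h0 h(1)])
  have Hk: "H k \<noteq> 0"
  proof
    assume "H k = 0"
    hence "H k $$ (- int (pdeg (p k))) = 0" by simp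
    thus False using h(4) by (simp add: H_def map_coeffs_nth[of h, OF h0])
  qed
  define q where "q i = H k * p i - H i * p k" for i
  have q: "q i \<in> polys" if "i \<in> I" for i
    using that insert.prems(1) pk Hc[THEN central_polysD] by (simp add: q_def polys_diff polys_mult)
  have qind: "\<forall>i\<in>I. C i = 0" if C: "\<And>i. i \<in> I \<Longrightarrow> C i \<in> central_polys" "(\<Sum>i\<in>I. C i * q i) = 0" for C
  proof -
    define C' where "C' i = (if i = k then - (\<Sum>i\<in>I. C i * H i) else C i * H k)" for i
    have "C' i \<in> central_polys" if "i \<in> insert k I" for i
      using that C(1) Hc by (auto simp: C'_def intro!: central_polys_closed central_polys_sum)
    moreover have "(\<Sum>i\<in>insert k I. C' i * p i) = 0"
    proof -
      have "(\<Sum>i\<in>I. C' i * p i) = (\<Sum>i\<in>I. C i * H k * p i)"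
        using insert.hyps by (intro sum.cong) (auto simp: C'_def)
      hence "(\<Sum>i\<in>insert k I. C' i * p i) = (\<Sum>i\<in>I. C i * q i)"
        using insert.hyps
        by (simp add: C'_def q_def right_diff_distrib sum_subtractf sum_distrib_right mult.assoc)
      thus ?thesis using C(2) by simp
    qed
    ultimately have "\<forall>i\<in>insert k I. C' i = 0" using insert.prems(2) by blast
    thus ?thesis using insert.hyps Hk by (auto simp: C'_def split: if_splits)
  qed
  have IH: "eventually (\<lambda>a. \<forall>c. (\<forall>i\<in>I. c i \<in> center) \<and> (\<Sum>i\<in>I. c i * poly_eval (q i) a) = 0
      \<longrightarrow> (\<forall>i\<in>I. c i = 0)) almost_all_central"
  proof (rule insert.IH)
    show "q i \<in> polys" if "i \<in> I" for i using that by (rule q)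
    show "\<forall>i\<in>I. C i = 0" if "\<And>i. i \<in> I \<Longrightarrow> C i \<in> central_polys" "(\<Sum>i\<in>I. C i * q i) = 0" for C
      using that by (rule qind)
  qed
  show ?case
    using IH eventually_poly_eval_nonzero[OF central_polysD[OF Hc] Hk] eventually_central
  proof eventually_elim
    case (elim a)
    note em = poly_eval_mult[OF elim(3)]
    have Hev: "poly_eval (H i) a = h (poly_eval (p i) a)" for i
      unfolding H_def by (rule poly_eval_map_coeffs[OF h(2,3) elim(3)])
    have qev: "poly_eval (q i) a = h (poly_eval (p k) a) * poly_eval (p i) a
        - h (poly_eval (p i) a) * poly_eval (p k) a" if "i \<in> I" for i
    proof -
      have "poly_eval (q i) a + poly_eval (H i * p k) a = poly_eval (H k * p i) a"
        unfolding poly_eval_add[symmetric] by (simp add: q_def)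
      moreover have "p i \<in> polys" using that insert.prems(1) by simp
      ultimately show ?thesis
        using em[OF central_polysD[OF Hc] pk, of i] em[OF central_polysD[OF Hc], of "p i" k] Hev
        by (simp add: eq_diff_eq)
    qed
    show ?case
    proof (intro allI impI, elim conjE)
      fix c assume c: "\<forall>i\<in>insert k I. c i \<in> center"
        and rel: "(\<Sum>i\<in>insert k I. c i * poly_eval (p i) a) = 0"
      let ?P = "\<lambda>i. poly_eval (p i) a"
      have hc: "h (c i * ?P i) = c i * h (?P i)" if "i \<in> insert k I" for i
      proof -
        have ci: "c i \<in> center" using c that by blast
        have "h (c i * ?P i) = h (?P i * c i)" by (simp only: center_commute[OF ci])
        also have "\<dots> = h (?P i) * c i" by (rule h(3)[OF ci])
        also have "\<dots> = c i * h (?P i)" by (rule center_commute[OF ci])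
        finally show ?thesis .
      qed
      have rel1: "(\<Sum>i\<in>I. c i * ?P i) = - (c k * ?P k)"
        using rel insert.hyps by (simp add: add_eq_0_iff2 add.commute)
      have "h (\<Sum>i\<in>insert k I. c i * ?P i) = 0" using h0 by (simp only: rel)
      moreover have "h (\<Sum>i\<in>insert k I. c i * ?P i) = (\<Sum>i\<in>insert k I. c i * h (?P i))"
        unfolding hs by (intro sum.cong refl hc)
      ultimately have "(\<Sum>i\<in>insert k I. c i * h (?P i)) = 0" by metis
      hence rel2: "(\<Sum>i\<in>I. c i * h (?P i)) = - (c k * h (?P k))"
        using insert.hyps by (simp add: add_eq_0_iff2 add.commute)
      have "(\<Sum>i\<in>I. c i * poly_eval (q i) a)
          = (\<Sum>i\<in>I. h (?P k) * (c i * ?P i) - c i * h (?P i) * ?P k)"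
      proof (intro sum.cong refl)
        fix i assume "i \<in> I"
        have "c i * (h (?P k) * ?P i) = h (?P k) * (c i * ?P i)"
          using center_commute[OF h(1)[of "?P k"], of "c i"] by (simp flip: mult.assoc)
        thus "c i * poly_eval (q i) a = h (?P k) * (c i * ?P i) - c i * h (?P i) * ?P k"
          using qev[OF \<open>i \<in> I\<close>] by (simp add: right_diff_distrib mult.assoc)
      qed
      also have "\<dots> = h (?P k) * (\<Sum>i\<in>I. c i * ?P i) - (\<Sum>i\<in>I. c i * h (?P i)) * ?P k"
        by (simp add: sum_subtractf sum_distrib_left sum_distrib_right)
      also have "\<dots> = 0" unfolding rel1 rel2
        using center_commute[OF h(1)[of "?P k"], of "c k"] by (simp flip: mult.assoc)
      finally have "\<forall>i\<in>I. c i = 0" using elim(1) c by blast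
      moreover have "c k = 0"
      proof -
        have "c k * h (?P k) = 0" using rel2 calculation by simp
        moreover have "h (?P k) \<noteq> 0" using elim(2) Hev[of k] by simp
        ultimately show ?thesis by simp
      qed
      ultimately show "\<forall>i\<in>insert k I. c i = 0" by blast
    qed
  qed
qed

lemma central_poly_in_center_ratfun:
  assumes C: "C \<in> central_polys" shows "ratfun_of_fls C \<in> center"
proof -
  have rep: "fls_of_ratfun (ratfun_of_fls C) = C"
    using central_polysD[OF C] by (simp add: ratfun_of_fls_inverse rational_polys)
  have "ratfun_of_fls C * z = z * ratfun_of_fls C" for z
  proof -
    let ?z = "fls_of_ratfun z"
    obtain g where g: "g \<in> polys" "g \<noteq> 0" "g * ?z \<in> polys"
      using fls_of_ratfun[of z] by (auto simp: rational_fls_def)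
    have "g * (C * ?z) = C * (g * ?z)"
      using central_polys_commute[OF C g(1)] by (simp flip: mult.assoc)
    also have "\<dots> = g * (?z * C)"
      using central_polys_commute[OF C g(3)] by (simp add: mult.assoc)
    finally have "C * ?z = ?z * C" using g(2) by simp
    hence "fls_of_ratfun (ratfun_of_fls C * z) = fls_of_ratfun (z * ratfun_of_fls C)"
      by (simp add: ratfun_rep rep)
    thus ?thesis by (simp only: fls_of_ratfun_inject)
  qed
  thus ?thesis by (simp add: center_def)
qed

text \<open>
  For each \<open>n\<close>, only finitely many central values spoil the independence of the words of length at most
  \<open>n\<close>, so an uncountable center contains a value that is good for all \<open>n\<close>.
\<close>
lemma free_over_center_descends:
  assumes unc: "uncountable (center :: 'd::division_ring set)"
    and free: "\<exists>x y :: 'd ratfun. free_over_center x y"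
  shows "\<exists>x y :: 'd. free_over_center x y"
proof -
  obtain X Y :: "'d ratfun" where XY: "free_over_center X Y" using free by blast
  define x where "x = fls_of_ratfun X"
  define y where "y = fls_of_ratfun Y"
  have rat: "x \<in> rational_fls" "y \<in> rational_fls" using fls_of_ratfun by (auto simp: x_def y_def)
  have wv: "fls_of_ratfun (word_value X Y w) = word_value x y w" for w
    by (induction w) (simp_all add: ratfun_rep x_def y_def)
  define good where "good n a \<longleftrightarrow> (\<forall>c. (\<forall>w\<in>words_upto n. c w \<in> center) \<and>
      (\<Sum>w\<in>words_upto n. c w * word_value (fraction_eval x a) (fraction_eval y a) w) = 0
      \<longrightarrow> (\<forall>w\<in>words_upto n. c w = 0))" for n a
  have good: "eventually (good n) almost_all_central" for n
  proof -
    obtain g where g: "g \<in> polys" "g \<noteq> 0" "\<And>w. w \<in> words_upto n \<Longrightarrow> g * word_value x y w \<in> polys"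
      using rational_common_denominator[of "word_value x y ` words_upto n"]
        finite_words_upto rational_word_value[OF rat] by (auto simp: image_subset_iff)
    define p where "p w = g * word_value x y w" for w
    have ind: "\<forall>w\<in>words_upto n. C w = 0"
      if C: "\<And>w. w \<in> words_upto n \<Longrightarrow> C w \<in> central_polys" "(\<Sum>w\<in>words_upto n. C w * p w) = 0" for C
    proof -
      have "(\<Sum>w\<in>words_upto n. C w * p w) = (\<Sum>w\<in>words_upto n. g * (C w * word_value x y w))"
        by (intro sum.cong refl) (simp add: p_def central_polys_commute[OF C(1) g(1)] flip: mult.assoc)
      hence "g * (\<Sum>w\<in>words_upto n. C w * word_value x y w) = 0" using C(2) by (simp add: sum_distrib_left)
      hence rel: "(\<Sum>w\<in>words_upto n. C w * word_value x y w) = 0" using g(2) by simp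
      have rep: "fls_of_ratfun (ratfun_of_fls (C w)) = C w" if "w \<in> words_upto n" for w
        using central_polysD[OF C(1)[OF that]] by (simp add: ratfun_of_fls_inverse rational_polys)
      have "fls_of_ratfun (\<Sum>w\<in>words_upto n. ratfun_of_fls (C w) * word_value X Y w) = 0"
      proof -
        have "fls_of_ratfun (\<Sum>w\<in>words_upto n. ratfun_of_fls (C w) * word_value X Y w)
            = (\<Sum>w\<in>words_upto n. C w * word_value x y w)"
          unfolding fls_of_ratfun_sum by (intro sum.cong refl) (simp only: times_ratfun.rep_eq wv rep)
        thus ?thesis using rel by simp
      qed
      hence "(\<Sum>w\<in>words_upto n. ratfun_of_fls (C w) * word_value X Y w) = 0"
        by (simp only: fls_of_ratfun_eq_0_iff)
      moreover have "\<forall>w\<in>words_upto n. ratfun_of_fls (C w) \<in> center"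
        using central_poly_in_center_ratfun C(1) by blast
      ultimately have "\<forall>w\<in>words_upto n. ratfun_of_fls (C w) = 0"
        using XY[unfolded free_over_center_def, THEN spec[of _ "words_upto n"],
          THEN spec[of _ "\<lambda>w. ratfun_of_fls (C w)"]] finite_words_upto by blast
      thus ?thesis using rep by (metis fls_of_ratfun_eq_0_iff)
    qed
    have ev: "eventually (\<lambda>a. poly_eval (p w) a
        = poly_eval g a * word_value (fraction_eval x a) (fraction_eval y a) w) almost_all_central"
      if "w \<in> words_upto n" for w
      using fraction_eval_any_denominator[OF rational_word_value[OF rat] g(1) g(3)[OF that]]
        fraction_eval_word[OF rat, of w]
      by eventually_elim (simp add: p_def)
    have "eventually (\<lambda>a. \<forall>w\<in>words_upto n. poly_eval (p w) a
        = poly_eval g a * word_value (fraction_eval x a) (fraction_eval y a) w) almost_all_central"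
      using ev finite_words_upto by (intro eventually_ball_finite) auto
    moreover have "eventually (\<lambda>a. \<forall>c. (\<forall>w\<in>words_upto n. c w \<in> center)
      \<and> (\<Sum>w\<in>words_upto n. c w * poly_eval (p w) a) = 0
      \<longrightarrow> (\<forall>w\<in>words_upto n. c w = 0)) almost_all_central"
    proof (rule central_independence_specializes[OF finite_words_upto])
      show "p w \<in> polys" if "w \<in> words_upto n" for w using g(3) that by (simp add: p_def)
      show "\<forall>w\<in>words_upto n. C w = 0"
        if "\<And>w. w \<in> words_upto n \<Longrightarrow> C w \<in> central_polys" "(\<Sum>w\<in>words_upto n. C w * p w) = 0" for C
        using that by (rule ind)
    qed
    ultimately show ?thesis
    proof eventually_elim
      case (elim a)
      show ?case unfolding good_def
      proof (intro allI impI, elim conjE)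
        fix c assume c: "\<forall>w\<in>words_upto n. c w \<in> center"
          and rel: "(\<Sum>w\<in>words_upto n. c w * word_value (fraction_eval x a) (fraction_eval y a) w) = 0"
        have "(\<Sum>w\<in>words_upto n. c w * poly_eval (p w) a)
            = (\<Sum>w\<in>words_upto n. poly_eval g a * (c w * word_value (fraction_eval x a) (fraction_eval y a) w))"
        proof (intro sum.cong refl)
          fix w assume w: "w \<in> words_upto n"
          hence "c w \<in> center" using c by blast
          from center_commute[OF this, of "poly_eval g a"] elim(1) w
          show "c w * poly_eval (p w) a
             = poly_eval g a * (c w * word_value (fraction_eval x a) (fraction_eval y a) w)"
            by (simp flip: mult.assoc)
        qed
        also have "\<dots> = 0" using rel by (simp flip: sum_distrib_left)
        finally show "\<forall>w\<in>words_upto n. c w = 0" using elim(2) c by blast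
      qed
    qed
  qed
  have "countable (\<Union>n. {a \<in> center. \<not> good n a})"
    using good by (intro countable_UN) (auto simp: eventually_almost_all_central intro: countable_finite)
  hence "\<not> center \<subseteq> (\<Union>n. {a \<in> center. \<not> good n a})"
    using unc countable_subset by blast
  then obtain a where a: "\<And>n. good n a" by blast
  have "free_over_center (fraction_eval x a) (fraction_eval y a)"
    unfolding free_over_center_def
  proof (intro allI impI, elim conjE)
    fix W c assume W: "finite W" "\<forall>w\<in>W. c w \<in> center"
      and rel: "(\<Sum>w\<in>W. c w * word_value (fraction_eval x a) (fraction_eval y a) w) = 0"
    define n where "n = Max (insert 0 (length ` W))"
    have sub: "W \<subseteq> words_upto n" using W(1) by (auto simp: n_def)
    define c' where "c' w = (if w \<in> W then c w else 0)" for w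
    have "(\<Sum>w\<in>words_upto n. c' w * word_value (fraction_eval x a) (fraction_eval y a) w) = 0"
      using sum.mono_neutral_cong_left[OF finite_words_upto sub, of
        "\<lambda>w. c' w * word_value (fraction_eval x a) (fraction_eval y a) w"
        "\<lambda>w. c w * word_value (fraction_eval x a) (fraction_eval y a) w"] rel
      by (simp add: c'_def)
    moreover have "\<forall>w\<in>words_upto n. c' w \<in> center" using W(2) by (simp add: c'_def center_simps)
    ultimately have "\<forall>w\<in>words_upto n. c' w = 0" using a[of n] unfolding good_def by blast
    thus "\<forall>w\<in>W. c w = 0" using sub by (auto simp: c'_def)
  qed
  thus ?thesis by blast
qed

lemma uncountable_center_ratfun:
  assumes "uncountable (center :: 'd::division_ring set)"
  shows "uncountable (center :: 'd ratfun set)"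
proof
  assume "countable (center :: 'd ratfun set)"
  moreover have "rf_const ` (center :: 'd set) \<subseteq> center"
  proof
    fix z assume "z \<in> rf_const ` (center :: 'd set)"
    then obtain c where c: "c \<in> (center :: 'd set)" "z = rf_const c" by blast
    have "fls_const c \<in> central_polys" using c(1) by (intro central_polysI) (auto simp: center_simps)
    moreover have "z = ratfun_of_fls (fls_const c)"
      unfolding c(2) rf_const.rep_eq[symmetric] by (simp add: fls_of_ratfun_inverse)
    ultimately show "z \<in> center" using central_poly_in_center_ratfun by blast
  qed
  ultimately have "countable (rf_const ` (center :: 'd set))" using countable_subset by blast
  moreover have "inj_on rf_const (center :: 'd set)"
  proof (rule inj_onI)
    fix a b :: 'd assume "rf_const a = rf_const b"
    hence "fls_of_ratfun (rf_const a) $$ 0 = fls_of_ratfun (rf_const b) $$ 0" by simp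
    thus "a = b" by (simp add: ratfun_rep)
  qed
  ultimately show False using assms countable_image_inj_on by blast
qed

lemma powers_dependent_if_not_free:
  fixes e y :: "'d::division_ring"
  assumes "uncountable (center :: 'd set)" and "\<nexists>x y :: 'd. free_over_center x y"
  shows "dependent_powers e y"
proof (rule ccontr)
  assume "\<not> dependent_powers e y"
  from independent_powers_imp_free[OF this] assms show False
    by (meson free_over_center_descends uncountable_center_ratfun)
qed

section \<open>Centralizers of finitely many commuting elements\<close>

text \<open>
  If \<open>[e, y] = 1\<close>, the commutator with \<open>e\<close> differentiates polynomials in \<open>y\<close> over \<open>C(e)\<close>.
\<close>
lemma commutator_one_independent:
  fixes e y :: "'d::division_ring"
  assumes char0: "\<And>n. n > 0 \<Longrightarrow> of_nat n \<noteq> (0 :: 'd)" and one: "e * y - y * e = 1"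
  shows "(\<And>i. i \<le> m \<Longrightarrow> c i * e = e * c i) \<Longrightarrow> (\<Sum>i\<le>m. c i * y ^ i) = 0 \<Longrightarrow> \<forall>i\<le>m. c i = 0"
proof (induction m arbitrary: c)
  case (Suc m)
  have ey: "e * y ^ Suc i - y ^ Suc i * e = of_nat (Suc i) * y ^ i" for i
  proof (induction i)
    case 0 thus ?case using one by simp
  next
    case (Suc i)
    have "e * y ^ Suc (Suc i) - y ^ Suc (Suc i) * e
        = (e * y - y * e) * y ^ Suc i + y * (e * y ^ Suc i - y ^ Suc i * e)"
      by (simp add: algebra_simps)
    also have "\<dots> = y ^ Suc i + y * (of_nat (Suc i) * y ^ i)" unfolding one Suc by simp
    also have "y * (of_nat (Suc i) * y ^ i) = of_nat (Suc i) * y ^ Suc i"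
      by (simp only: power_Suc mult.assoc[symmetric] mult_of_nat_commute[of "Suc i" y])
    finally show ?case by (simp add: distrib_right)
  qed
  let ?b = "\<lambda>i. c (Suc i) * of_nat (Suc i)"
  have "e * (c 0 + (\<Sum>i\<le>m. c (Suc i) * y ^ Suc i)) - (c 0 + (\<Sum>i\<le>m. c (Suc i) * y ^ Suc i)) * e
      = (\<Sum>i\<le>m. e * (c (Suc i) * y ^ Suc i) - c (Suc i) * y ^ Suc i * e)"
    using Suc.prems(1)[of 0]
    by (simp add: distrib_left distrib_right sum_distrib_left sum_distrib_right sum_subtractf del: power_Suc)
  also have "\<dots> = (\<Sum>i\<le>m. ?b i * y ^ i)"
  proof (intro sum.cong refl)
    fix i assume "i \<in> {..m}"
    hence "e * (c (Suc i) * y ^ Suc i) = c (Suc i) * (e * y ^ Suc i)"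
      using Suc.prems(1)[of "Suc i"] by (simp add: mult.assoc[symmetric] del: power_Suc)
    thus "e * (c (Suc i) * y ^ Suc i) - c (Suc i) * y ^ Suc i * e = ?b i * y ^ i"
      unfolding mult.assoc ey[symmetric] right_diff_distrib by simp
  qed
  finally have "(\<Sum>i\<le>m. ?b i * y ^ i) = 0"
    using Suc.prems(2) unfolding sum.atMost_Suc_shift by simp
  moreover have "?b i * e = e * ?b i" if "i \<le> m" for i
  proof -
    have ce: "c (Suc i) * e = e * c (Suc i)" using Suc.prems(1)[of "Suc i"] that by simp
    have "?b i * e = c (Suc i) * (e * of_nat (Suc i))"
      by (simp only: mult.assoc mult_of_nat_commute[of "Suc i" e])
    also have "\<dots> = e * ?b i" by (simp only: mult.assoc[symmetric] ce)
    finally show ?thesis .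
  qed
  ultimately have "\<forall>i\<le>m. ?b i = 0" by (intro Suc.IH) auto
  hence s0: "c (Suc i) = 0" if "i \<le> m" for i using that char0[of "Suc i"] by auto
  have "c 0 = 0" using Suc.prems(2) s0 unfolding sum.atMost_Suc_shift by simp
  show ?case
  proof (intro allI impI)
    fix i assume "i \<le> Suc m"
    thus "c i = 0" using \<open>c 0 = 0\<close> s0 by (cases i) auto
  qed
qed simp

lemma iterated_commutator_zero:
  fixes e u :: "'d::division_ring"
  assumes char0: "\<And>n. n > 0 \<Longrightarrow> of_nat n \<noteq> (0 :: 'd)" and dep: "\<And>y. dependent_powers e y"
    and zero: "e * (e * u - u * e) = (e * u - u * e) * e"
  shows "e * u = u * e"
proof (rule ccontr)
  define c where "c = e * u - u * e"
  assume "e * u \<noteq> u * e"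
  hence c0: "c \<noteq> 0" by (simp add: c_def)
  have ic: "e * inverse c = inverse c * e" using zero by (intro inverse_commutes) (simp add: c_def)
  define y where "y = inverse c * u"
  have "e * y = inverse c * (e * u)" unfolding y_def by (simp only: mult.assoc[symmetric] ic)
  moreover have "y * e = inverse c * (u * e)" unfolding y_def by (simp only: mult.assoc)
  ultimately have "e * y - y * e = inverse c * c" by (simp only: c_def right_diff_distrib)
  hence one: "e * y - y * e = 1" using c0 by simp
  obtain m :: nat and b i where "\<And>i. i \<le> m \<Longrightarrow> b i * e = e * b i" "i \<le> m" "b i \<noteq> 0" "(\<Sum>i\<le>m. b i * y ^ i) = 0"
    using dependent_powers_commuting_coefficients[OF dep[of y]] by blast
  thus False using commutator_one_independent[OF char0 one, of m b] by blast
qed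

text \<open>
  Let \<open>\<delta>\<^sub>i = [e\<^sub>i, \<cdot>]\<close>. Comparing coefficients of \<open>A U = U A\<close> gives \<open>\<Sum>\<^sub>i \<delta>\<^sub>i U\<^sub>N\<^sub>-\<^sub>i = 0\<close> for every \<open>N\<close>.
  Inductively on \<open>N\<close> and then on \<open>i\<close>, apply \<open>\<delta>\<^sub>i\<close>: terms with smaller index vanish already, and in
  those with larger index \<open>\<delta>\<^sub>i\<close> reaches a coefficient treated for a smaller \<open>N\<close>. What remains is
  \<open>\<delta>\<^sub>i \<delta>\<^sub>i U\<^sub>N\<^sub>-\<^sub>i = 0\<close>, so \<open>\<delta>\<^sub>i U\<^sub>N\<^sub>-\<^sub>i = 0\<close>.
\<close>
lemma generic_combination_centralizer:
  fixes es :: "nat \<Rightarrow> 'd::division_ring" and U :: "'d fls" and r :: nat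
  defines "A \<equiv> (\<Sum>i<r. fls_const (es i) * fls_X ^ i)"
  assumes com: "\<And>i j. i < r \<Longrightarrow> j < r \<Longrightarrow> es i * es j = es j * es i"
    and nil: "\<And>i u. i < r \<Longrightarrow> es i * (es i * u - u * es i) = (es i * u - u * es i) * es i \<Longrightarrow> es i * u = u * es i"
    and UA: "A * U = U * A" and j: "j < r"
  shows "es j * U $$ k = U $$ k * es j"
proof -
  define \<delta> where "\<delta> i u = es i * u - u * es i" for i u
  have \<delta>0: "\<delta> i 0 = 0" for i by (simp add: \<delta>_def)
  have \<delta>sum: "\<delta> i (sum f I) = (\<Sum>l\<in>I. \<delta> i (f l))" for i f and I :: "nat set"
    by (simp add: \<delta>_def sum_distrib_left sum_distrib_right sum_subtractf)
  have \<delta>com: "\<delta> i (\<delta> l u) = \<delta> l (\<delta> i u)" if "i < r" "l < r" for i l u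
  proof -
    have "\<delta> i (\<delta> l u) - \<delta> l (\<delta> i u) = (es i * es l - es l * es i) * u - u * (es i * es l - es l * es i)"
      by (simp add: \<delta>_def algebra_simps)
    thus ?thesis using com[OF that] by simp
  qed
  have \<delta>nil: "\<delta> i u = 0" if "i < r" "\<delta> i (\<delta> i u) = 0" for i u
    using nil[OF that(1), of u] that(2) by (simp add: \<delta>_def)
  have rel: "(\<Sum>i<r. \<delta> i (U $$ (N - int i))) = 0" for N
  proof -
    have "(A * U) $$ N = (\<Sum>i<r. es i * U $$ (N - int i))"
      by (simp only: A_def sum_distrib_right fls_nth_sum mult.assoc fls_X_power_times_conv_shift(1)) simp
    moreover have "(U * A) $$ N = (\<Sum>i<r. U $$ (N - int i) * es i)"
    proof -
      have "U * (fls_const (es i) * fls_X ^ i) = fls_X ^ i * (U * fls_const (es i))" for i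
      proof -
        have "U * (fls_const (es i) * fls_X ^ i) = (U * fls_const (es i)) * fls_X ^ i"
          by (simp only: mult.assoc)
        thus ?thesis by (simp only: fls_X_power_times_conv_shift)
      qed
      thus ?thesis
        by (simp only: A_def sum_distrib_left fls_nth_sum fls_X_power_times_conv_shift(1)) simp
    qed
    ultimately show ?thesis using UA by (simp add: \<delta>_def sum_subtractf)
  qed
  have below: "\<delta> i (U $$ n) = 0" if "n < fls_subdegree U" for i n using that \<delta>0 by simp
  have main: "\<forall>i<r. \<delta> i (U $$ (fls_subdegree U + int n - int i)) = 0" for n
  proof (induction n rule: less_induct)
    case (less n)
    let ?N = "fls_subdegree U + int n"
    show ?case
    proof (intro allI)
      fix i show "i < r \<longrightarrow> \<delta> i (U $$ (?N - int i)) = 0"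
      proof (induction i rule: less_induct)
        case (less i)
        show ?case
        proof
          assume i: "i < r"
          have z: "\<delta> i (\<delta> l (U $$ (?N - int l))) = 0" if l: "l < r" "l \<noteq> i" for l
          proof (cases "l < i")
            case True
            thus ?thesis using less.IH l \<delta>0 by simp
          next
            case False
            hence li: "l > i" using l by simp
            have "\<delta> i (U $$ (?N - int l)) = 0"
            proof (cases "l - i \<le> n")
              case True
              have "n - (l - i) < n" using True li by simp
              from \<open>\<And>m. m < n \<Longrightarrow> \<forall>i<r. \<delta> i (U $$ (fls_subdegree U + int m - int i)) = 0\<close>[OF this]
              have "\<delta> i (U $$ (fls_subdegree U + int (n - (l - i)) - int i)) = 0" using i by blast
              moreover have "?N - int l = fls_subdegree U + int (n - (l - i)) - int i"
                using True li by simp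
              ultimately show ?thesis by (simp only:)
            next
              case False thus ?thesis using li by (intro below) simp
            qed
            thus ?thesis using \<delta>com[OF i l(1)] \<delta>0 by simp
          qed
          have "0 = \<delta> i (\<Sum>l<r. \<delta> l (U $$ (?N - int l)))" using rel \<delta>0 by simp
          also have "\<dots> = (\<Sum>l<r. \<delta> i (\<delta> l (U $$ (?N - int l))))" by (rule \<delta>sum)
          also have "\<dots> = \<delta> i (\<delta> i (U $$ (?N - int i)))"
          proof -
            have "(\<Sum>l\<in>{..<r} - {i}. \<delta> i (\<delta> l (U $$ (?N - int l)))) = 0"
              by (rule sum.neutral) (use z in blast)
            thus ?thesis using i sum.remove[of "{..<r}" i "\<lambda>l. \<delta> i (\<delta> l (U $$ (?N - int l)))"] by simp
          qed
          finally show "\<delta> i (U $$ (?N - int i)) = 0" using \<delta>nil[OF i] by simp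
        qed
      qed
    qed
  qed
  have "\<delta> j (U $$ k) = 0"
  proof (cases "k < fls_subdegree U")
    case True thus ?thesis by (rule below)
  next
    case False
    define n where "n = nat (k + int j - fls_subdegree U)"
    have "fls_subdegree U + int n - int j = k" using False by (simp add: n_def)
    thus ?thesis using main[of n] j by metis
  qed
  thus ?thesis by (simp add: \<delta>_def)
qed

text \<open>
  One element of \<open>D(s)\<close>, the generic combination, does the work of the whole family.
\<close>
lemma left_algebraic_over_finite_centralizer:
  fixes es :: "nat \<Rightarrow> 'd::division_ring" and y :: 'd
  assumes com: "\<And>i j. i < r \<Longrightarrow> j < r \<Longrightarrow> es i * es j = es j * es i"
    and char0: "\<And>n. n > 0 \<Longrightarrow> of_nat n \<noteq> (0 :: 'd)"
    and dep: "\<And>e y :: 'd. dependent_powers e y"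
    and dep': "\<And>a b :: 'd ratfun. dependent_powers a b"
  shows "\<exists>(m::nat) c. (\<forall>i\<le>m. \<forall>j<r. c i * es j = es j * c i) \<and> (\<exists>i\<le>m. c i \<noteq> 0) \<and> (\<Sum>i\<le>m. c i * y ^ i) = 0"
proof -
  define a where "a = (\<Sum>i<r. rf_const (es i) * inverse rf_var ^ i)"
  have a: "fls_of_ratfun a = (\<Sum>i<r. fls_const (es i) * fls_X ^ i)"
  proof -
    have "inverse fls_X_inv = (fls_X :: 'd fls)"
      by (rule inverse_unique) (simp add: fls_X_inv_times_conv_shift)
    thus ?thesis by (simp add: a_def fls_of_ratfun_sum ratfun_rep fls_of_ratfun_power)
  qed
  obtain m :: nat and c i where c: "\<And>i. i \<le> m \<Longrightarrow> c i * a = a * c i" "i \<le> m" "c i \<noteq> 0"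
    "(\<Sum>i\<le>m. c i * rf_const y ^ i) = 0"
    using dependent_powers_commuting_coefficients[OF dep'[of a "rf_const y"]] by blast
  define U where "U i = fls_of_ratfun (c i)" for i
  have "U i \<noteq> 0" using c(3) by (simp add: U_def fls_of_ratfun_eq_0_iff)
  then obtain k where k: "U i $$ k \<noteq> 0" using nth_fls_subdegree_nonzero by blast
  have UA: "(\<Sum>l<r. fls_const (es l) * fls_X ^ l) * U i = U i * (\<Sum>l<r. fls_const (es l) * fls_X ^ l)"
    if "i \<le> m" for i
    using arg_cong[OF c(1)[OF that], of fls_of_ratfun] by (simp add: times_ratfun.rep_eq a U_def)
  have "(\<Sum>i\<le>m. U i * fls_const y ^ i) = 0"
    using arg_cong[OF c(4), of fls_of_ratfun]
    by (simp add: fls_of_ratfun_sum ratfun_rep fls_of_ratfun_power U_def)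
  from arg_cong[OF this, of "\<lambda>z. z $$ k"] have "(\<Sum>i\<le>m. U i $$ k * y ^ i) = 0"
    by (simp add: fls_nth_sum flip: fls_const_power)
  moreover have "U i $$ k * es j = es j * U i $$ k" if "i \<le> m" "j < r" for i j
  proof -
    have "es j * U i $$ k = U i $$ k * es j"
    proof (rule generic_combination_centralizer[where es = es and r = r])
      show "es l * es l' = es l' * es l" if "l < r" "l' < r" for l l' using that by (rule com)
      show "es l * u = u * es l" if "es l * (es l * u - u * es l) = (es l * u - u * es l) * es l" for l u
      proof (rule iterated_commutator_zero)
        show "of_nat n \<noteq> (0 :: 'd)" if "n > 0" for n using that by (rule char0)
      qed (rule dep, rule that)
    qed (rule UA[OF that(1)], rule that(2))
    thus ?thesis by (rule sym)
  qed
  ultimately show ?thesis using c(2) k by (intro exI[of _ m] exI[of _ "\<lambda>i. U i $$ k"]) blast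
qed

section \<open>Characters of countably generated commutative algebras\<close>

lemma algebra_map_simps:
  assumes "algebra_map \<kappa>"
  shows "\<kappa> 1 = 1" "\<kappa> 0 = 0" "\<kappa> (a + b) = \<kappa> a + \<kappa> b" "\<kappa> (a * b) = \<kappa> a * \<kappa> b"
    "\<kappa> (- a) = - \<kappa> a" "\<kappa> (a - b) = \<kappa> a - \<kappa> b" "\<kappa> a * x = x * \<kappa> a"
proof -
  have *: "\<kappa> 1 = 1 \<and> (\<forall>x y. \<kappa> (x + y) = \<kappa> x + \<kappa> y) \<and> (\<forall>x y. \<kappa> (x * y) = \<kappa> x * \<kappa> y)
    \<and> (\<forall>c x. \<kappa> c * x = x * \<kappa> c)"
    using assms unfolding algebra_map_def ring_homomorphism_def by blast
  show "\<kappa> 1 = 1" using * by blast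
  show add: "\<kappa> (a + b) = \<kappa> a + \<kappa> b" for a b using * by blast
  show "\<kappa> (a * b) = \<kappa> a * \<kappa> b" using * by blast
  show "\<kappa> a * x = x * \<kappa> a" using * by blast
  show 0: "\<kappa> 0 = 0" using add[of 0 0] by simp
  show m: "\<kappa> (- a) = - \<kappa> a" for a using minus_unique[of "\<kappa> a" "\<kappa> (- a)"] add[of a "- a"] 0 by simp
  show "\<kappa> (a - b) = \<kappa> a - \<kappa> b" using add[of a "- b"] m[of b] by simp
qed

lemma algebra_map_sum: "algebra_map \<kappa> \<Longrightarrow> \<kappa> (sum f I) = (\<Sum>i\<in>I. \<kappa> (f i))"
  by (induction I rule: infinite_finite_induct) (simp_all add: algebra_map_simps(2,3))

lemma algebra_map_eq_0_iff:
  fixes \<kappa> :: "'k::field \<Rightarrow> 'r::ring_1"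
  assumes "algebra_map \<kappa>" and "(1 :: 'r) \<noteq> 0" shows "\<kappa> a = 0 \<longleftrightarrow> a = 0"
proof
  assume "\<kappa> a = 0"
  hence "\<kappa> (a * inverse a) = 0" using algebra_map_simps(4)[OF assms(1)] by simp
  thus "a = 0" using assms algebra_map_simps(1)[OF assms(1)] by (cases "a = 0") auto
qed (simp add: algebra_map_simps(2)[OF assms(1)])

text \<open>
  The spanning sequence enumerates the monomials in the generators.
\<close>
lemma subalgebra_gen_countably_spanned:
  fixes \<kappa> :: "'k::field \<Rightarrow> 'r::ring_1"
  assumes \<kappa>: "algebra_map \<kappa>" and S: "countable S"
  shows "\<exists>b :: nat \<Rightarrow> 'r. \<forall>x\<in>subalgebra_gen \<kappa> S. \<exists>n a. x = (\<Sum>j<n. \<kappa> (a j) * b j)"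
proof -
  define B where "B = prod_list ` lists S"
  have B: "countable B" "B \<noteq> {}" using S by (auto simp: B_def intro!: countable_image countable_lists)
  define b where "b = from_nat_into B"
  have bB: "b j \<in> B" for j using B(2) by (simp add: b_def from_nat_into)
  have Bb: "\<exists>j. x = b j" if "x \<in> B" for x using from_nat_into_surj[OF B(1) that] by (auto simp: b_def)
  have B1: "1 \<in> B" unfolding B_def by (rule image_eqI[of _ _ "[]"]) auto
  have Bm: "x * y \<in> B" if xy: "x \<in> B" "y \<in> B" for x y
  proof -
    obtain u v where "x = prod_list u" "u \<in> lists S" "y = prod_list v" "v \<in> lists S"
      using xy by (auto simp: B_def)
    thus ?thesis unfolding B_def by (intro image_eqI[of _ _ "u @ v"]) auto
  qed
  define V where "V = {x. \<exists>n a. x = (\<Sum>j<n. \<kappa> (a j) * b j)}"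
  have Vb: "\<kappa> c * x \<in> V" if x: "x \<in> B" for c x
  proof -
    obtain l where l: "x = b l" using Bb[OF x] by blast
    have "\<kappa> c * x = (\<Sum>j<Suc l. \<kappa> (if j = l then c else 0) * b j)"
      using algebra_map_simps(2)[OF \<kappa>] l by simp
    thus ?thesis unfolding V_def
      by (intro CollectI exI[of _ "Suc l"] exI[of _ "\<lambda>j. if j = l then c else 0"])
  qed
  have V0: "0 \<in> V" unfolding V_def by (intro CollectI exI[of _ 0]) simp
  have Vadd: "x + y \<in> V" if xy: "x \<in> V" "y \<in> V" for x y
  proof -
    obtain n a m c where nm: "x = (\<Sum>j<n. \<kappa> (a j) * b j)" "y = (\<Sum>j<m. \<kappa> (c j) * b j)"
      using xy by (auto simp: V_def)
    define a' where "a' j = (if j < n then a j else 0)" for j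
    define c' where "c' j = (if j < m then c j else 0)" for j
    have "x = (\<Sum>j<max n m. \<kappa> (a' j) * b j)" unfolding nm(1)
      by (intro sum.mono_neutral_cong_left) (auto simp: a'_def algebra_map_simps(2)[OF \<kappa>])
    moreover have "y = (\<Sum>j<max n m. \<kappa> (c' j) * b j)" unfolding nm(2)
      by (intro sum.mono_neutral_cong_left) (auto simp: c'_def algebra_map_simps(2)[OF \<kappa>])
    ultimately have "x + y = (\<Sum>j<max n m. \<kappa> (a' j + c' j) * b j)"
      by (simp add: sum.distrib distrib_right algebra_map_simps(3)[OF \<kappa>])
    thus ?thesis unfolding V_def by (intro CollectI exI[of _ "max n m"] exI[of _ "\<lambda>j. a' j + c' j"])
  qed
  have Vsum: "sum f I \<in> V" if "\<And>i. i \<in> I \<Longrightarrow> f i \<in> V" for f :: "nat \<Rightarrow> 'r" and I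
    using that by (induction I rule: infinite_finite_induct) (auto simp: V0 Vadd)
  have Vmult: "x * y \<in> V" if xy: "x \<in> V" "y \<in> V" for x y
  proof -
    obtain n a m c where nm: "x = (\<Sum>j<n. \<kappa> (a j) * b j)" "y = (\<Sum>i<m. \<kappa> (c i) * b i)"
      using xy by (auto simp: V_def)
    have "x * y = (\<Sum>j<n. \<Sum>i<m. (\<kappa> (a j) * b j) * (\<kappa> (c i) * b i))"
      unfolding nm by (rule sum_product)
    moreover have "(\<kappa> (a j) * b j) * (\<kappa> (c i) * b i) = \<kappa> (a j * c i) * (b j * b i)" for i j
    proof -
      have "(\<kappa> (a j) * b j) * (\<kappa> (c i) * b i) = \<kappa> (a j) * (b j * \<kappa> (c i)) * b i"
        by (simp only: mult.assoc)
      also have "b j * \<kappa> (c i) = \<kappa> (c i) * b j" by (rule algebra_map_simps(7)[OF \<kappa>, symmetric])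
      finally show ?thesis by (simp only: mult.assoc algebra_map_simps(4)[OF \<kappa>])
    qed
    moreover have "(\<Sum>j<n. \<Sum>i<m. \<kappa> (a j * c i) * (b j * b i)) \<in> V"
      by (intro Vsum Vb Bm bB)
    ultimately show ?thesis by simp
  qed
  have "x \<in> V" if "x \<in> subalgebra_gen \<kappa> S" for x using that
  proof induction
    case (generator x)
    have "x \<in> B" unfolding B_def using generator by (intro image_eqI[of _ _ "[x]"]) auto
    thus ?case using Vb[of x 1] algebra_map_simps(1)[OF \<kappa>] by simp
  next
    case (scalar c)
    thus ?case using Vb[OF B1, of c] by simp
  qed (auto intro: Vadd Vmult)
  thus ?thesis unfolding V_def by blast
qed

text \<open>
  Horner's scheme; \<^const>\<open>poly\<close> would require the target ring to be commutative.
\<close>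
definition poly_at :: "('k::field \<Rightarrow> 'r::ring_1) \<Rightarrow> 'r \<Rightarrow> 'k poly \<Rightarrow> 'r" where
  "poly_at \<kappa> r p = fold_coeffs (\<lambda>a x. \<kappa> a + r * x) p 0"

lemma poly_at_pCons:
  assumes "algebra_map \<kappa>" shows "poly_at \<kappa> r (pCons a p) = \<kappa> a + r * poly_at \<kappa> r p"
  by (cases "a = 0 \<and> p = 0") (auto simp: poly_at_def algebra_map_simps(2)[OF assms])

lemma poly_at_simps:
  assumes \<kappa>: "algebra_map \<kappa>"
  shows "poly_at \<kappa> r 0 = 0" "poly_at \<kappa> r (p + q) = poly_at \<kappa> r p + poly_at \<kappa> r q"
    "poly_at \<kappa> r (smult c p) = \<kappa> c * poly_at \<kappa> r p" "poly_at \<kappa> r (p * q) = poly_at \<kappa> r p * poly_at \<kappa> r q"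
proof -
  show z: "poly_at \<kappa> r 0 = 0" by (simp add: poly_at_def)
  show add: "poly_at \<kappa> r (p + q) = poly_at \<kappa> r p + poly_at \<kappa> r q" for p q
    by (induction p q rule: poly_induct2)
       (simp_all add: z poly_at_pCons[OF \<kappa>] algebra_map_simps(3)[OF \<kappa>] algebra_simps)
  show sm: "poly_at \<kappa> r (smult c p) = \<kappa> c * poly_at \<kappa> r p" for c p
  proof (induction p)
    case (pCons a p)
    have "r * (\<kappa> c * poly_at \<kappa> r p) = \<kappa> c * (r * poly_at \<kappa> r p)"
      using algebra_map_simps(7)[OF \<kappa>, of c r] by (simp flip: mult.assoc)
    thus ?case using pCons by (simp add: poly_at_pCons[OF \<kappa>] algebra_map_simps(4)[OF \<kappa>] distrib_left)
  qed (simp add: z)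
  show "poly_at \<kappa> r (p * q) = poly_at \<kappa> r p * poly_at \<kappa> r q"
  proof (induction p)
    case (pCons a p)
    thus ?case
      by (simp add: add sm poly_at_pCons[OF \<kappa>] algebra_map_simps(2)[OF \<kappa>] distrib_right mult.assoc)
  qed (simp add: z)
qed

text \<open>
  This is the Nullstellensatz for countably generated algebras. Let \<open>M\<close> be a maximal ideal and suppose that
  \<open>r - \<mu>\<close> is invertible modulo \<open>M\<close> for every \<open>\<mu> \<in> k\<close>, with inverse \<open>q(\<mu>)\<close>. As \<open>k\<close> is uncountable and
  the algebra is a countable increasing union of spaces of finite dimension, one of these spaces, of
  dimension \<open>n\<close>, contains \<open>n + 1\<close> of the inverses, and they are linearly dependent. Multiplying the relation by
  all the factors \<open>r - \<mu>\<close> involved gives a nonzero polynomial that annihilates \<open>r\<close> modulo \<open>M\<close>; it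
  splits into linear factors, and one of them maps \<open>r\<close> into the prime ideal \<open>M\<close>. So every \<open>r\<close> is
  congruent to a unique scalar.
\<close>
lemma countable_algebra_character:
  fixes \<kappa> :: "'k::alg_closed_field \<Rightarrow> 'r::ring_1"
  assumes unc: "uncountable (UNIV :: 'k set)" and \<kappa>: "algebra_map \<kappa>" and S: "countable S"
    and nontriv: "(1 :: 'r) \<noteq> 0"
    and com: "\<And>x y. x \<in> subalgebra_gen \<kappa> S \<Longrightarrow> y \<in> subalgebra_gen \<kappa> S \<Longrightarrow> x * y = y * x"
  shows "\<exists>\<chi> :: 'r \<Rightarrow> 'k. (\<forall>c. \<chi> (\<kappa> c) = c) \<and>
    (\<forall>x\<in>subalgebra_gen \<kappa> S. \<forall>y\<in>subalgebra_gen \<kappa> S. \<chi> (x + y) = \<chi> x + \<chi> y \<and> \<chi> (x * y) = \<chi> x * \<chi> y)"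
proof -
  let ?R = "subalgebra_gen \<kappa> S"
  note ks = algebra_map_simps[OF \<kappa>]
  have R1: "1 \<in> ?R" and R0: "0 \<in> ?R" using subalgebra_gen.scalar[of \<kappa>] ks(1,2) by metis+
  have Rk: "\<kappa> c \<in> ?R" for c by (rule subalgebra_gen.scalar)
  have Ra: "x + y \<in> ?R" and Rm: "x * y \<in> ?R" if "x \<in> ?R" "y \<in> ?R" for x y
    using that by (auto intro: subalgebra_gen.intros)
  have Rn: "- x \<in> ?R" if "x \<in> ?R" for x using Rm[OF Rk[of "-1"] that] ks(1,5) by simp
  have Rd: "x - y \<in> ?R" if "x \<in> ?R" "y \<in> ?R" for x y using Ra[OF that(1) Rn[OF that(2)]] by simp
  define F where "F = (\<lambda>r x. r * x) ` ?R"
  have F0: "\<forall>f\<in>F. f 0 = 0" by (simp add: F_def)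
  obtain M where MR': "M \<subseteq> ?R" and M: "stable_subset F M" and M1: "1 \<notin> M"
    and max: "\<And>X. M \<subseteq> X \<Longrightarrow> X \<subseteq> ?R \<Longrightarrow> stable_subset F X \<Longrightarrow> 1 \<notin> X \<Longrightarrow> X = M"
    by (rule maximal_stable_subset_avoiding[OF nontriv R0 F0]) (rule that)
  note MR = subsetD[OF MR']
  have M0: "0 \<in> M" and Ma: "\<And>x y. x \<in> M \<Longrightarrow> y \<in> M \<Longrightarrow> x + y \<in> M"
    and Mm: "\<And>x y. x \<in> ?R \<Longrightarrow> y \<in> M \<Longrightarrow> x * y \<in> M"
    using M by (simp_all add: stable_subset_def F_def)
  have Mm': "y * x \<in> M" if "x \<in> ?R" "y \<in> M" for x y
    using Mm[OF that] com[OF that(1) MR[OF that(2)]] by simp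
  have Mn: "- x \<in> M" if "x \<in> M" for x using Mm[OF Rk[of "-1"] that] ks(1,5) by simp
  have Md: "x - y \<in> M" if "x \<in> M" "y \<in> M" for x y using Ma[OF that(1) Mn[OF that(2)]] by simp
  have Ms: "sum f I \<in> M" if "\<And>i. i \<in> I \<Longrightarrow> f i \<in> M" for f :: "nat \<Rightarrow> 'r" and I
    using that by (induction I rule: infinite_finite_induct) (auto simp: M0 Ma)
  have unit: "\<exists>q\<in>?R. 1 - q * r \<in> M" if r: "r \<in> ?R" "r \<notin> M" for r
  proof -
    define X where "X = {w + q * r |w q. w \<in> M \<and> q \<in> ?R}"
    have MX: "M \<subseteq> X" unfolding X_def using R0 by force
    have "r \<in> X" unfolding X_def using M0 R1 by force
    hence "X \<noteq> M" using r by blast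
    have XR: "X \<subseteq> ?R" unfolding X_def using MR r Ra Rm by blast
    have "0 \<in> X" using MX M0 by blast
    moreover have "x + y \<in> X" if xy: "x \<in> X" "y \<in> X" for x y
    proof -
      obtain w q w' q' where "x = w + q * r" "y = w' + q' * r" "w \<in> M" "w' \<in> M" "q \<in> ?R" "q' \<in> ?R"
        using xy by (auto simp: X_def)
      moreover from this have "x + y = (w + w') + (q + q') * r" by (simp add: algebra_simps)
      ultimately show ?thesis unfolding X_def using Ma Ra by blast
    qed
    moreover have "x * y \<in> X" if xy: "x \<in> ?R" "y \<in> X" for x y
    proof -
      obtain w q where "y = w + q * r" "w \<in> M" "q \<in> ?R" using xy by (auto simp: X_def)
      moreover from this have "x * y = x * w + (x * q) * r" by (simp add: algebra_simps)
      ultimately show ?thesis unfolding X_def using Mm Rm xy(1) by blast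
    qed
    ultimately have "stable_subset F X" by (simp add: stable_subset_def F_def)
    hence "1 \<in> X" using max[OF MX XR] \<open>X \<noteq> M\<close> by blast
    then obtain w q where wq: "1 = w + q * r" "w \<in> M" "q \<in> ?R" by (auto simp: X_def)
    have "1 - q * r = w + q * r - q * r" by (simp only: wq(1)[symmetric])
    hence "1 - q * r = w" by simp
    thus ?thesis using wq by blast
  qed
  have pR: "poly_at \<kappa> r p \<in> ?R" if "r \<in> ?R" for r p
    by (induction p) (auto simp: poly_at_simps(1)[OF \<kappa>] poly_at_pCons[OF \<kappa>] R0 intro!: Ra Rm Rk that)
  have root: "\<exists>\<mu>. r - \<kappa> \<mu> \<in> M" if r: "r \<in> ?R" and p: "p \<noteq> 0" "poly_at \<kappa> r p \<in> M" for r p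
    using p
  proof (induction "degree p" arbitrary: p rule: less_induct)
    case less
    show ?case
    proof (cases "degree p = 0")
      case True
      then obtain c where c: "p = [:c:]" by (auto elim: degree_eq_zeroE)
      hence "c \<noteq> 0" "\<kappa> c \<in> M" using less.prems by (auto simp: poly_at_pCons[OF \<kappa>] poly_at_simps(1)[OF \<kappa>])
      hence "1 \<in> M" using Mm[OF Rk[of "inverse c"], of "\<kappa> c"] ks(4)[of "inverse c" c] ks(1) by simp
      thus ?thesis using M1 by blast
    next
      case False
      then obtain \<mu> where "poly p \<mu> = 0" using alg_closed_imp_poly_has_root by blast
      then obtain q where q: "p = [:- \<mu>, 1:] * q" by (auto simp: poly_eq_0_iff_dvd elim: dvdE)
      have q0: "q \<noteq> 0" using q less.prems by auto
      have "degree q < degree p" unfolding q using q0 by (subst degree_mult_eq) auto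
      have pq: "poly_at \<kappa> r p = (r - \<kappa> \<mu>) * poly_at \<kappa> r q"
        unfolding q poly_at_simps(4)[OF \<kappa>]
        by (simp add: poly_at_pCons[OF \<kappa>] poly_at_simps(1)[OF \<kappa>] ks(1,5))
      show ?thesis
      proof (cases "r - \<kappa> \<mu> \<in> M")
        case False
        then obtain s where s: "s \<in> ?R" "1 - s * (r - \<kappa> \<mu>) \<in> M" using unit[OF Rd[OF r Rk]] by blast
        have "poly_at \<kappa> r q = (1 - s * (r - \<kappa> \<mu>)) * poly_at \<kappa> r q + s * poly_at \<kappa> r p"
          unfolding pq by (simp add: algebra_simps)
        hence "poly_at \<kappa> r q \<in> M"
          using Ma[OF Mm'[OF pR[OF r] s(2)] Mm[OF s(1) less.prems(2)]] by metis
        thus ?thesis using less.hyps[OF \<open>degree q < degree p\<close> q0] by blast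
      qed blast
    qed
  qed
  obtain b :: "nat \<Rightarrow> 'r" where b: "\<forall>x\<in>?R. \<exists>n a. x = (\<Sum>j<n. \<kappa> (a j) * b j)"
    using subalgebra_gen_countably_spanned[OF \<kappa> S] ..
  have scalar: "\<exists>\<mu>. r - \<kappa> \<mu> \<in> M" if r: "r \<in> ?R" for r
  proof (rule ccontr)
    assume no: "\<nexists>\<mu>. r - \<kappa> \<mu> \<in> M"
    hence "\<forall>\<mu>. \<exists>q\<in>?R. 1 - q * (r - \<kappa> \<mu>) \<in> M" using unit[OF Rd[OF r Rk]] by blast
    then obtain q where q: "\<And>\<mu>. q \<mu> \<in> ?R" "\<And>\<mu>. 1 - q \<mu> * (r - \<kappa> \<mu>) \<in> M" by metis
    have "\<forall>\<mu>. \<exists>n a. q \<mu> = (\<Sum>j<n. \<kappa> (a j) * b j)" using b q(1) by blast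
    then obtain N a where Na: "\<And>\<mu>. q \<mu> = (\<Sum>j<N \<mu>. \<kappa> (a \<mu> j) * b j)" by metis
    have "\<exists>n. infinite {\<mu>. N \<mu> = n}"
    proof (rule ccontr)
      assume "\<nexists>n. infinite {\<mu>. N \<mu> = n}"
      hence "countable (\<Union>n. {\<mu>. N \<mu> = n})" by (intro countable_UN) (auto intro: countable_finite)
      moreover have "(\<Union>n. {\<mu>. N \<mu> = n}) = (UNIV :: 'k set)" by auto
      ultimately show False using unc by simp
    qed
    then obtain n and f :: "nat \<Rightarrow> 'k" where f: "inj f" "range f \<subseteq> {\<mu>. N \<mu> = n}"
      using infinite_countable_subset by blast
    obtain d where d: "\<exists>i\<le>n. d i \<noteq> 0" "\<forall>j<n. (\<Sum>i\<le>n. d i * a (f i) j) = 0"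
      using left_linear_system_nontrivial[of n "\<lambda>i. a (f i)"] by blast
    have dq: "(\<Sum>i\<le>n. \<kappa> (d i) * q (f i)) = 0"
    proof -
      have Nf: "N (f i) = n" for i using f(2) by auto
      have "(\<Sum>i\<le>n. \<kappa> (d i) * q (f i)) = (\<Sum>i\<le>n. \<Sum>j<n. \<kappa> (d i * a (f i) j) * b j)"
        unfolding Na Nf by (simp add: sum_distrib_left ks(4) mult.assoc)
      also have "\<dots> = (\<Sum>j<n. \<kappa> (\<Sum>i\<le>n. d i * a (f i) j) * b j)"
        by (subst sum.swap) (simp add: algebra_map_sum[OF \<kappa>] sum_distrib_right)
      also have "\<dots> = 0" using d(2) by (simp add: ks(2))
      finally show ?thesis .
    qed
    define L where "L i = (\<Prod>l\<in>{..n} - {i}. [:- f l, 1:])" for i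
    define T where "T = (\<Prod>l\<le>n. [:- f l, 1:])"
    define P where "P = (\<Sum>i\<le>n. smult (d i) (L i))"
    have TL: "T = [:- f i, 1:] * L i" if "i \<le> n" for i
      unfolding T_def L_def using that by (subst prod.remove[of _ i]) auto
    have "P \<noteq> 0"
    proof -
      obtain i where i: "i \<le> n" "d i \<noteq> 0" using d(1) by blast
      have "poly (L l) (f i) = 0" if "l \<le> n" "l \<noteq> i" for l
        unfolding L_def poly_prod using i that by (auto simp: prod_zero_iff)
      hence "poly P (f i) = d i * poly (L i) (f i)"
        unfolding P_def poly_sum using i by (subst sum.remove[of _ i]) auto
      moreover have "poly (L i) (f i) \<noteq> 0"
        unfolding L_def poly_prod using f(1) by (auto simp: prod_zero_iff inj_eq)
      ultimately show ?thesis using i by auto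
    qed
    moreover have "poly_at \<kappa> r P \<in> M"
    proof -
      have sumat: "poly_at \<kappa> r (sum g I) = (\<Sum>i\<in>I. poly_at \<kappa> r (g i))" for g and I :: "nat set"
        by (induction I rule: infinite_finite_induct) (simp_all add: poly_at_simps[OF \<kappa>])
      have step: "poly_at \<kappa> r (L i) - q (f i) * poly_at \<kappa> r T \<in> M" if "i \<le> n" for i
      proof -
        have "poly_at \<kappa> r T = (r - \<kappa> (f i)) * poly_at \<kappa> r (L i)"
          unfolding TL[OF that] poly_at_simps(4)[OF \<kappa>]
          by (simp add: poly_at_pCons[OF \<kappa>] poly_at_simps(1)[OF \<kappa>] ks(1,5))
        hence "poly_at \<kappa> r (L i) - q (f i) * poly_at \<kappa> r T = (1 - q (f i) * (r - \<kappa> (f i))) * poly_at \<kappa> r (L i)"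
          by (simp only: left_diff_distrib mult.assoc mult_1_left)
        thus ?thesis using Mm'[OF pR[OF r] q(2)] by metis
      qed
      have "poly_at \<kappa> r P = (\<Sum>i\<le>n. \<kappa> (d i) * (poly_at \<kappa> r (L i) - q (f i) * poly_at \<kappa> r T))
          + (\<Sum>i\<le>n. \<kappa> (d i) * q (f i)) * poly_at \<kappa> r T"
        by (simp add: P_def sumat poly_at_simps(3)[OF \<kappa>] right_diff_distrib sum_subtractf sum_distrib_right mult.assoc)
      also have "\<dots> = (\<Sum>i\<le>n. \<kappa> (d i) * (poly_at \<kappa> r (L i) - q (f i) * poly_at \<kappa> r T))" using dq by simp
      finally show ?thesis using step by (auto intro!: Ms Mm Rk)
    qed
    ultimately show False using root[OF r] no by blast
  qed
  define \<chi> where "\<chi> x = (THE \<mu>. x - \<kappa> \<mu> \<in> M)" for x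
  have uniq: "\<mu> = \<nu>" if "x - \<kappa> \<mu> \<in> M" "x - \<kappa> \<nu> \<in> M" for x \<mu> \<nu>
  proof (rule ccontr)
    assume ne: "\<mu> \<noteq> \<nu>"
    have "\<kappa> (\<mu> - \<nu>) \<in> M" using Md[OF that(2,1)] by (simp add: ks(6))
    hence "\<kappa> (inverse (\<mu> - \<nu>)) * \<kappa> (\<mu> - \<nu>) \<in> M" by (rule Mm[OF Rk])
    thus False using M1 ne ks(4)[of "inverse (\<mu> - \<nu>)" "\<mu> - \<nu>"] ks(1) by simp
  qed
  have \<chi>I: "\<chi> x = \<mu>" if "x - \<kappa> \<mu> \<in> M" for x \<mu>
    unfolding \<chi>_def using that uniq by (intro the_equality) blast+
  have \<chi>: "x - \<kappa> (\<chi> x) \<in> M" if "x \<in> ?R" for x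
    using scalar[OF that] \<chi>I by blast
  show ?thesis
  proof (intro exI[of _ \<chi>] conjI allI ballI)
    show "\<chi> (\<kappa> c) = c" for c using M0 by (intro \<chi>I) simp
    fix x y assume xy: "x \<in> ?R" "y \<in> ?R"
    show "\<chi> (x + y) = \<chi> x + \<chi> y"
    proof (rule \<chi>I)
      have "x + y - \<kappa> (\<chi> x + \<chi> y) = (x - \<kappa> (\<chi> x)) + (y - \<kappa> (\<chi> y))" by (simp add: ks(3))
      thus "x + y - \<kappa> (\<chi> x + \<chi> y) \<in> M" using Ma[OF \<chi>[OF xy(1)] \<chi>[OF xy(2)]] by metis
    qed
    show "\<chi> (x * y) = \<chi> x * \<chi> y"
    proof (rule \<chi>I)
      have "x * y - \<kappa> (\<chi> x * \<chi> y) = (x - \<kappa> (\<chi> x)) * y + \<kappa> (\<chi> x) * (y - \<kappa> (\<chi> y))"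
        by (simp add: ks(4) algebra_simps)
      thus "x * y - \<kappa> (\<chi> x * \<chi> y) \<in> M" using Ma[OF Mm'[OF xy(2) \<chi>[OF xy(1)]] Mm[OF Rk \<chi>[OF xy(2)]]] by metis
    qed
  qed
qed

section \<open>Maximal subfields of the quotient division ring\<close>

lemma ring_homomorphism_simps:
  assumes "ring_homomorphism \<iota>"
  shows "\<iota> 1 = 1" "\<iota> 0 = 0" "\<iota> (x + y) = \<iota> x + \<iota> y" "\<iota> (x * y) = \<iota> x * \<iota> y"
proof -
  have *: "\<iota> 1 = 1 \<and> (\<forall>x y. \<iota> (x + y) = \<iota> x + \<iota> y) \<and> (\<forall>x y. \<iota> (x * y) = \<iota> x * \<iota> y)"
    using assms unfolding ring_homomorphism_def by blast
  show "\<iota> 1 = 1" "\<iota> (x + y) = \<iota> x + \<iota> y" "\<iota> (x * y) = \<iota> x * \<iota> y" using * by blast+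
  have "\<iota> (0 + 0) = \<iota> 0 + \<iota> 0" using * by blast
  thus "\<iota> 0 = 0" by simp
qed

lemma ring_homomorphism_sum:
  assumes "ring_homomorphism \<iota>" shows "\<iota> (sum f I) = (\<Sum>i\<in>I. \<iota> (f i))"
  by (induction I rule: infinite_finite_induct) (simp_all add: ring_homomorphism_simps(2,3)[OF assms])

text \<open>
  Otherwise there are \<open>e\<^sub>n \<in> E\<close> and \<open>y\<^sub>n\<close> such that \<open>y\<^sub>n\<close> commutes with \<open>e\<^sub>i\<close> for \<open>i < n\<close> but not with
  \<open>e\<^sub>n\<close>. Write \<open>e\<^sub>n = s\<^sub>n\<^sup>-\<^sup>1 a\<^sub>n\<close> with \<open>s\<^sub>n, a\<^sub>n \<in> A\<close>, and choose right \<open>E\<close>-linear functionals \<open>h\<^sub>n\<close> on \<open>D\<close>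
  with \<open>h\<^sub>n(s\<^sub>n y\<^sub>n e\<^sub>n - a\<^sub>n y\<^sub>n) = 1\<close>. The \<open>e\<^sub>n\<close> and the values \<open>h\<^sub>n(x y\<^sub>n)\<close> with \<open>x \<in> A\<close> lie in a
  countably generated subalgebra of \<open>E\<close>, which has a character \<open>\<chi>\<close>. The maps \<open>x \<mapsto> \<chi> (h\<^sub>n(x y\<^sub>n))\<close>
  vanish on the left ideal generated by the elements \<open>\<chi>(e\<^sub>i) s\<^sub>i - a\<^sub>i\<close> with \<open>i < n\<close>, and are
  \<open>1\<close> at the next such element. These ideals thus form a strictly ascending chain.
\<close>
lemma subfield_finite_centralizer:
  fixes \<eta> :: "'k::alg_closed_field \<Rightarrow> 'a::ring_1_no_zero_divisors" and \<iota> :: "'a \<Rightarrow> 'd::division_ring"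
  assumes unc: "uncountable (UNIV :: 'k set)" and \<eta>: "algebra_map \<eta>"
    and cg: "countably_generated_algebra \<eta>" and noeth: "left_noetherian TYPE('a)"
    and ore: "ore_quotient_division_ring \<iota>" and E: "is_subfield E" and kE: "\<And>c. \<iota> (\<eta> c) \<in> E"
  shows "\<exists>F. finite F \<and> F \<subseteq> E \<and> (\<forall>u. (\<forall>e\<in>F. e * u = u * e) \<longrightarrow> (\<forall>e\<in>E. e * u = u * e))"
proof (rule ccontr)
  define \<kappa> where "\<kappa> = \<iota> \<circ> \<eta>"
  have \<kappa>: "algebra_map \<kappa>" unfolding \<kappa>_def by (rule algebra_map_ore_quotient[OF \<eta> ore])
  note ks = algebra_map_simps[OF \<kappa>]
  have \<iota>: "ring_homomorphism \<iota>" and inj: "inj \<iota>"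
    and frac: "\<And>z. \<exists>s a. s \<noteq> 0 \<and> z = inverse (\<iota> s) * \<iota> a"
    using ore unfolding ore_quotient_division_ring_def by blast+
  note ih = ring_homomorphism_simps[OF \<iota>]
  assume "\<nexists>F. finite F \<and> F \<subseteq> E \<and> (\<forall>u. (\<forall>e\<in>F. e * u = u * e) \<longrightarrow> (\<forall>e\<in>E. e * u = u * e))"
  note no = this
  define Q where "Q e u \<longleftrightarrow> e * u = u * e" for e u :: 'd
  have "\<exists>e u. e \<in> E \<and> (\<forall>f\<in>F. Q f u) \<and> \<not> Q e u" if "finite F" "F \<subseteq> E" for F
    using no that unfolding Q_def[symmetric] by blast
  then obtain \<epsilon> \<upsilon> where eu: "\<And>F. finite F \<Longrightarrow> F \<subseteq> E \<Longrightarrow>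
      \<epsilon> F \<in> E \<and> (\<forall>f\<in>F. Q f (\<upsilon> F)) \<and> \<not> Q (\<epsilon> F) (\<upsilon> F)" by metis
  define Fs where "Fs = rec_nat {} (\<lambda>_ F. insert (\<epsilon> F) F)"
  have Fs_Suc: "Fs (Suc n) = insert (\<epsilon> (Fs n)) (Fs n)" and Fs_0: "Fs 0 = {}" for n by (simp_all add: Fs_def)
  have Fs: "finite (Fs n) \<and> Fs n \<subseteq> E" for n
    by (induction n) (use eu in \<open>auto simp: Fs_0 Fs_Suc\<close>)
  define e where "e n = \<epsilon> (Fs n)" for n
  define y where "y n = \<upsilon> (Fs n)" for n
  have eE: "e n \<in> E" and ne: "e n * y n \<noteq> y n * e n" for n using eu[of "Fs n"] Fs[of n] by (simp_all add: e_def y_def Q_def)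
  have mem: "e i \<in> Fs n" if "i < n" for i n using that by (induction n) (auto simp: Fs_Suc e_def less_Suc_eq)
  have ey: "e i * y n = y n * e i" if "i < n" for i n
  proof -
    have "Q (e i) (y n)" using eu[of "Fs n"] Fs[of n] mem[OF that] by (simp add: y_def)
    thus ?thesis by (simp add: Q_def)
  qed
  have "\<forall>n. \<exists>s a. s \<noteq> 0 \<and> e n = inverse (\<iota> s) * \<iota> a" using frac by blast
  then obtain s a where sa: "\<And>n. s n \<noteq> 0" "\<And>n. e n = inverse (\<iota> (s n)) * \<iota> (a n)" by metis
  have s0: "\<iota> (s n) \<noteq> 0" for n using sa(1)[of n] injD[OF inj, of "s n" 0] ih(2) by auto
  have se: "\<iota> (s n) * e n = \<iota> (a n)" for n using s0[of n] unfolding sa(2)[of n] by (simp flip: mult.assoc)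
  define z where "z n = \<iota> (s n) * y n * e n - \<iota> (a n) * y n" for n
  have z0: "z n \<noteq> 0" for n
  proof -
    have "z n = \<iota> (s n) * (y n * e n - e n * y n)"
      unfolding z_def se[symmetric] by (simp only: right_diff_distrib mult.assoc)
    thus ?thesis using s0[of n] ne[of n] by simp
  qed
  have "\<forall>n. \<exists>h. (\<forall>d. h d \<in> E) \<and> (\<forall>x y. h (x + y) = h x + h y) \<and> (\<forall>c\<in>E. \<forall>d. h (d * c) = h d * c) \<and> h (z n) = 1"
    by (metis subfield_functional[OF E z0])
  then obtain h where h: "\<And>n d. h n d \<in> E" "\<And>n x y. h n (x + y) = h n x + h n y"
    "\<And>n c d. c \<in> E \<Longrightarrow> h n (d * c) = h n d * c" "\<And>n. h n (z n) = 1" by metis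
  obtain S where S: "countable S" "subalgebra_gen \<eta> S = UNIV"
    using cg unfolding countably_generated_algebra_def by blast
  obtain b :: "nat \<Rightarrow> 'a" where b': "\<forall>x\<in>subalgebra_gen \<eta> S. \<exists>n c. x = (\<Sum>j<n. \<eta> (c j) * b j)"
    using subalgebra_gen_countably_spanned[OF \<eta> S(1)] ..
  have b: "\<exists>n c. x = (\<Sum>j<n. \<eta> (c j) * b j)" for x
    using b' unfolding S(2) by (rule bspec) simp
  define G where "G = range e \<union> (\<lambda>(n, j). h n (\<iota> (b j) * y n)) ` UNIV"
  have G: "countable G" "G \<subseteq> E" using h(1) eE by (auto simp: G_def)
  let ?R = "subalgebra_gen \<kappa> G"
  have RE: "x \<in> E" if "x \<in> ?R" for x
    using that
  proof induction
    case (generator x) thus ?case using G(2) by blast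
  next
    case (scalar c) thus ?case using kE by (simp add: \<kappa>_def)
  qed (use E in \<open>unfold is_subfield_def, blast\<close>)+
  have com: "x * w = w * x" if "x \<in> ?R" "w \<in> ?R" for x w
    using RE[OF that(1)] RE[OF that(2)] E unfolding is_subfield_def by blast
  have "\<exists>\<chi> :: 'd \<Rightarrow> 'k. (\<forall>c. \<chi> (\<kappa> c) = c) \<and>
    (\<forall>x\<in>?R. \<forall>w\<in>?R. \<chi> (x + w) = \<chi> x + \<chi> w \<and> \<chi> (x * w) = \<chi> x * \<chi> w)"
    by (rule countable_algebra_character[OF unc \<kappa> G(1) one_neq_zero]) (rule com)
  then obtain \<chi> :: "'d \<Rightarrow> 'k" where \<chi>': "(\<forall>c. \<chi> (\<kappa> c) = c) \<and>
    (\<forall>x\<in>?R. \<forall>w\<in>?R. \<chi> (x + w) = \<chi> x + \<chi> w \<and> \<chi> (x * w) = \<chi> x * \<chi> w)" ..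
  have \<chi>: "\<And>c. \<chi> (\<kappa> c) = c"
    "\<And>x w. x \<in> ?R \<Longrightarrow> w \<in> ?R \<Longrightarrow> \<chi> (x + w) = \<chi> x + \<chi> w"
    "\<And>x w. x \<in> ?R \<Longrightarrow> w \<in> ?R \<Longrightarrow> \<chi> (x * w) = \<chi> x * \<chi> w"
    using \<chi>' by blast+
  have eR: "e n \<in> ?R" for n by (rule subalgebra_gen.generator) (simp add: G_def)
  have kR: "\<kappa> c \<in> ?R" for c by (rule subalgebra_gen.scalar)
  have h0: "h n 0 = 0" for n using h(2)[of n 0 0] by simp
  have hsum: "h n (sum g I) = (\<Sum>i\<in>I. h n (g i))" for n g and I :: "nat set"
    by (induction I rule: infinite_finite_induct) (simp_all add: h0 h(2))
  have hk: "h n (\<kappa> c * d) = h n d * \<kappa> c" for n c d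
    using h(3)[of "\<kappa> c" n d] kE[of c] ks(7)[of c d] by (simp add: \<kappa>_def)
  have Rsum: "sum g I \<in> ?R" if "\<And>i. i \<in> I \<Longrightarrow> g i \<in> ?R" for g and I :: "nat set"
    using that kR[of 0] ks(2)
    by (induction I rule: infinite_finite_induct) (auto intro: subalgebra_gen.add)
  have hR: "h n (\<iota> x * y n) \<in> ?R" for n x
  proof -
    obtain m c where x: "x = (\<Sum>j<m. \<eta> (c j) * b j)" using b by blast
    have "\<iota> x * y n = (\<Sum>j<m. \<kappa> (c j) * (\<iota> (b j) * y n))"
      by (simp add: x ring_homomorphism_sum[OF \<iota>] ih(4) sum_distrib_right \<kappa>_def mult.assoc)
    hence "h n (\<iota> x * y n) = (\<Sum>j<m. h n (\<iota> (b j) * y n) * \<kappa> (c j))" by (simp add: hsum hk)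
    moreover have "h n (\<iota> (b j) * y n) \<in> ?R" for j
      by (rule subalgebra_gen.generator) (auto simp: G_def intro!: rev_image_eqI[of "(n, j)"])
    ultimately show ?thesis using kR by (auto intro!: Rsum subalgebra_gen.mult)
  qed
  define \<psi> where "\<psi> n x = \<chi> (h n (\<iota> x * y n))" for n x
  have \<psi>add: "\<psi> n (x + w) = \<psi> n x + \<psi> n w" for n x w
    using \<chi>(2)[OF hR hR] by (simp add: \<psi>_def ih(3) distrib_right h(2))
  have \<psi>k: "\<psi> n (\<eta> c * x) = \<psi> n x * c" for n c x
  proof -
    have "h n (\<iota> (\<eta> c * x) * y n) = h n (\<iota> x * y n) * \<kappa> c"
      using hk[of n c "\<iota> x * y n"] by (simp add: ih(4) \<kappa>_def mult.assoc)
    thus ?thesis using \<chi>(3)[OF hR kR] \<chi>(1) by (simp add: \<psi>_def)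
  qed
  define f where "f n = \<eta> (\<chi> (e n)) * s n - a n" for n
  have \<psi>0: "\<psi> n (r * f i) = 0" if "i < n" for n i r
  proof -
    have "r * f i + r * a i = \<eta> (\<chi> (e i)) * (r * s i)"
    proof -
      have "r * (\<eta> (\<chi> (e i)) * s i) = \<eta> (\<chi> (e i)) * (r * s i)"
        using algebra_map_simps(7)[OF \<eta>, of "\<chi> (e i)" r] by (simp flip: mult.assoc)
      thus ?thesis by (simp add: f_def right_diff_distrib)
    qed
    hence "\<psi> n (r * f i) + \<psi> n (r * a i) = \<psi> n (r * s i) * \<chi> (e i)"
      using \<psi>add[of n "r * f i" "r * a i"] \<psi>k by simp
    moreover have "\<psi> n (r * a i) = \<psi> n (r * s i) * \<chi> (e i)"
    proof -
      have "\<iota> (r * a i) * y n = \<iota> r * \<iota> (s i) * (e i * y n)"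
        by (simp only: ih(4) se[symmetric] mult.assoc)
      also have "\<dots> = \<iota> (r * s i) * y n * e i" by (simp only: ey[OF that] ih(4) mult.assoc)
      finally have "h n (\<iota> (r * a i) * y n) = h n (\<iota> (r * s i) * y n) * e i" using h(3)[OF eE] by simp
      thus ?thesis using \<chi>(3)[OF hR eR] by (simp add: \<psi>_def)
    qed
    ultimately show ?thesis by simp
  qed
  have \<psi>1: "\<psi> n (f n) = 1" for n
  proof -
    have "f n + a n = \<eta> (\<chi> (e n)) * s n" by (simp add: f_def)
    hence 1: "\<psi> n (f n) + \<psi> n (a n) = \<psi> n (s n) * \<chi> (e n)" using \<psi>add[of n "f n" "a n"] \<psi>k by simp
    have "z n + \<iota> (a n) * y n = \<iota> (s n) * y n * e n" by (simp add: z_def)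
    hence "1 + h n (\<iota> (a n) * y n) = h n (\<iota> (s n) * y n) * e n"
      using h(2)[of n "z n" "\<iota> (a n) * y n"] h(3)[OF eE] h(4) by simp
    moreover have "\<chi> (1 + h n (\<iota> (a n) * y n)) = 1 + \<psi> n (a n)"
      using \<chi>(2)[OF kR[of 1] hR] \<chi>(1)[of 1] ks(1) by (simp add: \<psi>_def)
    moreover have "\<chi> (h n (\<iota> (s n) * y n) * e n) = \<psi> n (s n) * \<chi> (e n)"
      using \<chi>(3)[OF hR eR] by (simp add: \<psi>_def)
    ultimately have "1 + \<psi> n (a n) = \<psi> n (s n) * \<chi> (e n)" by simp
    thus ?thesis using 1 by (metis add_right_cancel)
  qed
  define I where "I n = {x. \<exists>r. x = (\<Sum>i<n. r i * f i)}" for n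
  have ideal: "left_ideal (I n)" for n
    unfolding left_ideal_def
  proof (intro conjI ballI allI)
    show "0 \<in> I n" unfolding I_def by (intro CollectI exI[of _ "\<lambda>_. 0"]) simp
    fix x assume "x \<in> I n"
    then obtain r where r: "x = (\<Sum>i<n. r i * f i)" by (auto simp: I_def)
    show "t * x \<in> I n" for t unfolding I_def
      by (intro CollectI exI[of _ "\<lambda>i. t * r i"]) (simp add: r sum_distrib_left mult.assoc)
    fix w assume "w \<in> I n"
    then obtain q where q: "w = (\<Sum>i<n. q i * f i)" by (auto simp: I_def)
    show "x + w \<in> I n" unfolding I_def
      by (intro CollectI exI[of _ "\<lambda>i. r i + q i"]) (simp add: r q sum.distrib distrib_right)
  qed
  have asc: "I n \<subseteq> I (Suc n)" for n
  proof
    fix x assume "x \<in> I n"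
    then obtain r where r: "x = (\<Sum>i<n. r i * f i)" by (auto simp: I_def)
    show "x \<in> I (Suc n)" unfolding I_def
      by (intro CollectI exI[of _ "\<lambda>i. if i = n then 0 else r i"]) (simp add: r)
  qed
  obtain N where N: "\<forall>n\<ge>N. I n = I N" using noeth ideal asc unfolding left_noetherian_def by blast
  have "f N \<in> I (Suc N)" unfolding I_def
    by (intro CollectI exI[of _ "\<lambda>i. if i = N then 1 else 0"]) simp
  hence "f N \<in> I N" using N by (metis le_SucI order_refl)
  then obtain r where r: "f N = (\<Sum>i<N. r i * f i)" by (auto simp: I_def)
  have "\<psi> N (0 + 0) = \<psi> N 0 + \<psi> N 0" by (rule \<psi>add)
  hence "\<psi> N 0 + \<psi> N 0 = \<psi> N 0 + 0" by (simp only: add_0_right)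
  hence \<psi>N0: "\<psi> N 0 = 0" by (simp only: add_left_cancel)
  have "\<psi> N (sum g J) = (\<Sum>i\<in>J. \<psi> N (g i))" for g and J :: "nat set"
    by (induction J rule: infinite_finite_induct) (simp_all add: \<psi>add \<psi>N0)
  hence "\<psi> N (f N) = 0" unfolding r using \<psi>0 by simp
  thus False using \<psi>1[of N] by simp
qed

text \<open>
  The double centralizer of \<open>E \<union> {u}\<close> is a subfield, since \<open>E \<union> {u}\<close> is commutative.
\<close>
lemma maximal_subfield_self_centralizing:
  assumes E: "maximal_subfield E" and u: "\<And>e. e \<in> E \<Longrightarrow> e * u = u * e"
  shows "u \<in> E"
proof -
  have Ecom: "x * y = y * x" if "x \<in> E" "y \<in> E" for x y
    using E that unfolding maximal_subfield_def is_subfield_def by blast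
  define T where "T = insert u E"
  define C where "C = {z. \<forall>t\<in>T. z * t = t * z}"
  define F where "F = {z. \<forall>c\<in>C. z * c = c * z}"
  have TC: "T \<subseteq> C" unfolding C_def T_def using u Ecom by auto
  have TF: "T \<subseteq> F" unfolding F_def C_def by auto
  have FC: "F \<subseteq> C" unfolding C_def using TC by (auto simp: F_def)
  have "is_subfield F"
    unfolding is_subfield_def
  proof (intro conjI ballI impI)
    show "0 \<in> F" "1 \<in> F" by (simp_all add: F_def)
    fix x assume x: "x \<in> F"
    show "- x \<in> F" using x by (simp add: F_def)
    show "inverse x \<in> F" unfolding F_def
    proof (intro CollectI ballI)
      fix c assume "c \<in> C"
      hence "c * x = x * c" using x by (simp add: F_def)
      from inverse_commutes[OF this] show "inverse x * c = c * inverse x" ..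
    qed
    fix y assume y: "y \<in> F"
    show "x + y \<in> F" using x y by (simp add: F_def distrib_left distrib_right)
    show "x * y \<in> F" unfolding F_def
    proof (intro CollectI ballI)
      fix c assume "c \<in> C"
      hence c: "x * c = c * x" "y * c = c * y" using x y by (simp_all add: F_def)
      have "x * y * c = x * c * y" by (simp only: mult.assoc c(2))
      thus "x * y * c = c * (x * y)" by (simp only: c(1) mult.assoc)
    qed
    show "x * y = y * x" using x y FC by (auto simp: F_def)
  qed
  moreover have "E \<subseteq> F" using TF by (auto simp: T_def)
  ultimately have "F = E" using E unfolding maximal_subfield_def by blast
  thus ?thesis using TF by (auto simp: T_def)
qed

lemma poly_mapping_induct_single [case_names single add]:
  assumes "\<And>w c. P (Poly_Mapping.single w c)" "\<And>p q. P p \<Longrightarrow> P q \<Longrightarrow> P (p + q)"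
  shows "P (p :: 'a \<Rightarrow>\<^sub>0 'b::comm_monoid_add)"
proof (induction p rule: update_induct)
  case const
  show ?case using assms(1)[of undefined 0] by simp
next
  case (update f a b)
  have "Poly_Mapping.update a b f = Poly_Mapping.single a b + f"
    using update(1) by (intro poly_mapping_eqI)
      (auto simp: lookup_update lookup_add lookup_single in_keys_iff when_def)
  thus ?case using assms update by simp
qed

lemma contains_free_algebra2_if_free_over_center:
  fixes \<kappa> :: "'k::field \<Rightarrow> 'd::division_ring" and x y :: 'd
  assumes \<kappa>: "algebra_map \<kappa>" and free: "free_over_center x y"
  shows "contains_free_algebra2 \<kappa>"
proof -
  note ks = algebra_map_simps[OF \<kappa>]
  let ?W = "\<lambda>w. word_value x y (letters w)"
  define \<phi> :: "'k free_algebra2 \<Rightarrow> 'd" where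
    "\<phi> p = (\<Sum>w\<in>Poly_Mapping.keys p. \<kappa> (Poly_Mapping.lookup p w) * ?W w)" for p
  have \<phi>_super: "\<phi> p = (\<Sum>w\<in>S. \<kappa> (Poly_Mapping.lookup p w) * ?W w)"
    if "finite S" "Poly_Mapping.keys p \<subseteq> S" for p S
    unfolding \<phi>_def
  proof (rule sum.mono_neutral_left[OF that], rule ballI)
    fix w assume "w \<in> S - Poly_Mapping.keys p"
    hence "Poly_Mapping.lookup p w = 0" by (simp add: in_keys_iff)
    thus "\<kappa> (Poly_Mapping.lookup p w) * ?W w = 0" by (simp only: ks(2) mult_zero_left)
  qed
  have \<phi>_single: "\<phi> (Poly_Mapping.single w c) = \<kappa> c * ?W w" for w c
    by (subst \<phi>_super[of "{w}"]) auto
  have \<phi>_add: "\<phi> (p + q) = \<phi> p + \<phi> q" for p q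
  proof -
    let ?S = "Poly_Mapping.keys p \<union> Poly_Mapping.keys q"
    have "\<phi> (p + q) = (\<Sum>w\<in>?S. \<kappa> (Poly_Mapping.lookup (p + q) w) * ?W w)"
      by (rule \<phi>_super) (use Poly_Mapping.keys_add[of p q] in auto)
    also have "\<dots> = (\<Sum>w\<in>?S. \<kappa> (Poly_Mapping.lookup p w) * ?W w) + (\<Sum>w\<in>?S. \<kappa> (Poly_Mapping.lookup q w) * ?W w)"
      by (simp add: lookup_add ks(3) distrib_right sum.distrib)
    finally show ?thesis using \<phi>_super[of ?S p] \<phi>_super[of ?S q] by simp
  qed
  have W_add: "?W (v + w) = ?W v * ?W w" for v w
    by (simp add: plus_word_def word_value_def)
  have \<phi>_mult: "\<phi> (p * q) = \<phi> p * \<phi> q" for p q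
  proof (induction p rule: poly_mapping_induct_single)
    case (single v a)
    show ?case
    proof (induction q rule: poly_mapping_induct_single)
      case (single w c)
      have "\<kappa> a * ?W v * (\<kappa> c * ?W w) = \<kappa> a * (?W v * \<kappa> c) * ?W w" by (simp only: mult.assoc)
      also have "?W v * \<kappa> c = \<kappa> c * ?W v" by (rule ks(7)[symmetric])
      finally have eq: "\<kappa> a * ?W v * (\<kappa> c * ?W w) = \<kappa> a * (\<kappa> c * ?W v) * ?W w" .
      show ?case unfolding mult_single \<phi>_single W_add ks(4) eq by (simp only: mult.assoc)
    qed (simp_all add: distrib_left \<phi>_add)
  qed (simp_all add: distrib_right \<phi>_add)
  have W0: "?W 0 = 1" by (simp add: zero_word_def)
  have hom: "ring_homomorphism \<phi>"
    unfolding ring_homomorphism_def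
    using \<phi>_add \<phi>_mult \<phi>_single[of 0 1] by (simp add: W0 ks(1))
  have scal: "\<phi> (free_scalar c) = \<kappa> c" for c by (simp add: free_scalar_def \<phi>_single W0)
  have gen: "\<phi> (free_gen True) = x" "\<phi> (free_gen False) = y" by (simp_all add: free_gen_def \<phi>_single ks(1))
  have zero: "p = 0" if p: "\<phi> p = 0" for p
  proof -
    have inj: "inj_on letters (Poly_Mapping.keys p)" by (auto intro!: inj_onI word.expand)
    have "(\<Sum>w\<in>letters ` Poly_Mapping.keys p. \<kappa> (Poly_Mapping.lookup p (Word w)) * word_value x y w) = 0"
      using p unfolding \<phi>_def by (simp add: sum.reindex[OF inj])
    moreover have "\<kappa> c \<in> center" for c using ks(7)[of c] by (simp add: center_def)
    ultimately have rel: "finite (letters ` Poly_Mapping.keys p)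
      \<and> (\<forall>w\<in>letters ` Poly_Mapping.keys p. \<kappa> (Poly_Mapping.lookup p (Word w)) \<in> center)
      \<and> (\<Sum>w\<in>letters ` Poly_Mapping.keys p. \<kappa> (Poly_Mapping.lookup p (Word w)) * word_value x y w) = 0"
      by simp
    have "\<forall>w\<in>letters ` Poly_Mapping.keys p. \<kappa> (Poly_Mapping.lookup p (Word w)) = 0"
      by (rule free[unfolded free_over_center_def, THEN spec, THEN spec, THEN mp, OF rel])
    hence "Poly_Mapping.lookup p w = 0" for w
      by (cases "w \<in> Poly_Mapping.keys p")
         (auto simp: algebra_map_eq_0_iff[OF \<kappa> one_neq_zero] in_keys_iff)
    thus ?thesis by (intro poly_mapping_eqI) simp
  qed
  have "inj \<phi>"
  proof (rule injI)
    fix p q assume "\<phi> p = \<phi> q"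
    moreover have "\<phi> (p - q) + \<phi> q = \<phi> p" unfolding \<phi>_add[symmetric] by simp
    ultimately have "\<phi> (p - q) = 0" by simp
    from zero[OF this] show "p = q" by simp
  qed
  moreover have "range \<phi> = subalgebra_gen \<kappa> {x, y}"
  proof (intro equalityI subsetI)
    fix d assume "d \<in> range \<phi>"
    then obtain p where d: "d = \<phi> p" by blast
    have wv: "word_value x y w \<in> subalgebra_gen \<kappa> {x, y}" for w
    proof (induction w)
      case Nil
      show ?case using subalgebra_gen.scalar[of \<kappa> 1] ks(1) by simp
    qed (auto intro: subalgebra_gen.intros)
    show "d \<in> subalgebra_gen \<kappa> {x, y}" unfolding d
    proof (induction p rule: poly_mapping_induct_single)
      case (single v a)
      show ?case unfolding \<phi>_single by (intro subalgebra_gen.mult subalgebra_gen.scalar wv)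
    qed (simp add: \<phi>_add subalgebra_gen.add)
  next
    fix d assume "d \<in> subalgebra_gen \<kappa> {x, y}"
    thus "d \<in> range \<phi>"
    proof induction
      case (generator z)
      thus ?case using gen by (metis insertE rangeI singletonD)
    next
      case (scalar c)
      thus ?case using scal by (metis rangeI)
    next
      case (add d d')
      thus ?case using \<phi>_add by (metis rangeE rangeI)
    next
      case (mult d d')
      thus ?case using \<phi>_mult by (metis rangeE rangeI)
    qed
  qed
  ultimately have "bij_betw \<phi> UNIV (subalgebra_gen \<kappa> {x, y})" by (simp add: bij_betw_def)
  thus ?thesis unfolding contains_free_algebra2_def freely_generates_def
    using hom scal gen by blast
qed

theorem theorem1p2:
  fixes \<eta> :: "'k::{alg_closed_field, field_char_0} \<Rightarrow> 'a::ring_1_no_zero_divisors"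
    and \<iota> :: "'a \<Rightarrow> 'd::division_ring"
  assumes "uncountable (UNIV :: 'k set)"
    and "algebra_map \<eta>"
    and "countably_generated_algebra \<eta>"
    and "noetherian TYPE('a)"
    and "ore_quotient_division_ring \<iota>"
    and "\<not> contains_free_algebra2 (\<iota> \<circ> \<eta>)"
  shows "\<forall>E. maximal_subfield E \<longrightarrow> left_algebraic_over (E :: 'd set)"
proof (intro allI impI)
  fix E :: "'d set" assume E: "maximal_subfield E"
  define \<kappa> where "\<kappa> = \<iota> \<circ> \<eta>"
  have \<kappa>: "algebra_map \<kappa>" unfolding \<kappa>_def by (rule algebra_map_ore_quotient[OF assms(2,5)])
  note ks = algebra_map_simps[OF \<kappa>]
  have kc: "\<kappa> c \<in> center" for c using ks(7)[of c] by (simp add: center_def)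
  have kinj: "inj \<kappa>"
  proof (rule injI)
    fix a b assume "\<kappa> a = \<kappa> b"
    hence "\<kappa> (a - b) = 0" by (simp add: ks(6))
    thus "a = b" using algebra_map_eq_0_iff[OF \<kappa> one_neq_zero] by simp
  qed
  have char0: "of_nat n \<noteq> (0 :: 'd)" if "n > 0" for n
  proof -
    have "\<kappa> (of_nat n) = of_nat n" by (induction n) (simp_all add: ks(1,2,3))
    thus ?thesis using algebra_map_eq_0_iff[OF \<kappa> one_neq_zero, of "of_nat n"] that by simp
  qed
  have unc: "uncountable (center :: 'd set)"
  proof
    assume "countable (center :: 'd set)"
    hence "countable (range \<kappa>)" using kc by (meson countable_subset image_subsetI)
    thus False using assms(1) countable_image_inj_on[OF _ kinj] by blast
  qed
  have nofree: "\<nexists>x y :: 'd. free_over_center x y"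
    using contains_free_algebra2_if_free_over_center[OF \<kappa>] assms(6) unfolding \<kappa>_def by blast
  have dep: "dependent_powers e y" for e y :: 'd
    by (rule powers_dependent_if_not_free[OF unc nofree])
  have dep': "dependent_powers a b" for a b :: "'d ratfun"
    by (rule powers_dependent_if_not_free[OF uncountable_center_ratfun[OF unc]])
       (use free_over_center_descends[OF unc] nofree in blast)
  have sub: "is_subfield E" using E unfolding maximal_subfield_def by blast
  have kE: "\<iota> (\<eta> c) \<in> E" for c
    using maximal_subfield_self_centralizing[OF E, of "\<kappa> c"] center_commute[OF kc] by (simp add: \<kappa>_def)
  have "left_noetherian TYPE('a)" using assms(4) unfolding noetherian_def by blast
  from subfield_finite_centralizer[OF assms(1,2,3) this assms(5) sub kE]
  obtain F where F: "finite F" "F \<subseteq> E"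
    and FE: "\<forall>u. (\<forall>e\<in>F. e * u = u * e) \<longrightarrow> (\<forall>e\<in>E. e * u = u * e)"
    by (elim exE conjE) (rule that)
  obtain es :: "nat \<Rightarrow> 'd" and r where es: "F = es ` {i. i < r}"
    using finite_imp_nat_seg_image_inj_on[OF F(1)] by blast
  have com: "es i * es j = es j * es i" if "i < r" "j < r" for i j
    using sub F(2) es that unfolding is_subfield_def by blast
  show "left_algebraic_over E"
    unfolding left_algebraic_over_def
  proof
    fix x :: 'd
    have "\<exists>(m::nat) c. (\<forall>i\<le>m. \<forall>j<r. c i * es j = es j * c i) \<and> (\<exists>i\<le>m. c i \<noteq> 0) \<and> (\<Sum>i\<le>m. c i * x ^ i) = 0"
      by (rule left_algebraic_over_finite_centralizer[OF com char0 dep dep'])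
    then obtain m :: nat and c where c: "\<And>i j. i \<le> m \<Longrightarrow> j < r \<Longrightarrow> c i * es j = es j * c i"
      "\<exists>i\<le>m. c i \<noteq> 0" "(\<Sum>i\<le>m. c i * x ^ i) = 0" by blast
    have "c i \<in> E" if "i \<le> m" for i
    proof (rule maximal_subfield_self_centralizing[OF E])
      fix e assume e: "e \<in> E"
      have "\<forall>e\<in>F. e * c i = c i * e"
        unfolding es using c(1)[OF that] by simp
      hence "\<forall>e\<in>E. e * c i = c i * e" by (rule FE[THEN spec, THEN mp])
      thus "e * c i = c i * e" using e by (rule bspec)
    qed
    thus "\<exists>(m::nat) c. (\<forall>i\<le>m. c i \<in> E) \<and> (\<exists>i\<le>m. c i \<noteq> 0) \<and> (\<Sum>i\<le>m. c i * x ^ i) = 0"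
      using c(2,3) by blast
  qed
qed

end
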